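(* Let $\Omega\subset\mathbb{R}$ be an open set and let $f:\Omega\times\mathbb{R}\times\mathbb{R}\to[0,+\infty)$, $(x,s,\xi)\mapsto f(x,s,\xi)$, satisfy: (H1) $f$ is continuous on $\Omega\times\mathbb{R}\times\mathbb{R}$, and for every $(x,s)\in\Omega\times\mathbb{R}$ the map $\xi\mapsto f(x,s,\xi)$ is convex on $\mathbb{R}$; (H4) on every compact set $\Omega'\times H\times K\subset\Omega\times\mathbb{R}\times\mathbb{R}$, $f$ is absolutely continuous in $x$, uniformly in $(s,\xi)$: for every $\varepsilon>0$ there is $\delta>0$ such that for every $(s,\xi)\in H\times K$ and every finite family of pairwise disjoint open intervals $(a_i,b_i)\subset\Omega'$, $i=1,\dots,N$, with $\sum_i(b_i-a_i)<\delta$, one has $\sum_i|f(b_i,s,\xi)-f(a_i,s,\xi)|<\varepsilon$. Then the functional $F(u,\Omega)=\int_\Omega f(x,u(x),u'(x))\,dx$ is lower semicontinuous on $W^{1,1}_{loc}(\Omega)$ with respect to strong convergence in $L^1_{loc}(\Omega)$: whenever $u_m,u\in W^{1,1}_{loc}(\Omega)$ and $u_m\to u$ in $L^1_{loc}(\Omega)$, we have $\liminf_{m\to\infty}F(u_m,\Omega)\ge F(u,\Omega)$.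
   Context: $W^{1,1}_{loc}(\Omega)$ denotes the functions $u\in L^1_{loc}(\Omega)$ whose weak derivative $u'$ lies in $L^1_{loc}(\Omega)$. Convergence $u_m\to u$ in $L^1_{loc}(\Omega)$ means $\|u_m-u\|_{L^1(K)}\to0$ for every compact $K\subset\Omega$. The integral $F(u,\Omega)$ takes values in $[0,+\infty]$. *)

theory Defs
  imports "HOL-Analysis.Analysis"
begin

definition smooth_fun :: "(real \<Rightarrow> real) \<Rightarrow> bool" where
  "smooth_fun \<phi> \<longleftrightarrow> (\<forall>n x. ((deriv ^^ n) \<phi>) differentiable (at x))"

definition test_fun :: "real set \<Rightarrow> (real \<Rightarrow> real) \<Rightarrow> bool" where
  "test_fun \<Omega> \<phi> \<longleftrightarrow> smooth_fun \<phi> \<and> compact (closure {x. \<phi> x \<noteq> 0})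
      \<and> closure {x. \<phi> x \<noteq> 0} \<subseteq> \<Omega>"

definition L1_loc :: "real set \<Rightarrow> (real \<Rightarrow> real) \<Rightarrow> bool" where
  "L1_loc \<Omega> u \<longleftrightarrow> (\<forall>K. compact K \<and> K \<subseteq> \<Omega> \<longrightarrow> set_integrable lebesgue K u)"

definition weak_deriv :: "real set \<Rightarrow> (real \<Rightarrow> real) \<Rightarrow> (real \<Rightarrow> real) \<Rightarrow> bool" where
  "weak_deriv \<Omega> u v \<longleftrightarrow> (\<forall>\<phi>. test_fun \<Omega> \<phi> \<longrightarrow>
      (\<integral>x. u x * deriv \<phi> x \<partial>lebesgue) = - (\<integral>x. v x * \<phi> x \<partial>lebesgue))"

definition W11_loc :: "real set \<Rightarrow> (real \<Rightarrow> real) \<Rightarrow> (real \<Rightarrow> real) \<Rightarrow> bool" where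
  "W11_loc \<Omega> u v \<longleftrightarrow> L1_loc \<Omega> u \<and> L1_loc \<Omega> v \<and> weak_deriv \<Omega> u v"

definition L1_loc_conv :: "real set \<Rightarrow> (nat \<Rightarrow> real \<Rightarrow> real) \<Rightarrow> (real \<Rightarrow> real) \<Rightarrow> bool" where
  "L1_loc_conv \<Omega> us u \<longleftrightarrow> (\<forall>K. compact K \<and> K \<subseteq> \<Omega> \<longrightarrow>
      (\<lambda>m. \<integral>\<^sup>+ x. ennreal \<bar>us m x - u x\<bar> * indicator K x \<partial>lebesgue) \<longlonglongrightarrow> 0)"

definition F_functional :: "(real \<Rightarrow> real \<Rightarrow> real \<Rightarrow> real) \<Rightarrow> real set \<Rightarrow> (real \<Rightarrow> real) \<Rightarrow> (real \<Rightarrow> real) \<Rightarrow> ennreal" where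
  "F_functional f \<Omega> u u' = (\<integral>\<^sup>+ x. ennreal (f x (u x) (u' x)) * indicator \<Omega> x \<partial>lebesgue)"

definition H4 :: "(real \<Rightarrow> real \<Rightarrow> real \<Rightarrow> real) \<Rightarrow> real set \<Rightarrow> bool" where
  "H4 f \<Omega> \<longleftrightarrow> (\<forall>\<Omega>' H K. compact \<Omega>' \<and> \<Omega>' \<subseteq> \<Omega> \<and> compact H \<and> compact K \<longrightarrow>
     (\<forall>\<epsilon>>0. \<exists>\<delta>>0. \<forall>s\<in>H. \<forall>\<xi>\<in>K. \<forall>(N::nat) (a::nat \<Rightarrow> real) b.
        (\<forall>i<N. a i < b i \<and> {a i<..<b i} \<subseteq> \<Omega>') \<and>
        (\<forall>i<N. \<forall>j<N. i \<noteq> j \<longrightarrow> {a i<..<b i} \<inter> {a j<..<b j} = {}) \<and>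
        (\<Sum>i<N. b i - a i) < \<delta> \<longrightarrow>
        (\<Sum>i<N. \<bar>f (b i) s \<xi> - f (a i) s \<xi>\<bar>) < \<epsilon>))"

end

theory Submission
  imports Defs
begin

text \<open>
  If \<open>f(x,s,\<cdot>)\<close> oscillates by at most \<open>\<epsilon>\<close> on \<open>[p,p+h]\<close>, convexity makes
  \<open>f(x,s,p) + b(x,s)(\<xi> - p) - 2\<epsilon>\<close> with \<open>b(x,s) = (f(x,s,p+h) - f(x,s,p))/h\<close> an affine minorant whose slope inherits
  absolute continuity in \<open>x\<close> from \<open>f\<close>. Multiplied by Lipschitz cutoffs in \<open>x\<close> and \<open>s\<close> it stays below \<open>f \<ge> 0\<close>, and the
  resulting functional is continuous under \<open>L\<^sup>1\<close> convergence. The delicate term is \<open>\<integral> B(x,u) u'\<close>: freezing \<open>x\<close> on the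
  intervals of a uniform partition and summing by parts, the difference of this term at \<open>u\<close> and \<open>w\<close> becomes
  \<open>\<Sum>\<^sub>i \<integral> (B(x\<^sub>i,t) - B(x\<^sub>i\<^sub>+\<^sub>1,t)) dt\<close> over the segments between \<open>w(x\<^sub>i\<^sub>+\<^sub>1)\<close> and \<open>u(x\<^sub>i\<^sub>+\<^sub>1)\<close>. Absolute continuity, uniform in \<open>t\<close>,
  bounds it by \<open>2R\<epsilon> + C \<parallel>u - w\<parallel>\<^sub>1\<close>, with no bound on \<open>u'\<close> entering. These local lower bounds are then glued
  over countably many cells in which the slope \<open>u'\<close> of the limit is almost constant, using inner regularity and superadditivity of the lower limit.
\<close>

section \<open>Smooth bump functions\<close>

text \<open>No growth of \<open>f\<close> in the last variable is assumed, so the derivatives of the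
  approximating sequence need be neither bounded in mean nor weakly convergent. The slope of the
  minorant is a secant slope rather than a subgradient because \<open>H4\<close> speaks of values of
  \<open>f\<close> only: a difference of two values over a fixed \<open>h\<close> is again
  absolutely continuous in \<open>x\<close>, whereas a subgradient need not be. \<open>H4\<close>
  bounds variation sums at one fixed \<open>s\<close>, while along a function the value changes from
  cell to cell. Interchanging the sum over cells with the integral over levels \<open>t\<close>
  restores a fixed level: only the cells whose segment contains \<open>t\<close> count, and their
  total length, integrated over \<open>t\<close>, is a Riemann sum for the distance of the two
  functions. The loss of 4 \<epsilon> in the later estimates is 2 \<epsilon> for the minorant,
  \<epsilon> for comparing \<open>f\<close> at \<open>u'\<close> and at \<open>p\<close>, and
  \<epsilon> for the secant term. Summation by parts needs continuous representatives, whereas weak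
  derivatives are tested against smooth functions only; smooth bumps bridge the two.\<close>

definition flat_exp :: "nat \<Rightarrow> real \<Rightarrow> real" where
  "flat_exp k y = (if y > 0 then inverse y ^ k * exp (- inverse y) else 0)"

text \<open>The substitution t = 1/h reduces this to the decay of t^(k+1) exp(-t). The quotient is
  the difference quotient of \<open>flat_exp k\<close> at 0, the one point where its two branches
  meet.\<close>

lemma flat_exp_over_tendsto_0: "((\<lambda>h. flat_exp k h / h) \<longlongrightarrow> 0) (at 0)"
proof -
  have *: "((\<lambda>t::real. t ^ Suc k / exp t) \<longlongrightarrow> 0) at_top"
    by (rule tendsto_power_div_exp_0)
  have "((\<lambda>h::real. inverse h ^ Suc k / exp (inverse h)) \<longlongrightarrow> 0) (at_right 0)"
    by (rule filterlim_compose[OF * filterlim_inverse_at_top_right])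
  moreover have "\<forall>\<^sub>F h in at_right 0. inverse h ^ Suc k / exp (inverse h) = flat_exp k h / h"
    by (rule eventually_at_right_less[THEN eventually_mono])
      (auto simp: flat_exp_def exp_minus divide_simps)
  ultimately have "((\<lambda>h. flat_exp k h / h) \<longlongrightarrow> 0) (at_right 0)"
    by (blast intro: Lim_transform_eventually)
  moreover have "((\<lambda>h. flat_exp k h / h) \<longlongrightarrow> 0) (at_left 0)"
    by (rule tendsto_eventually, rule eventually_at_leftI[of "-1"]) (auto simp: flat_exp_def)
  ultimately show ?thesis
    by (simp add: filterlim_split_at)
qed

text \<open>The power factor is carried along because it closes the family under differentiation, up
  to linear combinations.\<close>

lemma flat_exp_has_derivative:
  "(flat_exp k has_real_derivative flat_exp (k + 2) y - real k * flat_exp (k + 1) y) (at y)"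
proof -
  consider "y > 0" | "y = 0" | "y < 0" by linarith
  then show ?thesis
  proof cases
    case 1
    have "((\<lambda>y. inverse y ^ k * exp (- inverse y)) has_real_derivative
        flat_exp (k + 2) y - real k * flat_exp (k + 1) y) (at y)"
      using 1 by (cases k) (auto intro!: derivative_eq_intros simp: flat_exp_def field_simps power2_eq_square,
          metis One_nat_def power_eq_if)
    then show ?thesis
      by (rule has_field_derivative_transform_within_open[of _ _ _ "{0<..}"]) (use 1 in \<open>auto simp: flat_exp_def\<close>)
  next
    case 2
    then show ?thesis
      using flat_exp_over_tendsto_0[of k] by (simp add: DERIV_def) (simp add: flat_exp_def)
  next
    case 3
    have "((\<lambda>y. 0) has_real_derivative flat_exp (k + 2) y - real k * flat_exp (k + 1) y) (at y)"
      using 3 by (simp add: flat_exp_def)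
    then show ?thesis
      by (rule has_field_derivative_transform_within_open[of _ _ _ "{..<0}"]) (use 3 in \<open>auto simp: flat_exp_def\<close>)
  qed
qed

text \<open>Each rule yields functions whose derivative is again in the class, so infinite
  differentiability follows by induction on the order without computing iterated derivatives. The
  rule \<open>antideriv\<close> admits the primitives that will serve as test functions.\<close>

inductive smooth_gen :: "(real \<Rightarrow> real) \<Rightarrow> bool" where
  flat: "smooth_gen (\<lambda>x. flat_exp k (\<alpha> * x + \<beta>))"
| const: "smooth_gen (\<lambda>x. c)"
| add: "smooth_gen g \<Longrightarrow> smooth_gen h \<Longrightarrow> smooth_gen (\<lambda>x. g x + h x)"
| mult: "smooth_gen g \<Longrightarrow> smooth_gen h \<Longrightarrow> smooth_gen (\<lambda>x. g x * h x)"
| antideriv: "smooth_gen g \<Longrightarrow> (\<And>x. (h has_real_derivative g x) (at x)) \<Longrightarrow> smooth_gen h"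

lemma smooth_gen_has_derivative:
  assumes "smooth_gen g"
  shows "\<exists>g'. smooth_gen g' \<and> (\<forall>x. (g has_real_derivative g' x) (at x))"
  using assms
proof induction
  case (flat k \<alpha> \<beta>)
  let ?g = "\<lambda>x. (flat_exp (k+2) (\<alpha> * x + \<beta>) + (- real k) * flat_exp (k+1) (\<alpha> * x + \<beta>)) * \<alpha>"
  have "smooth_gen ?g" by (intro smooth_gen.intros)
  moreover have "((\<lambda>x. flat_exp k (\<alpha> * x + \<beta>)) has_real_derivative ?g x) (at x)" for x
  proof -
    have "((\<lambda>x. \<alpha> * x + \<beta>) has_real_derivative \<alpha>) (at x)"
      by (auto intro!: derivative_eq_intros)
    from DERIV_chain2[OF flat_exp_has_derivative[of k] this] show ?thesis by simp
  qed
  ultimately show ?case by blast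
next
  case (const c)
  show ?case by (intro exI[of _ "\<lambda>x. 0"]) (auto intro: smooth_gen.const)
next
  case (add g h)
  then obtain g' h' where *: "smooth_gen g'" "smooth_gen h'" "\<And>x. (g has_real_derivative g' x) (at x)"
    "\<And>x. (h has_real_derivative h' x) (at x)" by blast
  show ?case by (intro exI[of _ "\<lambda>x. g' x + h' x"]) (auto intro!: smooth_gen.add DERIV_add *)
next
  case (mult g h)
  then obtain g' h' where *: "smooth_gen g'" "smooth_gen h'" "\<And>x. (g has_real_derivative g' x) (at x)"
    "\<And>x. (h has_real_derivative h' x) (at x)" by blast
  show ?case
    by (intro exI[of _ "\<lambda>x. g' x * h x + h' x * g x"])
      (auto intro!: smooth_gen.add smooth_gen.mult DERIV_mult * mult)
next
  case (antideriv g h)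
  then show ?case by blast
qed

lemma smooth_gen_imp_smooth_fun:
  assumes "smooth_gen g"
  shows "smooth_fun g"
proof -
  have "smooth_gen ((deriv ^^ n) g)" for n
  proof (induction n)
    case (Suc n)
    then obtain g' where "smooth_gen g'" "\<And>x. ((deriv ^^ n) g has_real_derivative g' x) (at x)"
      using smooth_gen_has_derivative by blast
    then have "deriv ((deriv ^^ n) g) = g'"
      by (auto intro: DERIV_imp_deriv)
    with \<open>smooth_gen g'\<close> show ?case by simp
  qed (use assms in simp)
  then show ?thesis
    unfolding smooth_fun_def using smooth_gen_has_derivative real_differentiable_def by metis
qed

lemma smooth_gen_continuous: "smooth_gen g \<Longrightarrow> continuous_on S g"
  by (meson DERIV_continuous_on has_field_derivative_at_within smooth_gen_has_derivative)

text \<open>Increasing \<open>n\<close> steepens both edges, so the bumps approach the indicator of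
  the open interval. The arguments are spelled in the form \<open>\<alpha> * x + \<beta>\<close> to
  match the rule \<open>flat\<close>.\<close>

definition smooth_bump :: "nat \<Rightarrow> real \<Rightarrow> real \<Rightarrow> real \<Rightarrow> real" where
  "smooth_bump n a b x =
     flat_exp 0 (real (Suc n) * x + - real (Suc n) * a) * flat_exp 0 (- real (Suc n) * x + real (Suc n) * b)"

lemma smooth_gen_bump: "smooth_gen (smooth_bump n a b)"
  unfolding smooth_bump_def[abs_def] by (intro smooth_gen.intros)

lemma smooth_bump_bounds: "0 \<le> smooth_bump n a b x" "smooth_bump n a b x \<le> 1"
proof -
  have *: "0 \<le> flat_exp 0 y" "flat_exp 0 y \<le> 1" for y
    by (auto simp: flat_exp_def)
  show "0 \<le> smooth_bump n a b x" "smooth_bump n a b x \<le> 1"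
    unfolding smooth_bump_def by (auto intro!: mult_nonneg_nonneg mult_le_one *)
qed

lemma smooth_bump_eq_0: "x \<le> a \<or> b \<le> x \<Longrightarrow> smooth_bump n a b x = 0"
proof -
  assume *: "x \<le> a \<or> b \<le> x"
  have "real (Suc n) * x + - real (Suc n) * a = real (Suc n) * (x - a)"
    "- real (Suc n) * x + real (Suc n) * b = real (Suc n) * (b - x)"
    by (simp_all add: algebra_simps)
  then show ?thesis
    unfolding smooth_bump_def flat_exp_def using * by (auto simp only: zero_less_mult_iff) auto
qed

lemma smooth_bump_tendsto: "(\<lambda>n. smooth_bump n a b x) \<longlonglongrightarrow> indicator {a<..<b} x"
proof (cases "x \<in> {a<..<b}")
  case True
  have *: "(\<lambda>n. flat_exp 0 (real (Suc n) * t)) \<longlonglongrightarrow> 1" if "t > 0" for t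
  proof -
    have "(\<lambda>n. exp (- (inverse t * inverse (real (Suc n))))) \<longlonglongrightarrow> exp (- (inverse t * 0))"
      by (intro tendsto_intros LIMSEQ_inverse_real_of_nat)
    then show ?thesis
      using that by (simp add: flat_exp_def zero_less_mult_iff mult.commute del: of_nat_Suc)
  qed
  have "(\<lambda>n. flat_exp 0 (real (Suc n) * (x - a)) * flat_exp 0 (real (Suc n) * (b - x))) \<longlonglongrightarrow> 1 * 1"
    by (intro tendsto_mult *) (use True in auto)
  then show ?thesis
    using True by (simp add: smooth_bump_def algebra_simps del: of_nat_Suc)
next
  case False
  then show ?thesis by (auto simp: smooth_bump_eq_0 not_less)
qed

text \<open>Zero mean is what makes the primitive vanish again to the right of the support. These
  primitives are the test functions in the du Bois-Reymond argument for weak derivatives.\<close>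

lemma test_fun_antiderivative:
  assumes g: "smooth_gen g" and zero: "\<And>x. x \<le> c \<or> d \<le> x \<Longrightarrow> g x = 0"
    and int0: "integral {c..d} g = 0" and sub: "{c..d} \<subseteq> \<Omega>"
  obtains \<phi> where "test_fun \<Omega> \<phi>" "\<And>x. (\<phi> has_real_derivative g x) (at x)" "\<And>x. x \<notin> {c..d} \<Longrightarrow> \<phi> x = 0"
    "\<phi> c = 0" "\<phi> d = 0"
proof -
  \<comment> \<open>Starting at \<open>c - 1\<close> makes every point \<open>x \<ge> c\<close>
    interior to \<open>{c-1..x+1}\<close>, so the derivative within that interval is a two-sided
    one.\<close>
  define \<phi> where "\<phi> x = integral {c-1..x} g" for x
  have int: "g integrable_on {a..b}" for a b
    by (intro integrable_continuous_real smooth_gen_continuous g)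
  have 0: "\<phi> x = 0" if "x \<le> c" for x
    unfolding \<phi>_def by (intro integral_unique has_integral_is_0) (use that zero in auto)
  have 1: "\<phi> x = 0" if "x \<ge> d" for x
  proof (cases "c \<le> d")
    case True
    have "\<phi> x = integral {c-1..c} g + integral {c..d} g + integral {d..x} g"
      unfolding \<phi>_def using True that
      by (subst Henstock_Kurzweil_Integration.integral_combine, simp_all add: int)+
    moreover have "integral {c-1..c} g = 0" using 0[of c] by (simp add: \<phi>_def)
    moreover have "integral {d..x} g = 0"
      by (rule integral_unique, rule has_integral_is_0) (use zero in auto)
    ultimately show ?thesis using int0 by simp
  next
    case False
    then have "g y = 0" for y using zero[of y] by linarith
    then show ?thesis unfolding \<phi>_def by (intro integral_unique has_integral_is_0) auto
  qed
  have deriv: "(\<phi> has_real_derivative g x) (at x)" for x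
  proof (cases "x < c")
    case True
    have "((\<lambda>x. 0) has_real_derivative g x) (at x)"
      using zero[of x] True by simp
    then show ?thesis
      by (rule has_field_derivative_transform_within_open[of _ _ _ "{..<c}"]) (use True 0 in auto)
  next
    case False
    have "(\<phi> has_real_derivative g x) (at x within {c-1..x+1})"
      unfolding \<phi>_def[abs_def] using False
      by (intro integral_has_real_derivative smooth_gen_continuous g) auto
    moreover have "at x within {c-1..x+1} = at x"
      using False by (intro at_within_Icc_at) auto
    ultimately show ?thesis by simp
  qed
  have out: "\<phi> x = 0" if "x \<notin> {c..d}" for x
    using 0[of x] 1[of x] that by auto
  have sg: "smooth_gen \<phi>"
    by (rule smooth_gen.antideriv[OF g deriv])
  have cl: "closure {x. \<phi> x \<noteq> 0} \<subseteq> {c..d}"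
    by (rule closure_minimal) (use out in \<open>blast, simp\<close>)
  have "test_fun \<Omega> \<phi>"
    unfolding test_fun_def
    using smooth_gen_imp_smooth_fun[OF sg] cl sub
    by (meson bounded_subset closed_closure compact_Icc compact_eq_bounded_closed compact_imp_bounded order_trans)
  then show ?thesis
    using that deriv out 0[of c] 1[of d] by auto
qed

section \<open>Approximation in mean by continuous functions\<close>

lemma dominated_convergence_ae:
  fixes f :: "nat \<Rightarrow> real \<Rightarrow> real"
  assumes f: "\<And>k. (f k) integrable_on S" and h: "h integrable_on S" and N: "negligible N"
    and le: "\<And>k x. x \<in> S - N \<Longrightarrow> norm (f k x) \<le> h x"
    and conv: "\<And>x. x \<in> S - N \<Longrightarrow> (\<lambda>k. f k x) \<longlonglongrightarrow> g x"
  shows "g integrable_on S" "(\<lambda>k. integral S (f k)) \<longlonglongrightarrow> integral S g"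
proof -
  have N': "negligible ((S - N - S) \<union> (S - (S - N)))"
    by (rule negligible_subset[OF N]) auto
  have eq: "(q integrable_on (S - N)) = (q integrable_on S)" for q :: "real \<Rightarrow> real"
    by (rule integrable_spike_set_eq) (use N' in \<open>simp add: Un_commute\<close>)
  have int_eq: "integral (S - N) q = integral S q" for q :: "real \<Rightarrow> real"
    by (rule integral_spike_set; rule negligible_subset[OF N]) auto
  have 1: "f k integrable_on (S - N)" "h integrable_on (S - N)" for k
    using f h by (auto simp: eq)
  show "g integrable_on S"
    using dominated_convergence(1)[OF 1 le conv] eq by blast
  show "(\<lambda>k. integral S (f k)) \<longlonglongrightarrow> integral S g"
    using dominated_convergence(2)[OF 1 le conv] by (simp add: int_eq)
qed

lemma absolutely_integrable_cont_mult:
  fixes g v :: "real \<Rightarrow> real"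
  assumes g: "continuous_on {c..d} g" and v: "v absolutely_integrable_on {c..d}"
  shows "(\<lambda>x. g x * v x) absolutely_integrable_on {c..d}"
proof (rule absolutely_integrable_bounded_measurable_product_real[OF _ _ _ v])
  show "g \<in> borel_measurable (lebesgue_on {c..d})"
    by (rule continuous_imp_measurable_on_sets_lebesgue[OF g]) auto
  show "bounded (g ` {c..d})"
    by (intro compact_imp_bounded compact_continuous_image g compact_Icc)
qed auto

lemma continuous_on_Icc_bounded:
  fixes g :: "real \<Rightarrow> real"
  assumes "continuous_on {c..d} g"
  obtains C where "C \<ge> 0" "\<And>x. x \<in> {c..d} \<Longrightarrow> \<bar>g x\<bar> \<le> C"
proof -
  have "bounded (g ` {c..d})"
    by (intro compact_imp_bounded compact_continuous_image assms compact_Icc)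
  then show ?thesis
    using that unfolding bounded_pos by (metis image_eqI less_imp_le real_norm_def)
qed

text \<open>Measurability supplies continuous functions converging almost everywhere, but no common
  bound for them. Clipping them and \<open>v\<close> at the same level \<open>M\<close> gives the
  constant bound \<open>2 * M\<close>; the error of clipping \<open>v\<close> itself is dominated by
  \<open>\<bar>v x\<bar>\<close>.\<close>

lemma absolutely_integrable_approx_continuous:
  fixes v :: "real \<Rightarrow> real"
  assumes v: "v absolutely_integrable_on {c..d}" and "\<epsilon> > 0"
  obtains g where "continuous_on UNIV g" "integral {c..d} (\<lambda>x. \<bar>g x - v x\<bar>) < \<epsilon>"
proof -
  define cl where "cl M y = max (- real M) (min (real M) y)" for M y
  have clcont: "continuous_on UNIV (cl M)" for M
    unfolding cl_def[abs_def] by (intro continuous_intros)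
  have clbound: "\<bar>cl M y\<bar> \<le> real M" for M y by (auto simp: cl_def)
  have vmeas: "v \<in> borel_measurable (lebesgue_on {c..d})"
    using absolutely_integrable_imp_borel_measurable[OF v] by simp
  have clv: "(\<lambda>x. cl M (v x)) \<in> borel_measurable (lebesgue_on {c..d})" for M
    using vmeas by (rule borel_measurable_continuous_on[OF clcont])
  have clvi: "(\<lambda>x. cl M (v x)) absolutely_integrable_on {c..d}" for M
    by (rule measurable_bounded_by_integrable_imp_absolutely_integrable[where g = "\<lambda>x. real M", OF clv])
      (use clbound in auto)
  have ai: "(\<lambda>x. \<bar>p x - q x\<bar>) integrable_on {c..d}"
    if "p absolutely_integrable_on {c..d}" "q absolutely_integrable_on {c..d}" for p q :: "real \<Rightarrow> real"
    using set_integral_diff(1)[OF that] unfolding absolutely_integrable_on_def by simp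
  have "(\<lambda>M. integral {c..d} (\<lambda>x. \<bar>cl M (v x) - v x\<bar>)) \<longlonglongrightarrow> integral {c..d} (\<lambda>x. 0)"
  proof (rule dominated_convergence(2))
    show "(\<lambda>x. \<bar>cl k (v x) - v x\<bar>) integrable_on {c..d}" for k
      by (rule ai[OF clvi v])
    show "(\<lambda>x. \<bar>v x\<bar>) integrable_on {c..d}"
      using v unfolding absolutely_integrable_on_def by simp
    show "norm \<bar>cl k (v x) - v x\<bar> \<le> \<bar>v x\<bar>" for k x by (auto simp: cl_def)
    fix x
    obtain K where "\<bar>v x\<bar> \<le> real K" using real_arch_simple by blast
    then have "\<forall>\<^sub>F k in sequentially. \<bar>cl k (v x) - v x\<bar> = 0"
      by (intro eventually_sequentiallyI[of K]) (auto simp: cl_def)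
    then show "(\<lambda>k. \<bar>cl k (v x) - v x\<bar>) \<longlonglongrightarrow> 0" by (rule tendsto_eventually)
  qed
  then have "\<forall>\<^sub>F M in sequentially. integral {c..d} (\<lambda>x. \<bar>cl M (v x) - v x\<bar>) < \<epsilon> / 2"
    using \<open>\<epsilon> > 0\<close> by (intro order_tendstoD(2)[where y = "integral {c..d} (\<lambda>x. 0)"]) auto
  then obtain M where M: "integral {c..d} (\<lambda>x. \<bar>cl M (v x) - v x\<bar>) < \<epsilon> / 2"
    by (auto simp: eventually_sequentially)
  have "v measurable_on {c..d}"
    using vmeas by (subst measurable_on_iff_borel_measurable) auto
  then obtain N g where N: "negligible N" and g: "\<And>n. continuous_on UNIV (g n)"
    and lim: "\<And>x. x \<notin> N \<Longrightarrow> (\<lambda>n. g n x) \<longlonglongrightarrow> (if x \<in> {c..d} then v x else 0)"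
    unfolding measurable_on_def by blast
  have gc: "continuous_on S (\<lambda>x. cl M (g n x))" for n S
    unfolding cl_def by (intro continuous_intros continuous_on_subset[OF g]) auto
  have gi: "(\<lambda>x. cl M (g n x)) absolutely_integrable_on {c..d}" for n
    by (intro absolutely_integrable_continuous_real gc)
  have "(\<lambda>n. integral {c..d} (\<lambda>x. \<bar>cl M (g n x) - cl M (v x)\<bar>)) \<longlonglongrightarrow> integral {c..d} (\<lambda>x. 0)"
  proof (rule dominated_convergence_ae(2)[OF _ _ N])
    show "(\<lambda>x. \<bar>cl M (g k x) - cl M (v x)\<bar>) integrable_on {c..d}" for k
      by (rule ai[OF gi clvi])
    show "(\<lambda>x. 2 * real M) integrable_on {c..d}" by (rule integrable_const_ivl)
    show "norm \<bar>cl M (g k x) - cl M (v x)\<bar> \<le> 2 * real M" for k x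
      using clbound[of M "g k x"] clbound[of M "v x"] by simp
    fix x assume x: "x \<in> {c..d} - N"
    have "isCont (cl M) (v x)" using clcont continuous_on_eq_continuous_at by blast
    then have "(\<lambda>k. cl M (g k x)) \<longlonglongrightarrow> cl M (v x)"
      using lim[of x] x by (intro isCont_tendsto_compose[of "v x" "cl M"]) auto
    then show "(\<lambda>k. \<bar>cl M (g k x) - cl M (v x)\<bar>) \<longlonglongrightarrow> 0"
      using LIM_zero tendsto_rabs_zero by blast
  qed
  then have "\<forall>\<^sub>F n in sequentially. integral {c..d} (\<lambda>x. \<bar>cl M (g n x) - cl M (v x)\<bar>) < \<epsilon> / 2"
    using \<open>\<epsilon> > 0\<close> by (intro order_tendstoD(2)[where y = "integral {c..d} (\<lambda>x. 0)"]) auto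
  then obtain n where n: "integral {c..d} (\<lambda>x. \<bar>cl M (g n x) - cl M (v x)\<bar>) < \<epsilon> / 2"
    by (auto simp: eventually_sequentially)
  have "integral {c..d} (\<lambda>x. \<bar>cl M (g n x) - v x\<bar>) \<le>
      integral {c..d} (\<lambda>x. \<bar>cl M (g n x) - cl M (v x)\<bar> + \<bar>cl M (v x) - v x\<bar>)"
    by (intro integral_le integrable_add ai gi clvi v) auto
  also have "\<dots> = integral {c..d} (\<lambda>x. \<bar>cl M (g n x) - cl M (v x)\<bar>) + integral {c..d} (\<lambda>x. \<bar>cl M (v x) - v x\<bar>)"
    by (intro Henstock_Kurzweil_Integration.integral_add ai gi clvi v)
  also have "\<dots> < \<epsilon>" using M n by simp
  finally show ?thesis using that[OF gc[of UNIV n]] by blast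
qed

section \<open>The absolutely continuous representative\<close>

lemma primitive_diff_le:
  fixes g v :: "real \<Rightarrow> real"
  assumes v: "v absolutely_integrable_on {c..d}" and g: "g absolutely_integrable_on {c..d}"
    and x: "x \<in> {c..d}"
  shows "\<bar>integral {c..x} g - integral {c..x} v\<bar> \<le> integral {c..d} (\<lambda>y. \<bar>g y - v y\<bar>)"
proof -
  have sub: "{c..x} \<subseteq> {c..d}" using x by auto
  have d: "(\<lambda>y. g y - v y) absolutely_integrable_on {c..d}"
    using g v by (rule set_integral_diff(1))
  have d': "(\<lambda>y. g y - v y) absolutely_integrable_on {c..x}"
    by (rule set_integrable_subset[OF d]) (use sub in auto)
  have i: "g integrable_on {c..x}" "v integrable_on {c..x}"
    using g v sub by (meson integrable_on_subinterval set_lebesgue_integral_eq_integral(1))+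
  have "\<bar>integral {c..x} g - integral {c..x} v\<bar> = norm (integral {c..x} (\<lambda>y. g y - v y))"
    using i by (simp add: Henstock_Kurzweil_Integration.integral_diff)
  also have "\<dots> \<le> integral {c..x} (\<lambda>y. \<bar>g y - v y\<bar>)"
    using d' by (intro integral_norm_bound_integral) (auto simp: absolutely_integrable_on_def)
  also have "\<dots> \<le> integral {c..d} (\<lambda>y. \<bar>g y - v y\<bar>)"
    using d d' sub by (intro integral_subset_le) (auto simp: absolutely_integrable_on_def)
  finally show ?thesis .
qed

lemma primitive_continuous:
  fixes y :: "real \<Rightarrow> real"
  assumes "y absolutely_integrable_on {c..d}"
  shows "continuous_on {c..d} (\<lambda>x. k + integral {c..x} y)"
  using set_lebesgue_integral_eq_integral(1)[OF assms]
  by (intro continuous_intros indefinite_integral_continuous_1)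

text \<open>For a continuous \<open>g\<close> in place of \<open>v\<close> this is the fundamental
  theorem applied to the product. Replacing \<open>v\<close> by a \<open>g\<close> that is
  \<epsilon>-close in mean moves the primitive uniformly by at most \<epsilon>, so the total defect
  is at most \<epsilon> times a constant depending only on \<open>\<phi>\<close>,
  \<open>\<phi>'\<close> and the interval.\<close>

lemma primitive_by_parts:
  fixes v \<phi> \<phi>' :: "real \<Rightarrow> real"
  assumes v: "v absolutely_integrable_on {c..d}" and "c \<le> d"
    and \<phi>: "\<And>x. (\<phi> has_real_derivative \<phi>' x) (at x)" and \<phi>': "continuous_on {c..d} \<phi>'"
    and z: "\<phi> c = 0" "\<phi> d = 0"
  shows "integral {c..d} (\<lambda>x. integral {c..x} v * \<phi>' x) = - integral {c..d} (\<lambda>x. v x * \<phi> x)"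
proof -
  have \<phi>c: "continuous_on {c..d} \<phi>"
    by (meson DERIV_continuous_on \<phi> has_field_derivative_at_within)
  obtain C where C: "\<And>x. x \<in> {c..d} \<Longrightarrow> \<bar>\<phi> x\<bar> \<le> C"
    using continuous_on_Icc_bounded[OF \<phi>c] by blast
  obtain C' where C': "\<And>x. x \<in> {c..d} \<Longrightarrow> \<bar>\<phi>' x\<bar> \<le> C'"
    using continuous_on_Icc_bounded[OF \<phi>'] by blast
  have C0: "C \<ge> 0" "C' \<ge> 0" using C[of c] C'[of c] \<open>c \<le> d\<close> by auto
  let ?L = "integral {c..d} (\<lambda>x. integral {c..x} v * \<phi>' x) + integral {c..d} (\<lambda>x. v x * \<phi> x)"
  let ?D = "C' * (d - c) + C"
  have vint: "v integrable_on {c..d}" using v set_lebesgue_integral_eq_integral(1) by blast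
  have bound: "\<bar>?L\<bar> \<le> \<epsilon> * ?D" if \<epsilon>: "\<epsilon> > 0" for \<epsilon>
  proof -
    obtain g where g: "continuous_on UNIV g" and ge: "integral {c..d} (\<lambda>x. \<bar>g x - v x\<bar>) < \<epsilon>"
      using absolutely_integrable_approx_continuous[OF v \<epsilon>] by blast
    have gc: "continuous_on {c..d} g" using g continuous_on_subset by blast
    have gai: "g absolutely_integrable_on {c..d}" by (rule absolutely_integrable_continuous_real[OF gc])
    define G where "G x = integral {c..x} g" for x
    define V where "V x = integral {c..x} v" for x
    have Gc: "continuous_on {c..d} G" "continuous_on {c..d} V"
      unfolding G_def[abs_def] V_def[abs_def]
      by (intro indefinite_integral_continuous_1 integrable_continuous_real gc vint)+
    have GV: "\<bar>G x - V x\<bar> \<le> \<epsilon>" if "x \<in> {c..d}" for x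
      using primitive_diff_le[OF v gai that] ge by (simp add: G_def V_def)
    have "((\<lambda>x. g x * \<phi> x + \<phi>' x * G x) has_integral G d * \<phi> d - G c * \<phi> c) {c..d}"
    proof (rule fundamental_theorem_of_calculus[OF \<open>c \<le> d\<close>])
      fix x assume x: "x \<in> {c..d}"
      have "(G has_real_derivative g x) (at x within {c..d})"
        unfolding G_def[abs_def] by (rule integral_has_real_derivative[OF gc x])
      from DERIV_mult[OF this has_field_derivative_at_within[OF \<phi>[of x]]]
      show "((\<lambda>x. G x * \<phi> x) has_vector_derivative g x * \<phi> x + \<phi>' x * G x) (at x within {c..d})"
        by (simp add: has_real_derivative_iff_has_vector_derivative)
    qed
    then have i0: "integral {c..d} (\<lambda>x. g x * \<phi> x + \<phi>' x * G x) = 0"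
      using z by (simp add: integral_unique)
    have i1: "(\<lambda>x. v x * \<phi> x) integrable_on {c..d}"
      using absolutely_integrable_cont_mult[OF \<phi>c v] set_lebesgue_integral_eq_integral(1)
      by (auto simp: mult.commute)
    have i2: "(\<lambda>x. V x * \<phi>' x) integrable_on {c..d}" "(\<lambda>x. g x * \<phi> x + \<phi>' x * G x) integrable_on {c..d}"
      by (intro integrable_continuous_real continuous_intros Gc \<phi>' \<phi>c gc)+
    have i3: "(\<lambda>x. \<bar>g x - v x\<bar>) integrable_on {c..d}"
      using set_integral_diff(1)[OF gai v] by (simp add: absolutely_integrable_on_def)
    have "?L = integral {c..d} (\<lambda>x. V x * \<phi>' x + v x * \<phi> x)"
      using i1 i2 by (simp add: Henstock_Kurzweil_Integration.integral_add V_def)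
    also have "\<dots> = integral {c..d} (\<lambda>x. (V x * \<phi>' x + v x * \<phi> x) - (g x * \<phi> x + \<phi>' x * G x))"
      using i0 i1 i2 by (subst Henstock_Kurzweil_Integration.integral_diff) (auto intro: integrable_add)
    finally have "\<bar>?L\<bar> = norm (integral {c..d} (\<lambda>x. (V x * \<phi>' x + v x * \<phi> x) - (g x * \<phi> x + \<phi>' x * G x)))"
      by simp
    also have "\<dots> \<le> integral {c..d} (\<lambda>x. \<epsilon> * C' + C * \<bar>g x - v x\<bar>)"
    proof (rule integral_norm_bound_integral)
      show "(\<lambda>x. (V x * \<phi>' x + v x * \<phi> x) - (g x * \<phi> x + \<phi>' x * G x)) integrable_on {c..d}"
        by (intro integrable_diff integrable_add i1 i2)
      show "(\<lambda>x. \<epsilon> * C' + C * \<bar>g x - v x\<bar>) integrable_on {c..d}"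
        by (intro integrable_add integrable_on_mult_right i3) auto
      fix x assume x: "x \<in> {c..d}"
      have "norm (V x * \<phi>' x + v x * \<phi> x - (g x * \<phi> x + \<phi>' x * G x)) = \<bar>(V x - G x) * \<phi>' x + (v x - g x) * \<phi> x\<bar>"
        by (simp add: algebra_simps)
      also have "\<dots> \<le> \<bar>G x - V x\<bar> * \<bar>\<phi>' x\<bar> + \<bar>\<phi> x\<bar> * \<bar>g x - v x\<bar>"
        by (rule order_trans[OF abs_triangle_ineq]) (simp add: abs_mult abs_minus_commute mult.commute)
      also have "\<dots> \<le> \<epsilon> * C' + C * \<bar>g x - v x\<bar>"
        using GV[OF x] C[OF x] C'[OF x] \<epsilon> C0 by (intro add_mono mult_mono) auto
      finally show "norm (V x * \<phi>' x + v x * \<phi> x - (g x * \<phi> x + \<phi>' x * G x)) \<le> \<epsilon> * C' + C * \<bar>g x - v x\<bar>" .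
    qed
    also have "\<dots> = \<epsilon> * C' * (d - c) + C * integral {c..d} (\<lambda>x. \<bar>g x - v x\<bar>)"
      using i3 \<open>c \<le> d\<close> by (subst Henstock_Kurzweil_Integration.integral_add) (auto intro: integrable_on_mult_right)
    also have "\<dots> \<le> \<epsilon> * C' * (d - c) + C * \<epsilon>"
      using ge C0 by (intro add_left_mono mult_left_mono) auto
    finally show ?thesis by (simp add: algebra_simps)
  qed
  have "(\<lambda>n. inverse (real (Suc n)) * ?D) \<longlonglongrightarrow> 0 * ?D"
    by (intro tendsto_intros LIMSEQ_inverse_real_of_nat)
  then have "\<bar>?L\<bar> \<le> 0"
    using bound by (intro LIMSEQ_le_const[of "\<lambda>n. inverse (real (Suc n)) * ?D"]) auto
  then show ?thesis by simp
qed

lemma integral_mult_smooth_bump_tendsto: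
  fixes y :: "real \<Rightarrow> real"
  assumes y: "y absolutely_integrable_on {c..d}" and ab: "c \<le> a" "b \<le> d"
  shows "(\<lambda>n. integral {c..d} (\<lambda>x. smooth_bump n a b x * y x)) \<longlonglongrightarrow> integral {a..b} y"
proof -
  have "(\<lambda>n. integral {c..d} (\<lambda>x. smooth_bump n a b x * y x)) \<longlonglongrightarrow> integral {c..d} (\<lambda>x. indicator {a<..<b} x * y x)"
  proof (rule dominated_convergence(2))
    show "(\<lambda>x. smooth_bump k a b x * y x) integrable_on {c..d}" for k
      using absolutely_integrable_cont_mult[OF smooth_gen_continuous[OF smooth_gen_bump] y]
        set_lebesgue_integral_eq_integral(1) by blast
    show "(\<lambda>x. \<bar>y x\<bar>) integrable_on {c..d}" using y by (simp add: absolutely_integrable_on_def)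
    show "norm (smooth_bump k a b x * y x) \<le> \<bar>y x\<bar>" for k x
      using smooth_bump_bounds[of k a b x] by (simp add: abs_mult mult_left_le_one_le)
    show "(\<lambda>k. smooth_bump k a b x * y x) \<longlonglongrightarrow> indicator {a<..<b} x * y x" for x
      by (intro tendsto_intros smooth_bump_tendsto)
  qed
  also have "(\<lambda>x. indicator {a<..<b} x * y x) = (\<lambda>x. if x \<in> {a<..<b} then y x else 0)"
    by (auto simp: indicator_def)
  also have "integral {c..d} \<dots> = integral ({c..d} \<inter> {a<..<b}) y"
    by (subst Int_commute) (rule integral_restrict_Int)
  also have "{c..d} \<inter> {a<..<b} = {a<..<b}" using ab by auto
  also have "integral {a<..<b} y = integral {a..b} y"
    by (rule integral_open_interval_real[symmetric])
  finally show ?thesis .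
qed

text \<open>The primitive \<open>V\<close> of \<open>v\<close> has the same weak derivative as
  \<open>u\<close>, so \<open>z = u - V\<close> is orthogonal to every smooth zero-mean function
  supported in the interval. Letting such functions approach combinations of indicators shows that
  all subintervals give \<open>z\<close> the same mean \<open>k\<close>, and Lebesgue
  differentiation turns this into \<open>z = k\<close> almost everywhere.\<close>

lemma W11_loc_representative:
  assumes W: "W11_loc \<Omega> u v" and sub: "{c..d} \<subseteq> \<Omega>" and "c < d"
  obtains k N where "negligible N" "\<And>x. x \<in> {c..d} - N \<Longrightarrow> u x = k + integral {c..x} v"
proof -
  have u: "u absolutely_integrable_on {c..d}" and v: "v absolutely_integrable_on {c..d}"
    using W sub by (auto simp: W11_loc_def L1_loc_def)
  have vint: "v integrable_on {c..d}" using v set_lebesgue_integral_eq_integral(1) by blast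
  define V where "V x = integral {c..x} v" for x
  define z where "z x = u x - V x" for x
  have Vc: "continuous_on {c..d} V"
    unfolding V_def[abs_def] by (intro indefinite_integral_continuous_1 vint)
  have Vai: "V absolutely_integrable_on {c..d}" by (rule absolutely_integrable_continuous_real[OF Vc])
  have z: "z absolutely_integrable_on {c..d}"
    unfolding z_def[abs_def] using u Vai by (rule set_integral_diff(1))
  have zero: "integral {c..d} (\<lambda>x. g x * z x) = 0"
    if g: "smooth_gen g" and g0: "\<And>x. x \<le> c \<or> d \<le> x \<Longrightarrow> g x = 0" and gi: "integral {c..d} g = 0" for g
  proof -
    obtain \<phi> where t: "test_fun \<Omega> \<phi>" and D: "\<And>x. (\<phi> has_real_derivative g x) (at x)"
      and out: "\<And>x. x \<notin> {c..d} \<Longrightarrow> \<phi> x = 0" and e: "\<phi> c = 0" "\<phi> d = 0"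
      using test_fun_antiderivative[OF g g0 gi sub] by blast
    have gc: "continuous_on {c..d} g" by (rule smooth_gen_continuous[OF g])
    have \<phi>c: "continuous_on {c..d} \<phi>"
      by (meson DERIV_continuous_on D has_field_derivative_at_within)
    have conv: "(\<integral>x. y x * h x \<partial>lebesgue) = integral {c..d} (\<lambda>x. h x * y x)"
      if y: "y absolutely_integrable_on {c..d}" and h: "continuous_on {c..d} h" and h0: "\<And>x. x \<notin> {c..d} \<Longrightarrow> h x = 0"
      for y h :: "real \<Rightarrow> real"
    proof -
      have "(\<integral>x. y x * h x \<partial>lebesgue) = (LINT x:{c..d}|lebesgue. h x * y x)"
        unfolding set_lebesgue_integral_def
        by (intro Bochner_Integration.integral_cong refl) (use h0 in \<open>auto simp: indicator_def\<close>)
      also have "\<dots> = integral {c..d} (\<lambda>x. h x * y x)"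
        by (rule set_lebesgue_integral_eq_integral(2)[OF absolutely_integrable_cont_mult[OF h y]])
      finally show ?thesis .
    qed
    have dg: "deriv \<phi> = g" using D by (auto intro: DERIV_imp_deriv)
    have *: "(\<integral>x. u x * deriv \<phi> x \<partial>lebesgue) = - (\<integral>x. v x * \<phi> x \<partial>lebesgue)"
      using W t by (auto simp: W11_loc_def weak_deriv_def)
    have 1: "integral {c..d} (\<lambda>x. g x * u x) = - integral {c..d} (\<lambda>x. \<phi> x * v x)"
    proof -
      have "(\<integral>x. u x * g x \<partial>lebesgue) = integral {c..d} (\<lambda>x. g x * u x)"
        by (rule conv[OF u gc]) (use g0 in \<open>meson atLeastAtMost_iff less_imp_le not_le\<close>)
      moreover have "(\<integral>x. v x * \<phi> x \<partial>lebesgue) = integral {c..d} (\<lambda>x. \<phi> x * v x)"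
        by (rule conv[OF v \<phi>c out])
      ultimately show ?thesis using * by (simp add: dg)
    qed
    have 2: "integral {c..d} (\<lambda>x. g x * V x) = - integral {c..d} (\<lambda>x. \<phi> x * v x)"
      using primitive_by_parts[OF v _ D gc e] \<open>c < d\<close> by (simp add: V_def mult.commute)
    have "integral {c..d} (\<lambda>x. g x * z x) = integral {c..d} (\<lambda>x. g x * u x - g x * V x)"
      by (simp add: z_def algebra_simps)
    also have "\<dots> = 0"
      using 1 2 absolutely_integrable_cont_mult[OF gc u] absolutely_integrable_cont_mult[OF gc Vai]
      by (subst Henstock_Kurzweil_Integration.integral_diff) (auto simp: set_lebesgue_integral_eq_integral(1))
    finally show ?thesis .
  qed
  define k where "k = integral {c..d} z / (d - c)"
  have mean: "integral {a..b} z = k * (b - a)" if ab: "c \<le> a" "a < b" "b \<le> d" for a b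
  proof -
    define I where "I n a b = integral {c..d} (smooth_bump n a b)" for n a b
    define J where "J n a b = integral {c..d} (\<lambda>x. smooth_bump n a b x * z x)" for n a b
    have Ilim: "(\<lambda>n. I n a b) \<longlonglongrightarrow> b - a" if "c \<le> a" "a < b" "b \<le> d" for a b
      using integral_mult_smooth_bump_tendsto[where y = "\<lambda>x. 1" and c = c and d = d and a = a and b = b] that by (simp add: I_def absolutely_integrable_continuous_real)
    have Jlim: "(\<lambda>n. J n a b) \<longlonglongrightarrow> integral {a..b} z" if "c \<le> a" "b \<le> d" for a b
      unfolding J_def using z that by (rule integral_mult_smooth_bump_tendsto)
    have "I n c d * J n a b = I n a b * J n c d" for n
    proof -
      \<comment> \<open>The second summand corrects the mean to zero, which makes the combination
        admissible for \<open>zero\<close>.\<close>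
      let ?g = "\<lambda>x. I n c d * smooth_bump n a b x + (- I n a b) * smooth_bump n c d x"
      have bi: "smooth_bump n a b integrable_on {c..d}" for a b
        by (intro integrable_continuous_real smooth_gen_continuous smooth_gen_bump)
      have bzi: "(\<lambda>x. smooth_bump n a b x * z x) integrable_on {c..d}" for a b
        using absolutely_integrable_cont_mult[OF smooth_gen_continuous[OF smooth_gen_bump] z]
          set_lebesgue_integral_eq_integral(1) by blast
      have "smooth_gen ?g" by (intro smooth_gen.add smooth_gen.mult smooth_gen.const smooth_gen_bump)
      moreover have "?g x = 0" if "x \<le> c \<or> d \<le> x" for x
        using that ab by (auto simp: smooth_bump_eq_0)
      moreover have "integral {c..d} ?g = 0"
        by (subst Henstock_Kurzweil_Integration.integral_add) (intro integrable_on_mult_right bi | simp add: I_def)+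
      ultimately have "integral {c..d} (\<lambda>x. ?g x * z x) = 0" by (rule zero)
      also have "(\<lambda>x. ?g x * z x) = (\<lambda>x. I n c d * (smooth_bump n a b x * z x) + (- I n a b) * (smooth_bump n c d x * z x))"
        by (auto simp: algebra_simps)
      also have "integral {c..d} \<dots> = I n c d * J n a b + (- I n a b) * J n c d"
        by (subst Henstock_Kurzweil_Integration.integral_add) (intro integrable_on_mult_right bzi | simp add: J_def)+
      finally show ?thesis by simp
    qed
    moreover have "(\<lambda>n. I n c d * J n a b) \<longlonglongrightarrow> (d - c) * integral {a..b} z"
      using ab \<open>c < d\<close> by (intro tendsto_mult Ilim Jlim) auto
    moreover have "(\<lambda>n. I n a b * J n c d) \<longlonglongrightarrow> (b - a) * integral {c..d} z"
      using ab \<open>c < d\<close> by (intro tendsto_mult Ilim Jlim) auto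
    ultimately have "(d - c) * integral {a..b} z = (b - a) * integral {c..d} z"
      using LIMSEQ_unique by auto
    then show ?thesis using \<open>c < d\<close> by (simp add: k_def field_simps)
  qed
  \<comment> \<open>The differentiation theorem asks for integrability on every bounded interval of
    the line, hence the extension by zero.\<close>
  define y where "y x = (if x \<in> {c..d} then z x else 0)" for x
  have "y integrable_on cbox a b" for a b
  proof -
    have "y absolutely_integrable_on UNIV"
      unfolding y_def[abs_def] using z by (subst absolutely_integrable_restrict_UNIV)
    then show ?thesis
      by (meson integrable_on_subcbox set_lebesgue_integral_eq_integral(1) top_greatest)
  qed
  then obtain N where N: "negligible N"
    and L: "\<And>x e. \<lbrakk>x \<notin> N; 0 < e\<rbrakk> \<Longrightarrow> \<exists>r>0. \<forall>h. 0 < h \<and> h < r \<longrightarrow>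
        norm (integral (cbox x (x + h *\<^sub>R One)) y /\<^sub>R h ^ DIM(real) - y x) < e"
    using integrable_ccontinuous_explicit[of y] by blast
  show ?thesis
  proof (rule that)
    \<comment> \<open>The averages are taken to the right of \<open>x\<close>, so the right endpoint
      joins the exceptional set.\<close>
    show "negligible (insert d N)" using N by simp
    fix x assume x: "x \<in> {c..d} - insert d N"
    then have xb: "c \<le> x" "x < d" "x \<notin> N" by auto
    have "\<bar>k - z x\<bar> \<le> 0 + e" if e: "e > 0" for e
    proof -
      obtain r where r: "r > 0" "\<And>h. 0 < h \<Longrightarrow> h < r \<Longrightarrow> \<bar>integral {x..x+h} y / h - y x\<bar> < e"
        using L[OF xb(3) e] by (auto simp: divide_inverse mult.commute)
      define h where "h = min (r/2) (d - x)"
      have h: "0 < h" "h < r" "x + h \<le> d" using r xb by (auto simp: h_def min_def)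
      have "integral {x..x+h} y = integral {x..x+h} z"
        by (rule integral_cong) (use h xb in \<open>auto simp: y_def\<close>)
      also have "\<dots> = k * h" using mean[of x "x+h"] h xb by simp
      finally show ?thesis using r(2)[OF h(1,2)] h xb by (simp add: y_def)
    qed
    then have "\<bar>k - z x\<bar> \<le> 0" by (rule field_le_epsilon)
    then show "u x = k + integral {c..x} v" by (simp add: z_def V_def)
  qed
qed

section \<open>Stability of the first-order term\<close>

lemma sum_integral_partition:
  fixes g :: "real \<Rightarrow> real" and x :: "nat \<Rightarrow> real"
  assumes "\<And>i. i < n \<Longrightarrow> x i \<le> x (Suc i)" "g integrable_on {x 0..x n}"
  shows "(\<Sum>i<n. integral {x i..x (Suc i)} g) = integral {x 0..x n} g \<and> x 0 \<le> x n"
  using assms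
proof (induction n)
  case (Suc n)
  have le: "x 0 \<le> x m" if "m \<le> n" for m
    using that Suc.prems(1) by (induction m) (auto intro: order_trans)
  have "g integrable_on {x 0..x n}"
    by (rule integrable_on_subinterval[OF Suc.prems(2)]) (use Suc.prems(1)[of n] in auto)
  then have "(\<Sum>i<n. integral {x i..x (Suc i)} g) = integral {x 0..x n} g"
    using Suc by auto
  then show ?case
    using Henstock_Kurzweil_Integration.integral_combine[of "x 0" "x n" "x (Suc n)" g] le[of n] Suc.prems(1)[of n] Suc.prems(2)
    by auto
qed auto

text \<open>With the first argument frozen at \<open>x i\<close>, the integrand is an exact
  derivative by the chain rule, so a cell contributes only values at its two ends. The error still
  contains the integral of \<open>\<bar>u' y\<bar>\<close>; this is harmless because \<eta> can be
  sent to 0 by refining the partition while \<open>u\<close> stays fixed.\<close>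

lemma frozen_sum_error:
  fixes B :: "real \<Rightarrow> real \<Rightarrow> real" and x :: "nat \<Rightarrow> real"
  assumes part: "x 0 = c" "x n = d" "\<And>i. i < n \<Longrightarrow> x i \<le> x (Suc i)" "\<And>i. i \<le> n \<Longrightarrow> x i \<in> {c..d}"
    and Bc: "continuous_on ({c..d} \<times> UNIV) (\<lambda>(x, s). B x s)"
    and u: "\<And>y. y \<in> {c..d} \<Longrightarrow> (u has_real_derivative u' y) (at y within {c..d})"
    and u'c: "continuous_on {c..d} u'" and uL: "\<And>y. y \<in> {c..d} \<Longrightarrow> u y \<in> {-L..L}"
    and close: "\<And>i y s. i < n \<Longrightarrow> y \<in> {x i..x (Suc i)} \<Longrightarrow> s \<in> {-L..L} \<Longrightarrow> \<bar>B y s - B (x i) s\<bar> \<le> \<eta>"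
  shows "\<bar>integral {c..d} (\<lambda>y. B y (u y) * u' y) -
      (\<Sum>i<n. integral {-L..u (x (Suc i))} (B (x i)) - integral {-L..u (x i)} (B (x i)))\<bar>
    \<le> \<eta> * integral {c..d} (\<lambda>y. \<bar>u' y\<bar>)"
proof -
  have Bs: "continuous_on S (B y)" if "y \<in> {c..d}" for y S
    by (rule continuous_on_compose2[OF Bc, of S "\<lambda>s. (y, s)", simplified])
      (use that in \<open>auto intro!: continuous_intros\<close>)
  have uc: "continuous_on {c..d} u"
    by (meson DERIV_continuous_on u)
  let ?p = "\<lambda>y. B y (u y) * u' y"
  have pc: "continuous_on {c..d} ?p"
    by (intro continuous_on_mult u'c continuous_on_compose2[OF Bc, of _ "\<lambda>y. (y, u y)", simplified])
      (auto intro!: continuous_intros uc)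
  have sub: "{x i..x (Suc i)} \<subseteq> {c..d}" if "i < n" for i
    using part(4)[of i] part(4)[of "Suc i"] that by auto
  have each: "\<bar>integral {x i..x (Suc i)} ?p - (integral {-L..u (x (Suc i))} (B (x i)) - integral {-L..u (x i)} (B (x i)))\<bar>
      \<le> \<eta> * integral {x i..x (Suc i)} (\<lambda>y. \<bar>u' y\<bar>)" if i: "i < n" for i
  proof -
    let ?I = "{x i..x (Suc i)}"
    have xi: "x i \<in> {c..d}" using part(4)[of i] i by auto
    have fi: "((\<lambda>y. B (x i) (u y) * u' y) has_integral
        (\<lambda>s. integral {-L..s} (B (x i))) (u (x (Suc i))) - (\<lambda>s. integral {-L..s} (B (x i))) (u (x i))) ?I"
    proof (rule fundamental_theorem_of_calculus[of _ _ "\<lambda>y. integral {-L..u y} (B (x i))", simplified])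
      show "x i \<le> x (Suc i)" using part(3)[OF i] .
      fix y assume y: "x i \<le> y \<and> y \<le> x (Suc i)"
      then have ycd: "y \<in> {c..d}" using sub[OF i] by auto
      have "((\<lambda>s. integral {-L..s} (B (x i))) has_real_derivative B (x i) (u y)) (at (u y) within {-L..L})"
        by (rule integral_has_real_derivative[OF Bs[OF xi] uL[OF ycd]])
      then have "((\<lambda>s. integral {-L..s} (B (x i))) has_real_derivative B (x i) (u y)) (at (u y) within u ` ?I)"
        by (rule has_field_derivative_subset) (use uL sub[OF i] in blast)
      moreover have "(u has_real_derivative u' y) (at y within ?I)"
        by (rule has_field_derivative_subset[OF u[OF ycd] sub[OF i]])
      ultimately have "((\<lambda>s. integral {-L..s} (B (x i))) \<circ> u has_real_derivative B (x i) (u y) * u' y) (at y within ?I)"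
        by (rule DERIV_image_chain)
      then show "((\<lambda>y. integral {-L..u y} (B (x i))) has_vector_derivative B (x i) (u y) * u' y) (at y within ?I)"
        by (simp add: has_real_derivative_iff_has_vector_derivative o_def)
    qed
    have c1: "continuous_on ?I u" "continuous_on ?I u'" "continuous_on ?I ?p"
      using uc u'c pc sub[OF i] continuous_on_subset by blast+
    have c2: "continuous_on ?I (\<lambda>y. B (x i) (u y) * u' y)"
      by (intro continuous_on_mult c1 continuous_on_compose2[OF Bs[OF xi, of UNIV]]) auto
    have "integral ?I ?p - (integral {-L..u (x (Suc i))} (B (x i)) - integral {-L..u (x i)} (B (x i)))
        = integral ?I (\<lambda>y. ?p y - B (x i) (u y) * u' y)"
      using integral_unique[OF fi] c1 c2
      by (subst Henstock_Kurzweil_Integration.integral_diff) (auto intro: integrable_continuous_real)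
    then have "\<bar>integral ?I ?p - (integral {-L..u (x (Suc i))} (B (x i)) - integral {-L..u (x i)} (B (x i)))\<bar>
        = norm (integral ?I (\<lambda>y. ?p y - B (x i) (u y) * u' y))" by simp
    also have "\<dots> \<le> integral ?I (\<lambda>y. \<eta> * \<bar>u' y\<bar>)"
    proof (rule integral_norm_bound_integral)
      fix y assume y: "y \<in> ?I"
      have "norm (?p y - B (x i) (u y) * u' y) = \<bar>B y (u y) - B (x i) (u y)\<bar> * \<bar>u' y\<bar>"
        by (simp add: abs_mult[symmetric] algebra_simps)
      also have "\<dots> \<le> \<eta> * \<bar>u' y\<bar>"
        using close[OF i y uL] y sub[OF i] by (intro mult_right_mono) auto
      finally show "norm (?p y - B (x i) (u y) * u' y) \<le> \<eta> * \<bar>u' y\<bar>" .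
    qed (intro integrable_continuous_real continuous_intros c1 c2)+
    finally show ?thesis by simp
  qed
  have "integral {c..d} ?p = (\<Sum>i<n. integral {x i..x (Suc i)} ?p)"
    using sum_integral_partition[of n x ?p] part pc by (simp add: integrable_continuous_real)
  moreover have "integral {c..d} (\<lambda>y. \<bar>u' y\<bar>) = (\<Sum>i<n. integral {x i..x (Suc i)} (\<lambda>y. \<bar>u' y\<bar>))"
    using sum_integral_partition[of n x "\<lambda>y. \<bar>u' y\<bar>"] part u'c by (simp add: integrable_continuous_real continuous_on_rabs)
  ultimately show ?thesis
    using sum_mono[of "{..<n}", OF each]
    by (auto simp: sum_subtractf[symmetric] sum_distrib_left intro!: order_trans[OF sum_abs])
qed

text \<open>Used with \<open>G i\<close> a primitive of the slope frozen at the i-th node and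
  \<open>a\<close> the values of a function at the nodes. The two boundary terms disappear there
  because the slope vanishes at both ends of the interval.\<close>

lemma abel_summation:
  fixes G :: "nat \<Rightarrow> 'a \<Rightarrow> real"
  shows "(\<Sum>i<n. G i (a (Suc i)) - G i (a i)) = (\<Sum>i<n. G i (a (Suc i)) - G (Suc i) (a (Suc i))) + G n (a n) - G 0 (a 0)"
  by (induction n) auto

text \<open>The right-hand side is an integral over the segment between \<open>s\<close> and
  \<open>t\<close>, written over the fixed interval \<open>{-L..L}\<close> so that a sum over many
  segments can be moved under one integral sign.\<close>

lemma integral_diff_le_segment:
  fixes g :: "real \<Rightarrow> real"
  assumes g: "continuous_on {-L..L} g" and s: "s \<in> {-L..L}" "t \<in> {-L..L}"
  shows "\<bar>integral {-L..s} g - integral {-L..t} g\<bar> \<le> integral {-L..L} (\<lambda>y. if y \<in> {min s t..max s t} then \<bar>g y\<bar> else 0)"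
  using s
proof (induction s t rule: linorder_wlog)
  case (le a b)
  have i: "g integrable_on {-L..b}" "g integrable_on {a..b}" "(\<lambda>y. \<bar>g y\<bar>) integrable_on {a..b}"
    by (intro integrable_continuous_real continuous_on_subset[OF g] continuous_intros; use le in force)+
  have "integral {-L..a} g + integral {a..b} g = integral {-L..b} g"
    using Henstock_Kurzweil_Integration.integral_combine[OF _ _ i(1), of a] le by auto
  then have "\<bar>integral {-L..a} g - integral {-L..b} g\<bar> = norm (integral {a..b} g)" by simp
  also have "\<dots> \<le> integral {a..b} (\<lambda>y. \<bar>g y\<bar>)"
    by (rule integral_norm_bound_integral) (use i in auto)
  also have "\<dots> = integral {-L..L} (\<lambda>y. if y \<in> {min a b..max a b} then \<bar>g y\<bar> else 0)"
  proof -
    have "{a..b} \<inter> {-L..L} = {a..b}" using le by auto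
    then show ?thesis using le(1) by (subst integral_restrict_Int) (simp add: min_def max_def)
  qed
  finally show ?case .
next
  case (sym a b)
  then show ?case by (simp add: abs_minus_commute min.commute max.commute)
qed

text \<open>After summation by parts the difference is a sum of integrals of
  \<open>B (x i) t - B (x (Suc i)) t\<close> over the segments between the values of
  \<open>u\<close> and \<open>w\<close> at the right node. With sum and integral exchanged,
  \<open>ac\<close> applies at each fixed level \<open>t\<close>: its constant part \<epsilon> is
  integrated over \<open>{-R..R}\<close> only, since \<open>B\<close> vanishes beyond, and its
  linear part integrates to a Riemann sum of \<open>\<bar>u - w\<bar>\<close>. The quantifier over
  index sets \<open>J\<close> in \<open>ac\<close> is there because the set of cells met at level
  \<open>t\<close> is arbitrary.\<close>

lemma first_order_term_estimate_C1:
  fixes B :: "real \<Rightarrow> real \<Rightarrow> real" and u u' w w' :: "real \<Rightarrow> real"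
  assumes "c < d" and Bc: "continuous_on ({c..d} \<times> UNIV) (\<lambda>(x, s). B x s)"
    and R: "R \<ge> 0" "\<And>x s. x \<in> {c..d} \<Longrightarrow> \<bar>s\<bar> \<ge> R \<Longrightarrow> B x s = 0"
    and ends: "\<And>s. B c s = 0" "\<And>s. B d s = 0"
    and pos: "\<delta> > 0" "\<epsilon> \<ge> 0" "C \<ge> 0"
    and ac: "\<And>s n J. n > 0 \<Longrightarrow> (d - c) / real n < \<delta> \<Longrightarrow> J \<subseteq> {..<n} \<Longrightarrow>
       (\<Sum>i\<in>J. \<bar>B (c + real i * ((d - c) / real n)) s - B (c + real (Suc i) * ((d - c) / real n)) s\<bar>)
         \<le> \<epsilon> + C * (real (card J) * ((d - c) / real n))"
    and u: "\<And>y. y \<in> {c..d} \<Longrightarrow> (u has_real_derivative u' y) (at y within {c..d})" "continuous_on {c..d} u'"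
    and w: "\<And>y. y \<in> {c..d} \<Longrightarrow> (w has_real_derivative w' y) (at y within {c..d})" "continuous_on {c..d} w'"
  shows "\<bar>integral {c..d} (\<lambda>x. B x (u x) * u' x) - integral {c..d} (\<lambda>x. B x (w x) * w' x)\<bar>
    \<le> 2 * R * \<epsilon> + C * integral {c..d} (\<lambda>x. \<bar>u x - w x\<bar>)" (is "?L \<le> ?R")
proof -
  have uc: "continuous_on {c..d} u" "continuous_on {c..d} w"
    by (rule DERIV_continuous_on[OF u(1)], assumption, rule DERIV_continuous_on[OF w(1)], assumption)
  obtain Lu Lw where Lu: "Lu \<ge> 0" "\<And>x. x \<in> {c..d} \<Longrightarrow> \<bar>u x\<bar> \<le> Lu"
    and Lw: "Lw \<ge> 0" "\<And>x. x \<in> {c..d} \<Longrightarrow> \<bar>w x\<bar> \<le> Lw"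
    using continuous_on_Icc_bounded[OF uc(1)] continuous_on_Icc_bounded[OF uc(2)] by metis
  \<comment> \<open>\<open>L\<close> exceeds both ranges and \<open>R\<close>, so
    \<open>{-L..L}\<close> contains every segment and the support of \<open>B\<close> in the second
    variable.\<close>
  define L where "L = Lu + Lw + R"
  have uL: "u x \<in> {-L..L}" "w x \<in> {-L..L}" if "x \<in> {c..d}" for x
    using Lu(2)[OF that] Lw(2)[OF that] Lu(1) Lw(1) R(1) by (auto simp: L_def)
  have RL: "R \<le> L" "L \<ge> 0" using Lu(1) Lw(1) R(1) by (auto simp: L_def)
  \<comment> \<open>These are all the costs of discretization: freezing along \<open>u\<close>,
    freezing along \<open>w\<close>, and the Riemann sum. The derivatives occur only here, with the
    factor \<eta>, and so drop out as \<eta> tends to 0.\<close>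
  let ?K = "integral {c..d} (\<lambda>y. \<bar>u' y\<bar>) + integral {c..d} (\<lambda>y. \<bar>w' y\<bar>) + C * (d - c)"
  have main: "?L \<le> ?R + \<eta> * ?K" if \<eta>: "\<eta> > 0" for \<eta>
  proof -
    have "uniformly_continuous_on ({c..d} \<times> {-L..L}) (\<lambda>(x, s). B x s)"
      by (intro compact_uniformly_continuous compact_Times compact_Icc continuous_on_subset[OF Bc]) auto
    then obtain r1 where r1: "r1 > 0" "\<And>x y s. x \<in> {c..d} \<Longrightarrow> y \<in> {c..d} \<Longrightarrow> s \<in> {-L..L} \<Longrightarrow> \<bar>x - y\<bar> < r1 \<Longrightarrow> \<bar>B x s - B y s\<bar> < \<eta>"
      using \<eta> unfolding uniformly_continuous_on_def
      by (auto simp: dist_Pair_Pair dist_real_def)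
    have "uniformly_continuous_on {c..d} (\<lambda>x. \<bar>u x - w x\<bar>)"
      by (intro compact_uniformly_continuous compact_Icc continuous_intros uc)
    then obtain r2 where r2: "r2 > 0" "\<And>x y. x \<in> {c..d} \<Longrightarrow> y \<in> {c..d} \<Longrightarrow> \<bar>x - y\<bar> < r2 \<Longrightarrow> \<bar>\<bar>u x - w x\<bar> - \<bar>u y - w y\<bar>\<bar> < \<eta>"
      using \<eta> unfolding uniformly_continuous_on_def by (metis dist_real_def)
    define r where "r = min \<delta> (min r1 r2)"
    have "r > 0" using r1 r2 pos by (simp add: r_def)
    obtain n where n: "(d - c) / r < real n" using reals_Archimedean2 by blast
    have n0: "n > 0" using n \<open>r > 0\<close> \<open>c < d\<close> by (cases n) (auto simp: divide_less_0_iff)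
    define m where "m = (d - c) / real n"
    have m: "0 < m" "m < r" "real n * m = d - c"
      using n n0 \<open>r > 0\<close> \<open>c < d\<close> by (auto simp: m_def field_simps)
    define x where "x i = c + real i * m" for i
    have xle: "x i \<le> x j" if "i \<le> j" for i j using m that by (simp add: x_def)
    have x0: "x 0 = c" "x n = d" using m by (auto simp: x_def)
    have xin: "x i \<in> {c..d}" if "i \<le> n" for i using xle[of 0 i] xle[of i n] that x0 by auto
    have xs: "x (Suc i) - x i = m" for i by (simp add: x_def algebra_simps)
    have sub: "{x i..x (Suc i)} \<subseteq> {c..d}" if "i < n" for i using xin[of i] xin[of "Suc i"] that by auto
    have Bclose: "\<bar>B y s - B (x i) s\<bar> \<le> \<eta>" if "i < n" "y \<in> {x i..x (Suc i)}" "s \<in> {-L..L}" for i y s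
    proof -
      have "\<bar>y - x i\<bar> < r1" using that(2) xs[of i] m by (auto simp: r_def)
      then show ?thesis using r1(2)[of y "x i" s] that sub[of i] xin[of i] by auto
    qed
    have Bs: "continuous_on S (B y)" if "y \<in> {c..d}" for y S
      by (rule continuous_on_compose2[OF Bc, of S "\<lambda>s. (y, s)", simplified])
        (use that in \<open>auto intro!: continuous_intros\<close>)
    define G where "G i s = integral {-L..s} (B (x i))" for i s
    define S where "S q = (\<Sum>i<n. G i (q (x (Suc i))) - G i (q (x i)))" for q
    have Su: "\<bar>integral {c..d} (\<lambda>y. B y (u y) * u' y) - S u\<bar> \<le> \<eta> * integral {c..d} (\<lambda>y. \<bar>u' y\<bar>)"
      unfolding S_def G_def
      by (rule frozen_sum_error[where x = x]) (use x0 xle xin Bc u uL Bclose in auto)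
    have Sw: "\<bar>integral {c..d} (\<lambda>y. B y (w y) * w' y) - S w\<bar> \<le> \<eta> * integral {c..d} (\<lambda>y. \<bar>w' y\<bar>)"
      unfolding S_def G_def
      by (rule frozen_sum_error[where x = x]) (use x0 xle xin Bc w uL Bclose in auto)
    have G0: "G 0 s = 0" "G n s = 0" for s
      unfolding G_def x0 using ends by (simp_all add: integral_unique[OF has_integral_is_0])
    define D where "D i t = B (x i) t - B (x (Suc i)) t" for i t
    have Dc: "continuous_on T (D i)" if "i < n" for i T
      unfolding D_def[abs_def] using that xin by (intro continuous_intros Bs) auto
    have GD: "G i s - G (Suc i) s = integral {-L..s} (D i)" if "i < n" for i s
      unfolding G_def D_def using that xin
      by (subst Henstock_Kurzweil_Integration.integral_diff) (auto intro!: integrable_continuous_real Bs)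
    have Sq: "S q = (\<Sum>i<n. integral {-L..q (x (Suc i))} (D i))" for q
      unfolding S_def using abel_summation[of G "\<lambda>i. q (x i)" n] G0 GD by simp
    define seg where "seg i = {min (u (x (Suc i))) (w (x (Suc i)))..max (u (x (Suc i))) (w (x (Suc i)))}" for i
    have segL: "seg i \<subseteq> {-L..L}" if "i < n" for i
      using uL[OF xin[of "Suc i"]] that by (auto simp: seg_def min_def max_def split: if_splits)
    have inti: "(\<lambda>y. if y \<in> seg i then h y else 0) integrable_on {-L..L}" if "continuous_on {-L..L} h" "i < n" for h :: "real \<Rightarrow> real" and i
    proof -
      have "h integrable_on seg i"
        using continuous_on_subset[OF that(1) segL[OF that(2)]] unfolding seg_def by (rule integrable_continuous_real)
      then show ?thesis using segL[of i] that by (simp add: integrable_restrict_Int Int_absorb2)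
    qed
    have intR: "(\<lambda>t. if t \<in> {-R..R} then \<epsilon> else 0) integrable_on {-L..L}"
      using RL by (subst integrable_restrict_Int) (auto simp: Int_absorb2)
    have "\<bar>S u - S w\<bar> \<le> (\<Sum>i<n. \<bar>integral {-L..u (x (Suc i))} (D i) - integral {-L..w (x (Suc i))} (D i)\<bar>)"
      unfolding Sq by (simp add: sum_subtractf[symmetric] sum_abs)
    also have "\<dots> \<le> (\<Sum>i<n. integral {-L..L} (\<lambda>t. if t \<in> seg i then \<bar>D i t\<bar> else 0))"
      unfolding seg_def by (intro sum_mono integral_diff_le_segment Dc uL xin) auto
    also have "\<dots> = integral {-L..L} (\<lambda>t. \<Sum>i<n. if t \<in> seg i then \<bar>D i t\<bar> else 0)"
      by (intro integral_sum[symmetric] inti continuous_intros Dc) auto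
    also have "\<dots> \<le> integral {-L..L} (\<lambda>t. (if t \<in> {-R..R} then \<epsilon> else 0) + C * (\<Sum>i<n. if t \<in> seg i then m else 0))"
    proof (rule integral_le)
      show "(\<lambda>t. \<Sum>i<n. if t \<in> seg i then \<bar>D i t\<bar> else 0) integrable_on {-L..L}"
        by (intro integrable_sum inti continuous_intros Dc) auto
      show "(\<lambda>t. (if t \<in> {-R..R} then \<epsilon> else 0) + C * (\<Sum>i<n. if t \<in> seg i then m else 0)) integrable_on {-L..L}"
        by (intro integrable_add intR integrable_on_mult_right integrable_sum inti continuous_intros) auto
      fix t
      \<comment> \<open>For this level \<open>t\<close> only the cells in \<open>J\<close>
        contribute, and all of them at the same second argument, as \<open>ac\<close>
        demands.\<close>
      define J where "J = {i \<in> {..<n}. t \<in> seg i}"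
      have J: "(\<Sum>i<n. if t \<in> seg i then q i else 0) = (\<Sum>i\<in>J. q i)" for q :: "nat \<Rightarrow> real"
        unfolding J_def by (rule sum.inter_filter[symmetric]) simp
      show "(\<Sum>i<n. if t \<in> seg i then \<bar>D i t\<bar> else 0) \<le> (if t \<in> {-R..R} then \<epsilon> else 0) + C * (\<Sum>i<n. if t \<in> seg i then m else 0)"
      proof (cases "t \<in> {-R..R}")
        case True
        have "(\<Sum>i\<in>J. \<bar>D i t\<bar>) \<le> \<epsilon> + C * (real (card J) * m)"
          using ac[of n J t] n0 m(2) unfolding D_def x_def m_def[symmetric] by (auto simp: J_def r_def)
        then show ?thesis using True unfolding J by simp
      next
        case False
        then have "D i t = 0" if "i < n" for i
          using R(2)[of "x i" t] R(2)[of "x (Suc i)" t] xin that by (auto simp: D_def)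
        then have "(\<Sum>i\<in>J. \<bar>D i t\<bar>) = 0" by (intro sum.neutral) (auto simp: J_def)
        then show ?thesis unfolding J using False pos m by (auto intro!: mult_nonneg_nonneg)
      qed
    qed
    \<comment> \<open>Integrating over \<open>t\<close> turns the number of cells met at level
      \<open>t\<close> into the sum of the lengths of all segments.\<close>
    also have "\<dots> = 2 * R * \<epsilon> + C * (\<Sum>i<n. m * \<bar>u (x (Suc i)) - w (x (Suc i))\<bar>)"
    proof -
      have e1: "integral {-L..L} (\<lambda>t. if t \<in> {-R..R} then \<epsilon> else 0) = 2 * R * \<epsilon>"
        using RL R(1) by (subst integral_restrict_Int) (auto simp: Int_absorb2)
      have e2: "integral {-L..L} (\<lambda>t. if t \<in> seg i then m else 0) = m * \<bar>u (x (Suc i)) - w (x (Suc i))\<bar>" if "i < n" for i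
        using segL[OF that] by (subst integral_restrict_Int) (auto simp: Int_absorb2 seg_def min_def max_def)
      have i3: "(\<lambda>t. if t \<in> seg i then m else 0) integrable_on {-L..L}" if "i < n" for i
        by (intro inti continuous_intros that)
      have e3: "integral {-L..L} (\<lambda>t. \<Sum>i<n. if t \<in> seg i then m else 0) = (\<Sum>i<n. m * \<bar>u (x (Suc i)) - w (x (Suc i))\<bar>)"
        by (subst integral_sum) (auto intro!: sum.cong i3 e2)
      have "integral {-L..L} (\<lambda>t. (if t \<in> {-R..R} then \<epsilon> else 0) + C * (\<Sum>i<n. if t \<in> seg i then m else 0)) =
          integral {-L..L} (\<lambda>t. if t \<in> {-R..R} then \<epsilon> else 0) + integral {-L..L} (\<lambda>t. C * (\<Sum>i<n. if t \<in> seg i then m else 0))"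
        by (intro Henstock_Kurzweil_Integration.integral_add intR integrable_on_mult_right integrable_sum i3) auto
      then show ?thesis
        unfolding e1 using e3 by simp
    qed
    also have "(\<Sum>i<n. m * \<bar>u (x (Suc i)) - w (x (Suc i))\<bar>) \<le> (\<Sum>i<n. integral {x i..x (Suc i)} (\<lambda>y. \<bar>u y - w y\<bar> + \<eta>))"
    proof (rule sum_mono)
      fix i assume i: "i \<in> {..<n}"
      have "m * \<bar>u (x (Suc i)) - w (x (Suc i))\<bar> = integral {x i..x (Suc i)} (\<lambda>y. \<bar>u (x (Suc i)) - w (x (Suc i))\<bar>)"
        using xs[of i] xle[of i "Suc i"] by simp
      also have "\<dots> \<le> integral {x i..x (Suc i)} (\<lambda>y. \<bar>u y - w y\<bar> + \<eta>)"
      proof (rule integral_le)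
        show "(\<lambda>y. \<bar>u y - w y\<bar> + \<eta>) integrable_on {x i..x (Suc i)}"
          using sub[of i] i by (intro integrable_continuous_real continuous_intros continuous_on_subset[OF uc(1)] continuous_on_subset[OF uc(2)]) auto
        fix y assume y: "y \<in> {x i..x (Suc i)}"
        then have "\<bar>x (Suc i) - y\<bar> < r2" using xs[of i] m by (auto simp: r_def)
        then show "\<bar>u (x (Suc i)) - w (x (Suc i))\<bar> \<le> \<bar>u y - w y\<bar> + \<eta>"
          using r2(2)[of "x (Suc i)" y] xin[of "Suc i"] i y sub[of i] by fastforce
      qed auto
      finally show "m * \<bar>u (x (Suc i)) - w (x (Suc i))\<bar> \<le> integral {x i..x (Suc i)} (\<lambda>y. \<bar>u y - w y\<bar> + \<eta>)" .
    qed
    also have "(\<Sum>i<n. integral {x i..x (Suc i)} (\<lambda>y. \<bar>u y - w y\<bar> + \<eta>)) = integral {c..d} (\<lambda>y. \<bar>u y - w y\<bar> + \<eta>)"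
      using sum_integral_partition[of n x "\<lambda>y. \<bar>u y - w y\<bar> + \<eta>"] xle x0 uc
      by (simp add: integrable_continuous_real continuous_intros)
    also have "\<dots> = integral {c..d} (\<lambda>y. \<bar>u y - w y\<bar>) + \<eta> * (d - c)"
      using \<open>c < d\<close> uc by (subst Henstock_Kurzweil_Integration.integral_add) (auto intro!: integrable_continuous_real continuous_intros)
    finally have "\<bar>S u - S w\<bar> \<le> 2 * R * \<epsilon> + C * (integral {c..d} (\<lambda>y. \<bar>u y - w y\<bar>) + \<eta> * (d - c))"
      using pos(3) by (simp add: mult_left_mono)
    moreover have "?L \<le> \<eta> * integral {c..d} (\<lambda>y. \<bar>u' y\<bar>) + \<eta> * integral {c..d} (\<lambda>y. \<bar>w' y\<bar>) + \<bar>S u - S w\<bar>"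
      using Su Sw by linarith
    ultimately show ?thesis by (simp add: algebra_simps)
  qed
  have "(\<lambda>n. ?R + inverse (real (Suc n)) * ?K) \<longlonglongrightarrow> ?R + 0 * ?K"
    by (intro tendsto_intros LIMSEQ_inverse_real_of_nat)
  then have "?L \<le> ?R + 0 * ?K"
    using main by (intro LIMSEQ_le_const[of "\<lambda>n. ?R + inverse (real (Suc n)) * ?K"]) auto
  then show ?thesis by simp
qed

section \<open>From continuously differentiable to absolutely continuous functions\<close>

lemma primitive_approx:
  fixes v :: "real \<Rightarrow> real"
  assumes v: "v absolutely_integrable_on {c..d}"
  obtains g where "\<And>j. continuous_on UNIV (g j)"
    "\<And>j. integral {c..d} (\<lambda>x. \<bar>g j x - v x\<bar>) < inverse (real (Suc j))"
    "\<And>j x. x \<in> {c..d} \<Longrightarrow> \<bar>integral {c..x} (g j) - integral {c..x} v\<bar> < inverse (real (Suc j))"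
proof -
  have "\<exists>g. continuous_on UNIV g \<and> integral {c..d} (\<lambda>x. \<bar>g x - v x\<bar>) < inverse (real (Suc j))" for j
    using absolutely_integrable_approx_continuous[OF v, of "inverse (real (Suc j))"] by (metis inverse_positive_iff_positive of_nat_0_less_iff zero_less_Suc)
  then obtain g where g: "\<And>j. continuous_on UNIV (g j)"
    "\<And>j. integral {c..d} (\<lambda>x. \<bar>g j x - v x\<bar>) < inverse (real (Suc j))" by metis
  have "g j absolutely_integrable_on {c..d}" for j
    by (intro absolutely_integrable_continuous_real continuous_on_subset[OF g(1)]) auto
  from primitive_diff_le[OF v this] g(2) show ?thesis
    using that[of g] g by (meson order_le_less_trans)
qed

text \<open>Split \<open>g j\<close> into \<open>g j - v\<close> and \<open>v\<close>. The first
  part is at most \<open>CB\<close> times the error in mean; in the second the derivative is fixed,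
  and pointwise convergence of \<open>Uj\<close> suffices with the dominating function
  \<open>CB * \<bar>v x\<bar>\<close>.\<close>

lemma product_integral_tendsto:
  fixes B :: "real \<Rightarrow> real \<Rightarrow> real"
  assumes Bc: "continuous_on ({c..d} \<times> UNIV) (\<lambda>(x, s). B x s)" and CB: "\<And>x s. x \<in> {c..d} \<Longrightarrow> \<bar>B x s\<bar> \<le> CB"
    and v: "v absolutely_integrable_on {c..d}" and U: "continuous_on {c..d} U"
    and g: "\<And>j. continuous_on {c..d} (g j)" "\<And>j. integral {c..d} (\<lambda>x. \<bar>g j x - v x\<bar>) < inverse (real (Suc j))"
    and Uj: "\<And>j. continuous_on {c..d} (Uj j)" "\<And>j x. x \<in> {c..d} \<Longrightarrow> \<bar>Uj j x - U x\<bar> < inverse (real (Suc j))"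
  shows "(\<lambda>j. integral {c..d} (\<lambda>x. B x (Uj j x) * g j x)) \<longlonglongrightarrow> integral {c..d} (\<lambda>x. B x (U x) * v x)"
proof (cases "c \<le> d")
  case True
  then have CB0: "CB \<ge> 0" using CB[of c 0] by auto
  have cont: "continuous_on {c..d} (\<lambda>x. B x (w x))" if "continuous_on {c..d} w" for w
    by (rule continuous_on_compose2[OF Bc, of _ "\<lambda>y. (y, w y)", simplified])
      (auto intro!: continuous_intros that)
  have gai: "g j absolutely_integrable_on {c..d}" for j
    by (rule absolutely_integrable_continuous_real[OF g(1)])
  have dai: "(\<lambda>x. g j x - v x) absolutely_integrable_on {c..d}" for j
    using gai v by (rule set_integral_diff(1))
  have Ulim: "(\<lambda>j. Uj j x) \<longlonglongrightarrow> U x" if "x \<in> {c..d}" for x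
  proof (rule LIM_zero_cancel, rule tendsto_0_le[OF LIMSEQ_inverse_real_of_nat, where K = 1])
    show "\<forall>\<^sub>F j in sequentially. norm (Uj j x - U x) \<le> norm (inverse (real (Suc j))) * 1"
      using Uj(2)[OF that] by (intro always_eventually allI) (simp add: less_imp_le del: of_nat_Suc)
  qed
  have i1: "(\<lambda>x. B x (w x) * (g j x - v x)) integrable_on {c..d}" if "continuous_on {c..d} w" for w j
    using absolutely_integrable_cont_mult[OF cont[OF that] dai] set_lebesgue_integral_eq_integral(1) by blast
  have i2: "(\<lambda>x. B x (w x) * v x) integrable_on {c..d}" if "continuous_on {c..d} w" for w
    using absolutely_integrable_cont_mult[OF cont[OF that] v] set_lebesgue_integral_eq_integral(1) by blast
  have "(\<lambda>j. integral {c..d} (\<lambda>x. B x (Uj j x) * (g j x - v x))) \<longlonglongrightarrow> 0"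
  proof (rule tendsto_0_le[where K = CB])
    show "(\<lambda>j. inverse (real (Suc j))) \<longlonglongrightarrow> 0" by (rule LIMSEQ_inverse_real_of_nat)
    show "\<forall>\<^sub>F j in sequentially. norm (integral {c..d} (\<lambda>x. B x (Uj j x) * (g j x - v x))) \<le> norm (inverse (real (Suc j))) * CB"
    proof (rule always_eventually, rule allI)
      fix j
      have i3: "(\<lambda>x. \<bar>g j x - v x\<bar>) integrable_on {c..d}"
        using dai[of j] by (simp add: absolutely_integrable_on_def)
      have "norm (integral {c..d} (\<lambda>x. B x (Uj j x) * (g j x - v x))) \<le> integral {c..d} (\<lambda>x. CB * \<bar>g j x - v x\<bar>)"
        by (rule integral_norm_bound_integral[OF i1[OF Uj(1)] integrable_on_mult_right[OF i3]])
          (auto simp: abs_mult intro!: mult_right_mono CB)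
      also have "\<dots> \<le> CB * inverse (real (Suc j))"
        using g(2)[of j] CB0 by (simp add: mult_left_mono)
      finally show "norm (integral {c..d} (\<lambda>x. B x (Uj j x) * (g j x - v x))) \<le> norm (inverse (real (Suc j))) * CB"
        by (simp add: mult.commute)
    qed
  qed
  moreover have "(\<lambda>j. integral {c..d} (\<lambda>x. B x (Uj j x) * v x)) \<longlonglongrightarrow> integral {c..d} (\<lambda>x. B x (U x) * v x)"
  proof (rule dominated_convergence(2)[OF i2[OF Uj(1)]])
    show "(\<lambda>x. CB * \<bar>v x\<bar>) integrable_on {c..d}"
      using v by (intro integrable_on_mult_right) (simp add: absolutely_integrable_on_def)
    show "norm (B x (Uj k x) * v x) \<le> CB * \<bar>v x\<bar>" if "x \<in> {c..d}" for k x
      using CB[OF that] by (auto simp: abs_mult intro: mult_right_mono)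
    show "(\<lambda>k. B x (Uj k x) * v x) \<longlonglongrightarrow> B x (U x) * v x" if "x \<in> {c..d}" for x
    proof (intro tendsto_mult tendsto_const)
      have "continuous_on UNIV (B x)"
        by (rule continuous_on_compose2[OF Bc, of UNIV "\<lambda>s. (x, s)", simplified])
          (use that in \<open>auto intro!: continuous_intros\<close>)
      then show "(\<lambda>k. B x (Uj k x)) \<longlonglongrightarrow> B x (U x)"
        using Ulim[OF that] continuous_on_eq_continuous_at isCont_tendsto_compose by blast
    qed
  qed
  ultimately have "(\<lambda>j. integral {c..d} (\<lambda>x. B x (Uj j x) * (g j x - v x)) + integral {c..d} (\<lambda>x. B x (Uj j x) * v x))
      \<longlonglongrightarrow> 0 + integral {c..d} (\<lambda>x. B x (U x) * v x)"
    by (rule tendsto_add)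
  moreover have "integral {c..d} (\<lambda>x. B x (Uj j x) * (g j x - v x)) + integral {c..d} (\<lambda>x. B x (Uj j x) * v x)
      = integral {c..d} (\<lambda>x. B x (Uj j x) * g j x)" for j
    using i1[OF Uj(1)] i2[OF Uj(1)]
    by (subst Henstock_Kurzweil_Integration.integral_add[symmetric]) (auto simp: algebra_simps)
  ultimately show ?thesis by simp
qed simp

text \<open>The right-hand side of the smooth estimate contains no derivative, so the estimate
  passes to limits of primitives of continuous functions whose derivatives converge only in
  mean.\<close>

lemma first_order_term_estimate:
  fixes B :: "real \<Rightarrow> real \<Rightarrow> real" and v q :: "real \<Rightarrow> real"
  assumes "c < d" and Bc: "continuous_on ({c..d} \<times> UNIV) (\<lambda>(x, s). B x s)"
    and CB: "\<And>x s. x \<in> {c..d} \<Longrightarrow> \<bar>B x s\<bar> \<le> CB"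
    and R: "R \<ge> 0" "\<And>x s. x \<in> {c..d} \<Longrightarrow> \<bar>s\<bar> \<ge> R \<Longrightarrow> B x s = 0"
    and ends: "\<And>s. B c s = 0" "\<And>s. B d s = 0"
    and pos: "\<delta> > 0" "\<epsilon> \<ge> 0" "C \<ge> 0"
    and ac: "\<And>s n J. n > 0 \<Longrightarrow> (d - c) / real n < \<delta> \<Longrightarrow> J \<subseteq> {..<n} \<Longrightarrow>
       (\<Sum>i\<in>J. \<bar>B (c + real i * ((d - c) / real n)) s - B (c + real (Suc i) * ((d - c) / real n)) s\<bar>)
         \<le> \<epsilon> + C * (real (card J) * ((d - c) / real n))"
    and v: "v absolutely_integrable_on {c..d}" and q: "q absolutely_integrable_on {c..d}"
    and U: "\<And>x. x \<in> {c..d} \<Longrightarrow> U x = k + integral {c..x} v"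
    and W: "\<And>x. x \<in> {c..d} \<Longrightarrow> W x = l + integral {c..x} q"
  shows "\<bar>integral {c..d} (\<lambda>x. B x (U x) * v x) - integral {c..d} (\<lambda>x. B x (W x) * q x)\<bar>
    \<le> 2 * R * \<epsilon> + C * integral {c..d} (\<lambda>x. \<bar>U x - W x\<bar>)"
proof -
  obtain g where g: "\<And>j. continuous_on UNIV (g j)" "\<And>j. integral {c..d} (\<lambda>x. \<bar>g j x - v x\<bar>) < inverse (real (Suc j))"
    "\<And>j x. x \<in> {c..d} \<Longrightarrow> \<bar>integral {c..x} (g j) - integral {c..x} v\<bar> < inverse (real (Suc j))"
    using primitive_approx[OF v] by blast
  obtain h where h: "\<And>j. continuous_on UNIV (h j)" "\<And>j. integral {c..d} (\<lambda>x. \<bar>h j x - q x\<bar>) < inverse (real (Suc j))"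
    "\<And>j x. x \<in> {c..d} \<Longrightarrow> \<bar>integral {c..x} (h j) - integral {c..x} q\<bar> < inverse (real (Suc j))"
    using primitive_approx[OF q] by blast
  have gc: "continuous_on {c..d} (g j)" "continuous_on {c..d} (h j)" for j
    using g(1) h(1) continuous_on_subset by blast+
  define Uj where "Uj j x = k + integral {c..x} (g j)" for j x
  define Wj where "Wj j x = l + integral {c..x} (h j)" for j x
  have Uc: "continuous_on {c..d} U"
    using primitive_continuous[OF v, of k] by (rule continuous_on_eq) (simp add: U)
  have Wc: "continuous_on {c..d} W"
    using primitive_continuous[OF q, of l] by (rule continuous_on_eq) (simp add: W)
  have Ujc: "continuous_on {c..d} (Uj j)" "continuous_on {c..d} (Wj j)" for j
    unfolding Uj_def[abs_def] Wj_def[abs_def]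
    by (intro primitive_continuous absolutely_integrable_continuous_real gc)+
  have UjU: "\<bar>Uj j x - U x\<bar> < inverse (real (Suc j))" "\<bar>Wj j x - W x\<bar> < inverse (real (Suc j))" if "x \<in> {c..d}" for j x
    using g(3)[OF that, of j] h(3)[OF that, of j] U[OF that] W[OF that] by (auto simp: Uj_def Wj_def)
  have D: "(Uj j has_real_derivative g j y) (at y within {c..d})" "(Wj j has_real_derivative h j y) (at y within {c..d})"
    if "y \<in> {c..d}" for j y
    using integral_has_real_derivative[OF gc(1) that, of j] integral_has_real_derivative[OF gc(2) that, of j]
    unfolding Uj_def[abs_def] Wj_def[abs_def] by (auto intro!: derivative_eq_intros)
  have est: "\<bar>integral {c..d} (\<lambda>x. B x (Uj j x) * g j x) - integral {c..d} (\<lambda>x. B x (Wj j x) * h j x)\<bar>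
    \<le> 2 * R * \<epsilon> + C * integral {c..d} (\<lambda>x. \<bar>Uj j x - Wj j x\<bar>)" for j
    by (rule first_order_term_estimate_C1[OF \<open>c < d\<close> Bc R ends pos ac D(1) gc(1) D(2) gc(2)])
  have "(\<lambda>j. integral {c..d} (\<lambda>x. B x (Uj j x) * g j x)) \<longlonglongrightarrow> integral {c..d} (\<lambda>x. B x (U x) * v x)"
    by (rule product_integral_tendsto[OF Bc CB v Uc gc(1) g(2) Ujc(1) UjU(1)])
  moreover have "(\<lambda>j. integral {c..d} (\<lambda>x. B x (Wj j x) * h j x)) \<longlonglongrightarrow> integral {c..d} (\<lambda>x. B x (W x) * q x)"
    by (rule product_integral_tendsto[OF Bc CB q Wc gc(2) h(2) Ujc(2) UjU(2)])
  ultimately have "(\<lambda>j. \<bar>integral {c..d} (\<lambda>x. B x (Uj j x) * g j x) - integral {c..d} (\<lambda>x. B x (Wj j x) * h j x)\<bar>)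
     \<longlonglongrightarrow> \<bar>integral {c..d} (\<lambda>x. B x (U x) * v x) - integral {c..d} (\<lambda>x. B x (W x) * q x)\<bar>"
    by (intro tendsto_intros)
  moreover have "(\<lambda>j. integral {c..d} (\<lambda>x. \<bar>Uj j x - Wj j x\<bar>)) \<longlonglongrightarrow> integral {c..d} (\<lambda>x. \<bar>U x - W x\<bar>)"
  proof (rule dominated_convergence(2))
    show "(\<lambda>x. \<bar>Uj j x - Wj j x\<bar>) integrable_on {c..d}" for j
      by (intro integrable_continuous_real continuous_intros Ujc)
    \<comment> \<open>Each of the two approximants is within 1 of its limit, hence the 2.\<close>
    show "(\<lambda>x. \<bar>U x - W x\<bar> + 2) integrable_on {c..d}"
      by (intro integrable_continuous_real continuous_intros Uc Wc)
    fix x assume x: "x \<in> {c..d}"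
    have "inverse (real (Suc j)) \<le> 1" for j by (simp add: divide_simps)
    then show "norm \<bar>Uj j x - Wj j x\<bar> \<le> \<bar>U x - W x\<bar> + 2" for j
      using UjU(1)[OF x, of j] UjU(2)[OF x, of j] by (smt (verit) real_norm_def)
    have ev: "\<forall>\<^sub>F j in sequentially. norm (Uj j x - U x) \<le> norm (inverse (real (Suc j))) * 1"
      "\<forall>\<^sub>F j in sequentially. norm (Wj j x - W x) \<le> norm (inverse (real (Suc j))) * 1"
      using UjU[OF x] by (auto intro!: always_eventually less_imp_le simp del: of_nat_Suc)
    have "(\<lambda>j. Uj j x) \<longlonglongrightarrow> U x" "(\<lambda>j. Wj j x) \<longlonglongrightarrow> W x"
      by (rule LIM_zero_cancel[OF tendsto_0_le[OF LIMSEQ_inverse_real_of_nat ev(1)]],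
          rule LIM_zero_cancel[OF tendsto_0_le[OF LIMSEQ_inverse_real_of_nat ev(2)]])
    then show "(\<lambda>j. \<bar>Uj j x - Wj j x\<bar>) \<longlonglongrightarrow> \<bar>U x - W x\<bar>" by (intro tendsto_intros)
  qed
  then have "(\<lambda>j. 2 * R * \<epsilon> + C * integral {c..d} (\<lambda>x. \<bar>Uj j x - Wj j x\<bar>)) \<longlonglongrightarrow>
      2 * R * \<epsilon> + C * integral {c..d} (\<lambda>x. \<bar>U x - W x\<bar>)"
    by (intro tendsto_intros)
  ultimately show ?thesis
    using est by (meson LIMSEQ_le)
qed

section \<open>Affine minorants and absolute continuity in the space variable\<close>

text \<open>Outside \<open>{p..p+h}\<close> monotonicity of slopes puts the secant line below
  \<open>g\<close> without any loss. Inside, the secant rises by at most \<epsilon> and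
  \<open>g\<close> falls by at most \<epsilon>, which accounts for
  \<open>2 * \<epsilon>\<close>.\<close>

lemma convex_affine_minorant:
  fixes g :: "real \<Rightarrow> real"
  assumes conv: "convex_on UNIV g" and h: "h > 0" and osc: "\<And>\<eta>. \<eta> \<in> {p..p+h} \<Longrightarrow> \<bar>g \<eta> - g p\<bar> \<le> \<epsilon>"
  shows "g p + (g (p + h) - g p) / h * (\<xi> - p) - 2 * \<epsilon> \<le> g \<xi>"
proof -
  define b where "b = (g (p + h) - g p) / h"
  have \<epsilon>: "0 \<le> \<epsilon>" using osc[of p] h by auto
  consider "\<xi> \<in> {p..p+h}" | "\<xi> < p" | "\<xi> > p + h" by fastforce
  then have "g p + b * (\<xi> - p) - 2 * \<epsilon> \<le> g \<xi>"
  proof cases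
    case 1
    have "b * (\<xi> - p) = (g (p + h) - g p) * ((\<xi> - p) / h)" by (simp add: b_def)
    also have "\<dots> \<le> \<epsilon> * 1"
      using osc[of "p + h"] 1 h \<epsilon> by (intro mult_mono) (auto simp: divide_simps abs_le_iff)
    finally show ?thesis using osc[OF 1] by (simp add: abs_le_iff)
  next
    case 2
    have "(g \<xi> - g p) / (\<xi> - p) \<le> (g p - g (p + h)) / (p - (p + h))"
      using convex_on_slope_le[OF conv, of \<xi> "p + h" p] 2 h by auto
    then have "(g \<xi> - g p) / (\<xi> - p) \<le> b"
      using minus_divide_divide[of "g p - g (p + h)" "p - (p + h)"] by (simp add: b_def)
    then have "b * (\<xi> - p) \<le> g \<xi> - g p" using 2 by (simp add: divide_le_eq)
    then show ?thesis using \<epsilon> by simp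
  next
    case 3
    have "(g p - g (p + h)) / (p - (p + h)) \<le> (g p - g \<xi>) / (p - \<xi>)"
      using convex_on_slope_le[OF conv, of p \<xi> "p + h"] 3 h by auto
    then have "b \<le> (g \<xi> - g p) / (\<xi> - p)"
      using minus_divide_divide[of "g p - g (p + h)" "p - (p + h)"] minus_divide_divide[of "g p - g \<xi>" "p - \<xi>"]
      by (simp add: b_def)
    then have "b * (\<xi> - p) \<le> g \<xi> - g p" using 3 h by (simp add: le_divide_eq)
    then show ?thesis using \<epsilon> by simp
  qed
  then show ?thesis by (simp add: b_def)
qed

text \<open>Grouping the cells of a uniform partition into blocks of length between half of \<open>\<delta>\<close> and \<open>\<delta>\<close>
  turns absolute continuity into a bound that is affine in the total length.\<close>

lemma H4_uniform_partition:
  assumes H4: "H4 f \<Omega>" and sub: "{c..d} \<subseteq> \<Omega>" and "c < d" and "compact H" "compact K" and "\<epsilon> > 0"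
  obtains C \<delta> where "C \<ge> 0" "\<delta> > 0"
    "\<And>s \<xi> n J. s \<in> H \<Longrightarrow> \<xi> \<in> K \<Longrightarrow> n > 0 \<Longrightarrow> (d - c) / real n < \<delta> \<Longrightarrow> J \<subseteq> {..<n} \<Longrightarrow>
       (\<Sum>i\<in>J. \<bar>f (c + real i * ((d - c) / real n)) s \<xi> - f (c + real (Suc i) * ((d - c) / real n)) s \<xi>\<bar>)
         \<le> \<epsilon> + C * (real (card J) * ((d - c) / real n))"
proof -
  let ?fam = "\<lambda>N a b \<delta>. (\<forall>i<N. a i < b i \<and> {a i<..<b i} \<subseteq> {c..d}) \<and>
        (\<forall>i<N. \<forall>j<N. i \<noteq> j \<longrightarrow> {a i<..<b i} \<inter> {a j<..<b j} = {}) \<and> (\<Sum>i<N. b i - a i) < \<delta>"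
  have "\<exists>\<delta>>0. \<forall>s\<in>H. \<forall>\<xi>\<in>K. \<forall>(N::nat) a b. ?fam N a b \<delta> \<longrightarrow> (\<Sum>i<N. \<bar>f (b i) s \<xi> - f (a i) s \<xi>\<bar>) < \<epsilon>"
    by (rule H4[unfolded H4_def, THEN spec[of _ "{c..d}"], THEN spec[of _ H], THEN spec[of _ K], THEN mp,
          THEN spec[of _ \<epsilon>], THEN mp]) (use assms in auto)
  then obtain \<delta> where \<delta>: "\<delta> > 0" and
    ac0: "\<forall>s\<in>H. \<forall>\<xi>\<in>K. \<forall>(N::nat) a b. ?fam N a b \<delta> \<longrightarrow> (\<Sum>i<N. \<bar>f (b i) s \<xi> - f (a i) s \<xi>\<bar>) < \<epsilon>"
    by blast
  have ac: "(\<Sum>i<N. \<bar>f (b i) s \<xi> - f (a i) s \<xi>\<bar>) < \<epsilon>"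
    if "s \<in> H" "\<xi> \<in> K" "\<And>i. i < N \<Longrightarrow> a i < b i \<and> {a i<..<b i} \<subseteq> {c..d}"
      "\<And>i j. i < N \<Longrightarrow> j < N \<Longrightarrow> i \<noteq> j \<Longrightarrow> {a i<..<b i} \<inter> {a j<..<b j} = {}"
      "(\<Sum>i<N. b i - a i) < \<delta>" for s \<xi> a b and N :: nat
    by (rule ac0[rule_format, OF that(1,2)]) (use that(3-5) in blast)
  show ?thesis
  \<comment> \<open>A full block has length at least half of \<delta>, so the rate
    \<open>2 * \<epsilon> / \<delta>\<close> charges at least \<epsilon> for it; the additive
    \<epsilon> pays for the last, incomplete block. Halving the admissible mesh leaves room to hit
    the required range of block lengths.\<close>
  proof (rule that[of "2 * \<epsilon> / \<delta>" "\<delta> / 2"])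
    show "0 \<le> 2 * \<epsilon> / \<delta>" "0 < \<delta> / 2" using \<delta> \<open>\<epsilon> > 0\<close> by auto
    fix s \<xi> and n :: nat and J
    assume s: "s \<in> H" and \<xi>: "\<xi> \<in> K" and n: "n > 0" and mesh: "(d - c) / real n < \<delta> / 2" and J: "J \<subseteq> {..<n}"
    define m where "m = (d - c) / real n"
    define x where "x i = c + real i * m" for i
    define V where "V J = (\<Sum>i\<in>J. \<bar>f (x i) s \<xi> - f (x (Suc i)) s \<xi>\<bar>)" for J
    have m: "0 < m" "m < \<delta> / 2" "real n * m = d - c" using mesh n \<open>c < d\<close> by (auto simp: m_def)
    have xle: "x i \<le> x j" if "i \<le> j" for i j using m that by (simp add: x_def)
    have xs: "x (Suc i) = x i + m" for i by (simp add: x_def algebra_simps)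
    have xin: "x i \<in> {c..d}" if "i \<le> n" for i
      using xle[of 0 i] xle[of i n] that m by (auto simp: x_def)
    have short: "V J \<le> \<epsilon>" if J: "J \<subseteq> {..<n}" "real (card J) * m < \<delta>" for J
    proof -
      have fin: "finite J" using J finite_subset by blast
      obtain e where e: "bij_betw e {..<card J} J"
        using bij_betw_from_nat_into_finite[OF fin] ex_bij_betw_nat_finite[OF fin] by (metis atLeast0LessThan)
      have ein: "e i < n" "e i \<in> J" if "i < card J" for i using e J that by (auto simp: bij_betw_def)
      have "(\<Sum>i<card J. \<bar>f (x (Suc (e i))) s \<xi> - f (x (e i)) s \<xi>\<bar>) < \<epsilon>"
      proof (rule ac[OF s \<xi>])
        show "x (e i) < x (Suc (e i)) \<and> {x (e i)<..<x (Suc (e i))} \<subseteq> {c..d}" if "i < card J" for i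
          using ein(1)[OF that] xin[of "e i"] xin[of "Suc (e i)"] xs m by auto
        show "{x (e i)<..<x (Suc (e i))} \<inter> {x (e j)<..<x (Suc (e j))} = {}" if "i < card J" "j < card J" "i \<noteq> j" for i j
        proof -
          have "e i \<noteq> e j" using e that by (auto simp: bij_betw_def inj_on_def)
          then consider "Suc (e i) \<le> e j" | "Suc (e j) \<le> e i" by linarith
          then show ?thesis by cases (use xle in fastforce)+
        qed
        show "(\<Sum>i<card J. x (Suc (e i)) - x (e i)) < \<delta>" using J(2) by (simp add: xs)
      qed
      also have "(\<Sum>i<card J. \<bar>f (x (Suc (e i))) s \<xi> - f (x (e i)) s \<xi>\<bar>) = V J"
        unfolding V_def by (subst sum.reindex_bij_betw[OF e, symmetric]) (simp add: abs_minus_commute)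
      finally show ?thesis by simp
    qed
    have "V J \<le> \<epsilon> + 2 * \<epsilon> / \<delta> * (real (card J) * m)" using J
    proof (induction "card J" arbitrary: J rule: less_induct)
      case less
      have fin: "finite J" using less finite_subset by blast
      show ?case
      proof (cases "real (card J) * m < \<delta>")
        case True
        have "0 \<le> 2 * \<epsilon> / \<delta> * (real (card J) * m)" using \<delta> \<open>\<epsilon> > 0\<close> m by auto
        then show ?thesis using short[OF less.prems True] by linarith
      next
        case False
        \<comment> \<open>The least number of cells of total length at least half of \<delta>. Since
          one cell is shorter than half of \<delta>, the overshoot keeps \<open>k * m\<close> below
          \<delta> and \<open>short\<close> applies to the block.\<close>
        define k where "k = nat \<lceil>\<delta> / 2 / m\<rceil>"
        have "real k \<ge> \<delta> / 2 / m" "real k < \<delta> / 2 / m + 1"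
          using \<delta> m unfolding k_def by (auto simp: less_ceiling_iff intro: of_nat_ceiling)  linarith+
        then have k: "\<delta> / 2 \<le> real k * m" "real k * m < \<delta>"
          using m by (auto simp: field_simps)
        have "k \<le> card J"
        proof (rule ccontr)
          assume "\<not> k \<le> card J"
          then have "real (card J) * m \<le> real k * m" using m by (intro mult_right_mono) auto
          then show False using False k by simp
        qed
        then obtain J' where J': "J' \<subseteq> J" "card J' = k" using obtain_subset_with_card_n by metis
        have k0: "k > 0" using k \<delta> by (cases k) auto
        have cd: "card (J - J') = card J - k" using J' fin by (simp add: card_Diff_subset finite_subset)
        have "V J = V J' + V (J - J')"
          unfolding V_def by (subst sum.subset_diff[OF J'(1) fin]) (rule add.commute)
        also have "V J' \<le> \<epsilon>" using short[of J'] J' k less.prems by auto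
        also have "V (J - J') \<le> \<epsilon> + 2 * \<epsilon> / \<delta> * (real (card (J - J')) * m)"
          using less.prems k0 \<open>k \<le> card J\<close> by (intro less.hyps) (auto simp: cd)
        finally have "V J \<le> \<epsilon> + (\<epsilon> + 2 * \<epsilon> / \<delta> * ((real (card J) - real k) * m))"
          using \<open>k \<le> card J\<close> by (simp add: cd of_nat_diff)
        moreover have "\<epsilon> \<le> 2 * \<epsilon> / \<delta> * (real k * m)"
          using mult_left_mono[OF k(1), of "2 * \<epsilon> / \<delta>"] \<delta> \<open>\<epsilon> > 0\<close> by simp
        ultimately show ?thesis by (simp add: algebra_simps)
      qed
    qed
    then show "(\<Sum>i\<in>J. \<bar>f (c + real i * ((d - c) / real n)) s \<xi> - f (c + real (Suc i) * ((d - c) / real n)) s \<xi>\<bar>)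
         \<le> \<epsilon> + 2 * \<epsilon> / \<delta> * (real (card J) * ((d - c) / real n))"
      by (simp add: V_def x_def m_def)
  qed
qed

section \<open>The lower bound on a cell\<close>

lemma compact_support_bounded:
  fixes B :: "real \<Rightarrow> real \<Rightarrow> real"
  assumes Bc: "continuous_on ({c..d} \<times> UNIV) (\<lambda>(x, s). B x s)"
    and R: "\<And>x s. x \<in> {c..d} \<Longrightarrow> \<bar>s\<bar> \<ge> R \<Longrightarrow> B x s = 0"
  obtains C where "C \<ge> 0" "\<And>x s. x \<in> {c..d} \<Longrightarrow> \<bar>B x s\<bar> \<le> C"
proof -
  have "bounded ((\<lambda>(x, s). B x s) ` ({c..d} \<times> {-R..R}))"
    by (intro compact_imp_bounded compact_continuous_image compact_Times compact_Icc continuous_on_subset[OF Bc]) auto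
  then obtain C where C: "C > 0" "\<And>z. z \<in> {c..d} \<times> {-R..R} \<Longrightarrow> norm ((\<lambda>(x, s). B x s) z) \<le> C"
    unfolding bounded_pos by blast
  show ?thesis
  proof (rule that[of C])
    fix x s assume x: "x \<in> {c..d}"
    show "\<bar>B x s\<bar> \<le> C"
      using C(2)[of "(x, s)"] C(1) R[OF x, of s] x by (cases "\<bar>s\<bar> \<ge> R") (auto simp: abs_less_iff not_le)
  qed (use C in simp)
qed

text \<open>Uniform continuity is turned into the affine modulus
  \<open>\<epsilon> + D * \<bar>s - t\<bar>\<close>, valid for all \<open>s\<close> and
  \<open>t\<close>. Its linear part is integrated against the convergence in mean, so no almost
  everywhere convergent subsequence has to be extracted.\<close>

lemma zero_order_term_tendsto:
  fixes A :: "real \<Rightarrow> real \<Rightarrow> real"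
  assumes "c \<le> d" and Ac: "continuous_on ({c..d} \<times> UNIV) (\<lambda>(x, s). A x s)"
    and R: "\<And>x s. x \<in> {c..d} \<Longrightarrow> \<bar>s\<bar> \<ge> R \<Longrightarrow> A x s = 0"
    and Um: "\<And>m. continuous_on {c..d} (Um m)" and U: "continuous_on {c..d} U"
    and lim: "(\<lambda>m. integral {c..d} (\<lambda>x. \<bar>Um m x - U x\<bar>)) \<longlonglongrightarrow> 0"
  shows "(\<lambda>m. integral {c..d} (\<lambda>x. A x (Um m x))) \<longlonglongrightarrow> integral {c..d} (\<lambda>x. A x (U x))"
proof -
  obtain C where C: "C \<ge> 0" "\<And>x s. x \<in> {c..d} \<Longrightarrow> \<bar>A x s\<bar> \<le> C"
    using compact_support_bounded[OF Ac R] by blast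
  have cont: "continuous_on {c..d} (\<lambda>x. A x (w x))" if "continuous_on {c..d} w" for w
    by (rule continuous_on_compose2[OF Ac, of _ "\<lambda>y. (y, w y)", simplified])
      (auto intro!: continuous_intros that)
  have modulus: "\<exists>D\<ge>0. \<forall>x\<in>{c..d}. \<forall>s t. \<bar>A x s - A x t\<bar> \<le> \<epsilon> + D * \<bar>s - t\<bar>" if \<epsilon>: "\<epsilon> > 0" for \<epsilon>
  proof -
    have "uniformly_continuous_on ({c..d} \<times> {-R-1..R+1}) (\<lambda>(x, s). A x s)"
      by (intro compact_uniformly_continuous compact_Times compact_Icc continuous_on_subset[OF Ac]) auto
    then obtain r where r: "r > 0" "\<And>x s t. x \<in> {c..d} \<Longrightarrow> s \<in> {-R-1..R+1} \<Longrightarrow> t \<in> {-R-1..R+1} \<Longrightarrow> \<bar>s - t\<bar> < r \<Longrightarrow> \<bar>A x s - A x t\<bar> < \<epsilon>"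
      using \<epsilon> unfolding uniformly_continuous_on_def
      by (auto simp: dist_Pair_Pair dist_real_def)
    \<comment> \<open>For \<open>\<bar>s - t\<bar> \<ge> min r 1\<close> the crude bound
      \<open>2 * C\<close> is at most \<open>D * \<bar>s - t\<bar>\<close>. The threshold 1 ensures
      that if one of two closer points leaves \<open>{-R-1..R+1}\<close>, both lie where
      \<open>A\<close> vanishes.\<close>
    define D where "D = 2 * C / min r 1"
    have "\<bar>A x s - A x t\<bar> \<le> \<epsilon> + D * \<bar>s - t\<bar>" if x: "x \<in> {c..d}" for x s t
    proof (cases "\<bar>s - t\<bar> < min r 1")
      case True
      have "\<bar>A x s - A x t\<bar> \<le> \<epsilon>"
      proof (cases "s \<in> {-R-1..R+1} \<and> t \<in> {-R-1..R+1}")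
        case True
        then show ?thesis using r(2)[OF x, of s t] \<open>\<bar>s - t\<bar> < min r 1\<close> by auto
      next
        case False
        then have "\<bar>s\<bar> \<ge> R" "\<bar>t\<bar> \<ge> R" using True by (auto simp: abs_if split: if_splits)
        then show ?thesis using R[OF x] \<epsilon> by simp
      qed
      moreover have "0 \<le> D * \<bar>s - t\<bar>" using C r by (simp add: D_def)
      ultimately show ?thesis by linarith
    next
      case False
      have "\<bar>A x s - A x t\<bar> \<le> 2 * C" using C(2)[OF x, of s] C(2)[OF x, of t] by linarith
      also have "\<dots> = D * min r 1" using r by (simp add: D_def)
      also have "\<dots> \<le> D * \<bar>s - t\<bar>" using False C r by (intro mult_left_mono) (auto simp: D_def)
      finally show ?thesis using \<epsilon> by simp
    qed
    moreover have "D \<ge> 0" using C r by (simp add: D_def)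
    ultimately show ?thesis by blast
  qed
  show ?thesis
  proof (rule LIMSEQ_I)
    fix r :: real assume "r > 0"
    define \<epsilon> where "\<epsilon> = r / (2 * (d - c + 1))"
    have \<epsilon>: "\<epsilon> > 0" "\<epsilon> * (d - c) < r / 2" using \<open>r > 0\<close> \<open>c \<le> d\<close> by (auto simp: \<epsilon>_def field_simps)
    obtain D where D: "D \<ge> 0" "\<And>x s t. x \<in> {c..d} \<Longrightarrow> \<bar>A x s - A x t\<bar> \<le> \<epsilon> + D * \<bar>s - t\<bar>"
      using modulus[OF \<epsilon>(1)] by blast
    have "(\<lambda>m. D * integral {c..d} (\<lambda>x. \<bar>Um m x - U x\<bar>)) \<longlonglongrightarrow> D * 0"
      by (intro tendsto_intros lim)
    then have "\<forall>\<^sub>F m in sequentially. D * integral {c..d} (\<lambda>x. \<bar>Um m x - U x\<bar>) < r / 2"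
      using \<open>r > 0\<close> by (intro order_tendstoD(2)[of _ "D * 0"]) auto
    then obtain M where M: "\<And>m. m \<ge> M \<Longrightarrow> D * integral {c..d} (\<lambda>x. \<bar>Um m x - U x\<bar>) < r / 2"
      by (auto simp: eventually_sequentially)
    have "norm (integral {c..d} (\<lambda>x. A x (Um m x)) - integral {c..d} (\<lambda>x. A x (U x))) < r" if "m \<ge> M" for m
    proof -
      have i: "(\<lambda>x. A x (Um m x)) integrable_on {c..d}" "(\<lambda>x. A x (U x)) integrable_on {c..d}"
        "(\<lambda>x. \<bar>Um m x - U x\<bar>) integrable_on {c..d}"
        by (intro integrable_continuous_real continuous_intros cont Um U)+
      have "norm (integral {c..d} (\<lambda>x. A x (Um m x)) - integral {c..d} (\<lambda>x. A x (U x)))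
          = norm (integral {c..d} (\<lambda>x. A x (Um m x) - A x (U x)))"
        using i by (simp add: Henstock_Kurzweil_Integration.integral_diff)
      also have "\<dots> \<le> integral {c..d} (\<lambda>x. \<epsilon> + D * \<bar>Um m x - U x\<bar>)"
        by (rule integral_norm_bound_integral)
          (use i D in \<open>auto intro!: integrable_diff integrable_add integrable_on_mult_right\<close>)
      also have "\<dots> = \<epsilon> * (d - c) + D * integral {c..d} (\<lambda>x. \<bar>Um m x - U x\<bar>)"
        using i \<open>c \<le> d\<close> by (subst Henstock_Kurzweil_Integration.integral_add) (auto intro: integrable_on_mult_right)
      also have "\<dots> < r" using M[OF that] \<epsilon> by simp
      finally show ?thesis .
    qed
    then show "\<exists>no. \<forall>n\<ge>no. norm (integral {c..d} (\<lambda>x. A x (Um n x)) - integral {c..d} (\<lambda>x. A x (U x))) < r"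
      by blast
  qed
qed

text \<open>The order of choices matters: \<epsilon> is fixed first through \<open>R\<close> alone,
  which determines \<open>C\<close>; convergence in mean then makes the term with \<open>C\<close>
  small, however large \<open>C\<close> is.\<close>

lemma first_order_term_tendsto:
  fixes B :: "real \<Rightarrow> real \<Rightarrow> real"
  assumes "c < d" and Bc: "continuous_on ({c..d} \<times> UNIV) (\<lambda>(x, s). B x s)"
    and R: "R \<ge> 0" "\<And>x s. x \<in> {c..d} \<Longrightarrow> \<bar>s\<bar> \<ge> R \<Longrightarrow> B x s = 0"
    and ends: "\<And>s. B c s = 0" "\<And>s. B d s = 0"
    and ac: "\<And>\<epsilon>. \<epsilon> > 0 \<Longrightarrow> \<exists>C\<ge>0. \<exists>\<delta>>0. \<forall>s n J. n > 0 \<longrightarrow> (d - c) / real n < \<delta> \<longrightarrow> J \<subseteq> {..<n} \<longrightarrow>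
       (\<Sum>i\<in>J. \<bar>B (c + real i * ((d - c) / real n)) s - B (c + real (Suc i) * ((d - c) / real n)) s\<bar>)
         \<le> \<epsilon> + C * (real (card J) * ((d - c) / real n))"
    and vm: "\<And>m. vm m absolutely_integrable_on {c..d}" and v: "v absolutely_integrable_on {c..d}"
    and Um: "\<And>m x. x \<in> {c..d} \<Longrightarrow> Um m x = km m + integral {c..x} (vm m)"
    and U: "\<And>x. x \<in> {c..d} \<Longrightarrow> U x = k + integral {c..x} v"
    and lim: "(\<lambda>m. integral {c..d} (\<lambda>x. \<bar>Um m x - U x\<bar>)) \<longlonglongrightarrow> 0"
  shows "(\<lambda>m. integral {c..d} (\<lambda>x. B x (Um m x) * vm m x)) \<longlonglongrightarrow> integral {c..d} (\<lambda>x. B x (U x) * v x)"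
proof (rule LIMSEQ_I)
  fix r :: real assume "r > 0"
  obtain CB where CB: "\<And>x s. x \<in> {c..d} \<Longrightarrow> \<bar>B x s\<bar> \<le> CB"
    using compact_support_bounded[OF Bc R(2)] by blast
  \<comment> \<open>The 1 added to \<open>R\<close> covers the case \<open>R = 0\<close> and makes
    \<open>2 * R * \<epsilon> < r / 2\<close> strict.\<close>
  define \<epsilon> where "\<epsilon> = r / (4 * (R + 1))"
  have \<epsilon>: "\<epsilon> > 0" "2 * R * \<epsilon> < r / 2" using \<open>r > 0\<close> R(1) by (auto simp: \<epsilon>_def field_simps)
  obtain C \<delta> where C: "C \<ge> 0" "\<delta> > 0" and ac': "\<And>s n J. n > 0 \<Longrightarrow> (d - c) / real n < \<delta> \<Longrightarrow> J \<subseteq> {..<n} \<Longrightarrow>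
       (\<Sum>i\<in>J. \<bar>B (c + real i * ((d - c) / real n)) s - B (c + real (Suc i) * ((d - c) / real n)) s\<bar>)
         \<le> \<epsilon> + C * (real (card J) * ((d - c) / real n))"
    using ac[OF \<epsilon>(1)] by blast
  have "(\<lambda>m. C * integral {c..d} (\<lambda>x. \<bar>Um m x - U x\<bar>)) \<longlonglongrightarrow> C * 0"
    by (intro tendsto_intros lim)
  then have "\<forall>\<^sub>F m in sequentially. C * integral {c..d} (\<lambda>x. \<bar>Um m x - U x\<bar>) < r / 2"
    using \<open>r > 0\<close> by (intro order_tendstoD(2)[of _ "C * 0"]) auto
  then obtain M where M: "\<And>m. m \<ge> M \<Longrightarrow> C * integral {c..d} (\<lambda>x. \<bar>Um m x - U x\<bar>) < r / 2"
    by (auto simp: eventually_sequentially)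
  have est: "\<bar>integral {c..d} (\<lambda>x. B x (Um m x) * vm m x) - integral {c..d} (\<lambda>x. B x (U x) * v x)\<bar>
      \<le> 2 * R * \<epsilon> + C * integral {c..d} (\<lambda>x. \<bar>Um m x - U x\<bar>)" for m
    by (rule first_order_term_estimate[OF \<open>c < d\<close> Bc CB R ends C(2) less_imp_le[OF \<epsilon>(1)] C(1) ac' vm v Um U])
  have "norm (integral {c..d} (\<lambda>x. B x (Um m x) * vm m x) - integral {c..d} (\<lambda>x. B x (U x) * v x)) < r" if "m \<ge> M" for m
    using est[of m] M[OF that] \<epsilon>(2) unfolding real_norm_def by linarith
  then show "\<exists>no. \<forall>n\<ge>no. norm (integral {c..d} (\<lambda>x. B x (Um n x) * vm n x) - integral {c..d} (\<lambda>x. B x (U x) * v x)) < r"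
    by blast
qed

section \<open>Cutoffs and the lower bound near a compact set\<close>

lemma ennreal_integral_le_nn_integral:
  fixes g :: "'a \<Rightarrow> real"
  assumes "integrable M g"
  shows "ennreal (\<integral>x. g x \<partial>M) \<le> (\<integral>\<^sup>+x. ennreal (g x) \<partial>M)"
proof -
  have i: "integrable M (\<lambda>x. max 0 (g x))" using assms by simp
  have "ennreal (\<integral>x. g x \<partial>M) \<le> ennreal (\<integral>x. max 0 (g x) \<partial>M)"
    by (intro ennreal_leI integral_mono assms i) auto
  also have "\<dots> = (\<integral>\<^sup>+x. ennreal (max 0 (g x)) \<partial>M)"
    using i by (intro nn_integral_eq_integral[symmetric]) auto
  also have "\<dots> = (\<integral>\<^sup>+x. ennreal (g x) \<partial>M)"
    by (intro nn_integral_cong) (auto simp: max_def ennreal_neg)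
  finally show ?thesis .
qed

text \<open>The affine minorant is multiplied by \<open>\<psi>\<close> in \<open>x\<close> and by a
  cutoff in \<open>s\<close>. The coefficients then have bounded support in \<open>s\<close> and the
  slope coefficient vanishes at \<open>c\<close> and \<open>d\<close>, as the two convergence
  results require. The minorized functional converges along the sequence, so its limit bounds the
  lower limit from below.\<close>

lemma lower_bound_with_cutoff:
  fixes f :: "real \<Rightarrow> real \<Rightarrow> real \<Rightarrow> real"
  assumes "c < d" and sub: "{c..d} \<subseteq> \<Omega>"
    and nonneg: "\<And>x s \<xi>. x \<in> \<Omega> \<Longrightarrow> f x s \<xi> \<ge> 0"
    and fc: "continuous_on (\<Omega> \<times> UNIV \<times> UNIV) (\<lambda>(x, s, \<xi>). f x s \<xi>)"
    and conv: "\<And>x s. x \<in> \<Omega> \<Longrightarrow> convex_on UNIV (f x s)" and H4: "H4 f \<Omega>"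
    and vm: "\<And>m. vm m absolutely_integrable_on {c..d}" and v: "v absolutely_integrable_on {c..d}"
    and Um: "\<And>m x. x \<in> {c..d} \<Longrightarrow> Um m x = km m + integral {c..x} (vm m)"
    and U: "\<And>x. x \<in> {c..d} \<Longrightarrow> U x = k + integral {c..x} v"
    and lim: "(\<lambda>m. integral {c..d} (\<lambda>x. \<bar>Um m x - U x\<bar>)) \<longlonglongrightarrow> 0"
    and um: "\<And>m. negligible (N m)" "\<And>m x. x \<in> {c..d} - N m \<Longrightarrow> um m x = Um m x"
    and R: "R \<ge> 0" "\<And>x. x \<in> {c..d} \<Longrightarrow> \<bar>U x\<bar> \<le> R" and h: "h > 0"
    and osc: "\<And>x s \<eta>. x \<in> {c..d} \<Longrightarrow> \<bar>s\<bar> \<le> R + 1 \<Longrightarrow> \<eta> \<in> {p..p+h} \<Longrightarrow> \<bar>f x s \<eta> - f x s p\<bar> \<le> \<epsilon>"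
    and \<psi>: "\<And>x. 0 \<le> \<psi> x" "\<And>x. \<psi> x \<le> 1" "\<And>x y. \<bar>\<psi> x - \<psi> y\<bar> \<le> \<Lambda> * \<bar>x - y\<bar>" "\<And>x. x \<notin> V \<Longrightarrow> \<psi> x = 0"
      "\<psi> c = 0" "\<psi> d = 0"
  shows "ennreal (integral {c..d} (\<lambda>x. \<psi> x * (f x (U x) p + (f x (U x) (p + h) - f x (U x) p) / h * (v x - p) - 2 * \<epsilon>)))
    \<le> liminf (\<lambda>m. \<integral>\<^sup>+x. ennreal (f x (um m x) (vm m x)) * indicator V x \<partial>lebesgue)"
proof -
  \<comment> \<open>Equal to 1 on the range of \<open>U\<close>, so it leaves no trace in the limit,
    and 0 from \<open>R + 1\<close> on, beyond which \<open>osc\<close> gives no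
    information.\<close>
  define \<phi> :: "real \<Rightarrow> real" where "\<phi> s = max 0 (min 1 (R + 1 - \<bar>s\<bar>))" for s
  have \<phi>: "0 \<le> \<phi> s" "\<phi> s \<le> 1" for s by (auto simp: \<phi>_def)
  have \<phi>0: "\<phi> s = 0" if "\<bar>s\<bar> \<ge> R + 1" for s using that by (auto simp: \<phi>_def)
  have \<phi>1: "\<phi> (U x) = 1" if "x \<in> {c..d}" for x using R(2)[OF that] by (auto simp: \<phi>_def)
  have \<phi>c: "continuous_on S \<phi>" for S unfolding \<phi>_def[abs_def] by (intro continuous_intros)
  have \<Lambda>: "\<Lambda> \<ge> 0" using \<psi>(3)[of 0 1] by simp
  have \<psi>c: "continuous_on S \<psi>" for S
  proof (rule continuous_on_subset[of UNIV])
    show "continuous_on UNIV \<psi>"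
      by (rule lipschitz_on_continuous_on[of \<Lambda>], rule lipschitz_onI) (use \<psi>(3) \<Lambda> in \<open>auto simp: dist_real_def\<close>)
  qed simp
  define b where "b x s = (f x s (p + h) - f x s p) / h" for x s
  \<comment> \<open>\<open>A x s + B x s * \<xi>\<close> is \<open>\<psi> x * \<phi> s\<close> times
    the minorant, sorted by powers of \<xi>. Only \<open>B\<close> multiplies a derivative and needs
    absolute continuity in \<open>x\<close>; for \<open>A\<close> continuity is enough.\<close>
  define A where "A x s = \<psi> x * \<phi> s * (f x s p - p * b x s - 2 * \<epsilon>)" for x s
  define B where "B x s = \<psi> x * (\<phi> s * b x s)" for x s
  have fxc: "continuous_on ({c..d} \<times> UNIV) (\<lambda>z. f (fst z) (snd z) \<xi>)" for \<xi>
    using sub by (intro continuous_on_compose2[OF fc, of _ "\<lambda>z. (fst z, snd z, \<xi>)", simplified]) (auto intro!: continuous_intros)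
  have bc: "continuous_on ({c..d} \<times> UNIV) (\<lambda>z. b (fst z) (snd z))"
    unfolding b_def using h by (intro continuous_intros fxc) auto
  have cc: "continuous_on S (\<lambda>z::real \<times> real. \<psi> (fst z))" "continuous_on S (\<lambda>z::real \<times> real. \<phi> (snd z))" for S
    by (rule continuous_on_compose2[OF \<psi>c[of UNIV]] continuous_on_compose2[OF \<phi>c[of UNIV]]; auto intro!: continuous_intros)+
  have Ac: "continuous_on ({c..d} \<times> UNIV) (\<lambda>(x, s). A x s)"
    unfolding A_def case_prod_unfold by (intro continuous_intros cc fxc bc)
  have \<phi>bc: "continuous_on ({c..d} \<times> UNIV) (\<lambda>(x, s). \<phi> s * b x s)"
    unfolding case_prod_unfold by (intro continuous_intros cc fxc bc)
  have Bc: "continuous_on ({c..d} \<times> UNIV) (\<lambda>(x, s). B x s)"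
    unfolding B_def case_prod_unfold by (intro continuous_intros cc fxc bc)
  have A0: "A x s = 0" "B x s = 0" "\<phi> s * b x s = 0" if "\<bar>s\<bar> \<ge> R + 1" for x s
    using \<phi>0[OF that] by (auto simp: A_def B_def)
  have R1: "R + 1 \<ge> 0" using R by simp
  have ac: "\<exists>C\<ge>0. \<exists>\<delta>>0. \<forall>s n J. n > 0 \<longrightarrow> (d - c) / real n < \<delta> \<longrightarrow> J \<subseteq> {..<n} \<longrightarrow>
       (\<Sum>i\<in>J. \<bar>B (c + real i * ((d - c) / real n)) s - B (c + real (Suc i) * ((d - c) / real n)) s\<bar>)
         \<le> \<epsilon>' + C * (real (card J) * ((d - c) / real n))" if \<epsilon>': "\<epsilon>' > 0" for \<epsilon>'
  proof -
    obtain Cb where Cb: "Cb \<ge> 0" "\<And>x s. x \<in> {c..d} \<Longrightarrow> \<bar>\<phi> s * b x s\<bar> \<le> Cb"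
      using compact_support_bounded[OF \<phi>bc A0(3)] by blast
    \<comment> \<open>The slope uses two values of \<open>f\<close>, at \<open>p + h\<close> and at
      \<open>p\<close>, divided by \<open>h\<close>; two errors of this size therefore add up to
      \<open>\<epsilon>'\<close>.\<close>
    have pos: "\<epsilon>' * h / 2 > 0" using \<epsilon>' h by simp
    have cp: "compact {-(R+1)..R+1}" "compact {p, p+h}" by auto
    obtain C \<delta> where C: "C \<ge> 0" "\<delta> > 0" and
      C': "\<And>s \<xi> n J. s \<in> {-(R+1)..R+1} \<Longrightarrow> \<xi> \<in> {p, p+h} \<Longrightarrow> n > 0 \<Longrightarrow> (d - c) / real n < \<delta> \<Longrightarrow> J \<subseteq> {..<n} \<Longrightarrow>
       (\<Sum>i\<in>J. \<bar>f (c + real i * ((d - c) / real n)) s \<xi> - f (c + real (Suc i) * ((d - c) / real n)) s \<xi>\<bar>)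
         \<le> \<epsilon>' * h / 2 + C * (real (card J) * ((d - c) / real n))"
      using H4_uniform_partition[OF H4 sub \<open>c < d\<close> cp pos] by blast
    have "(\<Sum>i\<in>J. \<bar>B (c + real i * ((d - c) / real n)) s - B (c + real (Suc i) * ((d - c) / real n)) s\<bar>)
         \<le> \<epsilon>' + (\<Lambda> * Cb + 2 * C / h) * (real (card J) * ((d - c) / real n))"
      if n: "n > 0" "(d - c) / real n < \<delta>" "J \<subseteq> {..<n}" for s n J
    proof -
      define m where "m = (d - c) / real n"
      define x where "x i = c + real i * m" for i
      have m: "m > 0" "real n * m = d - c" using n \<open>c < d\<close> by (auto simp: m_def)
      have xin: "x i \<in> {c..d}" if "i \<le> n" for i
        using mult_right_mono[of "real i" "real n" m] that m by (auto simp: x_def)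
      have xs: "\<bar>x i - x (Suc i)\<bar> = m" for i using m by (simp add: x_def algebra_simps)
      have "(\<Sum>i\<in>J. \<bar>B (x i) s - B (x (Suc i)) s\<bar>) \<le> \<epsilon>' + (\<Lambda> * Cb + 2 * C / h) * (real (card J) * m)"
      proof (cases "\<bar>s\<bar> \<ge> R + 1")
        case True
        then show ?thesis using A0(2)[OF True] \<epsilon>' \<Lambda> Cb C h m by (simp add: add_nonneg_nonneg)
      next
        case False
        then have s: "s \<in> {-(R+1)..R+1}" by auto
        define F where "F \<xi> i = \<bar>f (x i) s \<xi> - f (x (Suc i)) s \<xi>\<bar>" for \<xi> i
        have each: "\<bar>B (x i) s - B (x (Suc i)) s\<bar> \<le> \<Lambda> * Cb * m + (F (p + h) i + F p i) / h" if i: "i \<in> J" for i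
        proof -
          have "x (Suc i) \<in> {c..d}" using xin[of "Suc i"] n(3) i by auto
          \<comment> \<open>Discrete product rule. The increment of \<open>\<psi>\<close> costs at
            most \<open>\<Lambda> * m\<close> per cell and feeds the part linear in the total
            length; the increment of \<open>b\<close> is left to \<open>H4\<close>.\<close>
          have "B (x i) s - B (x (Suc i)) s = (\<psi> (x i) - \<psi> (x (Suc i))) * (\<phi> s * b (x (Suc i)) s) + \<psi> (x i) * \<phi> s * (b (x i) s - b (x (Suc i)) s)"
            by (simp add: B_def algebra_simps)
          then have "\<bar>B (x i) s - B (x (Suc i)) s\<bar> \<le> \<bar>(\<psi> (x i) - \<psi> (x (Suc i))) * (\<phi> s * b (x (Suc i)) s)\<bar> + \<bar>\<psi> (x i) * \<phi> s * (b (x i) s - b (x (Suc i)) s)\<bar>"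
            by linarith
          also have "\<bar>(\<psi> (x i) - \<psi> (x (Suc i))) * (\<phi> s * b (x (Suc i)) s)\<bar> \<le> (\<Lambda> * m) * Cb"
            unfolding abs_mult[of "\<psi> (x i) - \<psi> (x (Suc i))"]
            using \<psi>(3)[of "x i" "x (Suc i)"] Cb(2)[OF \<open>x (Suc i) \<in> {c..d}\<close>, of s] \<Lambda> m
            by (intro mult_mono) (auto simp: xs)
          also have "\<bar>\<psi> (x i) * \<phi> s * (b (x i) s - b (x (Suc i)) s)\<bar> \<le> 1 * \<bar>b (x i) s - b (x (Suc i)) s\<bar>"
            unfolding abs_mult[of "\<psi> (x i) * \<phi> s"]
            using \<psi>(1,2)[of "x i"] \<phi>[of s] by (intro mult_right_mono) (auto simp: abs_mult intro!: mult_le_one)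
          also have "b (x i) s - b (x (Suc i)) s = ((f (x i) s (p+h) - f (x (Suc i)) s (p+h)) - (f (x i) s p - f (x (Suc i)) s p)) / h"
            by (simp add: b_def diff_divide_distrib[symmetric])
          also have "1 * \<bar>\<dots>\<bar> \<le> (F (p + h) i + F p i) / h"
            using h by (simp add: F_def divide_right_mono)
          finally show ?thesis by (simp add: mult_ac)
        qed
        have "(\<Sum>i\<in>J. \<bar>B (x i) s - B (x (Suc i)) s\<bar>) \<le> (\<Sum>i\<in>J. \<Lambda> * Cb * m + (F (p + h) i + F p i) / h)"
          by (rule sum_mono[OF each])
        also have "\<dots> = \<Lambda> * Cb * (real (card J) * m) + ((\<Sum>i\<in>J. F (p + h) i) + (\<Sum>i\<in>J. F p i)) / h"
          by (simp add: sum.distrib sum_divide_distrib[symmetric])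
        also have "\<dots> \<le> \<Lambda> * Cb * (real (card J) * m) + ((\<epsilon>' * h / 2 + C * (real (card J) * m)) + (\<epsilon>' * h / 2 + C * (real (card J) * m))) / h"
          using C'[OF s _ n, of "p+h"] C'[OF s _ n, of p] h unfolding F_def x_def m_def[symmetric]
          by (intro add_left_mono divide_right_mono add_mono) auto
        also have "\<dots> = \<epsilon>' + (\<Lambda> * Cb + 2 * C / h) * (real (card J) * m)"
          using h by (simp add: field_simps)
        finally show ?thesis .
      qed
      then show ?thesis by (simp add: x_def m_def)
    qed
    moreover have "\<Lambda> * Cb + 2 * C / h \<ge> 0" using \<Lambda> Cb C h by simp
    ultimately show ?thesis using C(2) by blast
  qed
  have Uc: "continuous_on {c..d} U"
    using primitive_continuous[OF v, of k] by (rule continuous_on_eq) (simp add: U)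
  have Umc: "continuous_on {c..d} (Um m)" for m
    using primitive_continuous[OF vm, of "km m"] by (rule continuous_on_eq) (simp add: Um)
  have comp: "continuous_on {c..d} (\<lambda>x. A x (w x))" "continuous_on {c..d} (\<lambda>x. B x (w x))" if "continuous_on {c..d} w" for w
    by (rule continuous_on_compose2[OF Ac, of _ "\<lambda>y. (y, w y)", simplified]
          continuous_on_compose2[OF Bc, of _ "\<lambda>y. (y, w y)", simplified]; auto intro!: continuous_intros that)+
  define g where "g m x = A x (Um m x) + B x (Um m x) * vm m x" for m x
  have ga: "g m absolutely_integrable_on {c..d}" for m
    unfolding g_def[abs_def]
    by (intro set_integral_add absolutely_integrable_continuous_real absolutely_integrable_cont_mult comp Umc vm)
  have Bi: "(\<lambda>x. B x (w x) * y x) integrable_on {c..d}" if "continuous_on {c..d} w" "y absolutely_integrable_on {c..d}" for w y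
    using absolutely_integrable_cont_mult[OF comp(2)[OF that(1)] that(2)] set_lebesgue_integral_eq_integral(1) by blast
  have Ai: "(\<lambda>x. A x (w x)) integrable_on {c..d}" if "continuous_on {c..d} w" for w
    by (intro integrable_continuous_real comp that)
  have "(\<lambda>m. integral {c..d} (\<lambda>x. A x (Um m x)) + integral {c..d} (\<lambda>x. B x (Um m x) * vm m x)) \<longlonglongrightarrow>
      integral {c..d} (\<lambda>x. A x (U x)) + integral {c..d} (\<lambda>x. B x (U x) * v x)"
  proof (intro tendsto_add)
    show "(\<lambda>m. integral {c..d} (\<lambda>x. A x (Um m x))) \<longlonglongrightarrow> integral {c..d} (\<lambda>x. A x (U x))"
      by (rule zero_order_term_tendsto[OF less_imp_le[OF \<open>c < d\<close>] Ac A0(1) Umc Uc lim])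
    have ends: "B c s = 0" "B d s = 0" for s using \<psi>(5,6) by (simp_all add: B_def)
    show "(\<lambda>m. integral {c..d} (\<lambda>x. B x (Um m x) * vm m x)) \<longlonglongrightarrow> integral {c..d} (\<lambda>x. B x (U x) * v x)"
      by (rule first_order_term_tendsto[OF \<open>c < d\<close> Bc R1 A0(2) ends ac vm v Um U lim])
  qed
  moreover have "integral {c..d} (\<lambda>x. A x (Um m x)) + integral {c..d} (\<lambda>x. B x (Um m x) * vm m x) = integral {c..d} (g m)" for m
    unfolding g_def[abs_def]
    by (rule Henstock_Kurzweil_Integration.integral_add[symmetric, OF Ai[OF Umc] Bi[OF Umc vm]])
  moreover have "integral {c..d} (\<lambda>x. A x (U x)) + integral {c..d} (\<lambda>x. B x (U x) * v x)
      = integral {c..d} (\<lambda>x. \<psi> x * (f x (U x) p + (f x (U x) (p + h) - f x (U x) p) / h * (v x - p) - 2 * \<epsilon>))" (is "_ = ?I")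
    unfolding Henstock_Kurzweil_Integration.integral_add[symmetric, OF Ai[OF Uc] Bi[OF Uc v]]
    unfolding b_def[symmetric] by (rule integral_cong) (simp add: A_def B_def \<phi>1 algebra_simps)
  ultimately have glim: "(\<lambda>m. integral {c..d} (g m)) \<longlonglongrightarrow> ?I" by simp
  \<comment> \<open>Where the affine function \<open>t\<close> is negative, scaling by a factor in
    [0,1] keeps it nonpositive, hence below \<open>f \<ge> 0\<close>; where it is nonnegative,
    scaling only lowers it.\<close>
  have minor: "A x s + B x s * \<xi> \<le> f x s \<xi>" if x: "x \<in> {c..d}" for x s \<xi>
  proof (cases "\<bar>s\<bar> \<ge> R + 1")
    case True
    then show ?thesis using A0[OF True] nonneg x sub by auto
  next
    case False
    define t where "t = f x s p + b x s * (\<xi> - p) - 2 * \<epsilon>"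
    have "t \<le> f x s \<xi>"
      unfolding t_def b_def by (rule convex_affine_minorant[OF conv h osc]) (use x sub False in auto)
    moreover have "A x s + B x s * \<xi> = (\<psi> x * \<phi> s) * t" by (simp add: A_def B_def t_def algebra_simps)
    moreover have w: "0 \<le> \<psi> x * \<phi> s" "\<psi> x * \<phi> s \<le> 1" using \<psi>(1,2) \<phi> by (auto intro!: mult_le_one)
    moreover have "0 \<le> f x s \<xi>" using nonneg x sub by auto
    ultimately show ?thesis
      using mult_left_le_one_le[of t "\<psi> x * \<phi> s"] mult_nonneg_nonpos[of "\<psi> x * \<phi> s" t] by (cases "t \<ge> 0") auto
  qed
  have below: "ennreal (integral {c..d} (g m)) \<le> (\<integral>\<^sup>+x. ennreal (f x (um m x) (vm m x)) * indicator V x \<partial>lebesgue)" for m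
  proof -
    have "integral {c..d} (g m) = (\<integral>x. indicator {c..d} x * g m x \<partial>lebesgue)"
      using set_lebesgue_integral_eq_integral(2)[OF ga[of m]] by (simp add: set_lebesgue_integral_def)
    then have "ennreal (integral {c..d} (g m)) \<le> (\<integral>\<^sup>+x. ennreal (indicator {c..d} x * g m x) \<partial>lebesgue)"
      using ennreal_integral_le_nn_integral[of lebesgue "\<lambda>x. indicator {c..d} x * g m x"] ga[of m] by (simp add: set_integrable_def)
    also have "\<dots> \<le> (\<integral>\<^sup>+x. ennreal (f x (um m x) (vm m x)) * indicator V x \<partial>lebesgue)"
    proof (rule nn_integral_mono_AE)
      have "AE x in lebesgue. x \<notin> N m" using um(1)[of m] by (simp add: negligible_iff_null_sets AE_not_in)
      then show "AE x in lebesgue. ennreal (indicator {c..d} x * g m x) \<le> ennreal (f x (um m x) (vm m x)) * indicator V x"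
      proof eventually_elim
        case (elim x)
        show ?case
        proof (cases "x \<in> {c..d} \<and> x \<in> V")
          case True
          then have "g m x \<le> f x (um m x) (vm m x)"
            using minor[of x "Um m x" "vm m x"] um(2)[of x m] elim by (simp add: g_def)
          then show ?thesis using True by (simp add: ennreal_leI)
        next
          case False
          then have "indicator {c..d} x * g m x = 0"
            using \<psi>(4)[of x] by (auto simp: g_def A_def B_def indicator_def)
          then show ?thesis by (simp only: ennreal_0 zero_le)
        qed
      qed
    qed
    finally show ?thesis .
  qed
  have "ennreal ?I = liminf (\<lambda>m. ennreal (integral {c..d} (g m)))"
    by (intro lim_imp_Liminf[symmetric] tendsto_ennrealI glim) simp
  also have "\<dots> \<le> liminf (\<lambda>m. \<integral>\<^sup>+x. ennreal (f x (um m x) (vm m x)) * indicator V x \<partial>lebesgue)"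
    by (intro Liminf_mono always_eventually allI below)
  finally show ?thesis .
qed

text \<open>Cutoffs supported in \<open>V\<close> and in the open cell shrink to the indicator of
  \<open>K\<close>, so the lower bound survives on \<open>K\<close> alone. There \<open>v\<close>
  lies within \<open>{p..p+h}\<close>, so the minorant, evaluated along the limit function, differs
  from \<open>f\<close> by a multiple of \<epsilon>.\<close>

lemma lower_bound_on_cell:
  fixes f :: "real \<Rightarrow> real \<Rightarrow> real \<Rightarrow> real"
  assumes "c < d" and sub: "{c..d} \<subseteq> \<Omega>"
    and nonneg: "\<And>x s \<xi>. x \<in> \<Omega> \<Longrightarrow> f x s \<xi> \<ge> 0"
    and fc: "continuous_on (\<Omega> \<times> UNIV \<times> UNIV) (\<lambda>(x, s, \<xi>). f x s \<xi>)"
    and conv: "\<And>x s. x \<in> \<Omega> \<Longrightarrow> convex_on UNIV (f x s)" and H4: "H4 f \<Omega>"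
    and W: "\<And>m. W11_loc \<Omega> (us m) (vs m)" and v: "v absolutely_integrable_on {c..d}"
    and lim: "L1_loc_conv \<Omega> us u"
    and U: "\<And>x. x \<in> {c..d} \<Longrightarrow> U x = k + integral {c..x} v"
    and N: "negligible N" "\<And>x. x \<in> {c..d} - N \<Longrightarrow> u x = U x"
    and R: "R \<ge> 0" "\<And>x. x \<in> {c..d} \<Longrightarrow> \<bar>U x\<bar> \<le> R" and h: "h > 0"
    and osc: "\<And>x s \<eta>. x \<in> {c..d} \<Longrightarrow> \<bar>s\<bar> \<le> R + 1 \<Longrightarrow> \<eta> \<in> {p..p+h} \<Longrightarrow> \<bar>f x s \<eta> - f x s p\<bar> \<le> \<epsilon>"
    and K: "compact K" "K \<subseteq> {c<..<d}" "open V" "K \<subseteq> V"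
    and vK: "\<And>x. x \<in> K \<Longrightarrow> v x \<in> {p..p+h}" and fK: "\<And>x. x \<in> K \<Longrightarrow> f x (u x) (v x) \<ge> 4 * \<epsilon>"
  shows "(\<integral>\<^sup>+x. ennreal (f x (u x) (v x) - 4 * \<epsilon>) * indicator K x \<partial>lebesgue)
    \<le> liminf (\<lambda>m. \<integral>\<^sup>+x. ennreal (f x (us m x) (vs m x)) * indicator V x \<partial>lebesgue)" (is "_ \<le> ?L")
proof (cases "K = {}")
  \<comment> \<open>The empty set is treated apart because \<open>infdist\<close> to it is 0, which
    would make the cutoffs below identically 1.\<close>
  case False
  have vm: "vs m absolutely_integrable_on {c..d}" for m
    using W[of m] sub by (auto simp: W11_loc_def L1_loc_def)
  have "\<exists>k N. negligible N \<and> (\<forall>x \<in> {c..d} - N. us m x = k + integral {c..x} (vs m))" for m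
    using W11_loc_representative[OF W[of m] sub \<open>c < d\<close>] by metis
  then obtain km Nm where Nm: "\<And>m. negligible (Nm m)"
    and km: "\<And>m x. x \<in> {c..d} - Nm m \<Longrightarrow> us m x = km m + integral {c..x} (vs m)" by metis
  define Um where "Um m x = km m + integral {c..x} (vs m)" for m x
  have Uc: "continuous_on {c..d} U"
    using primitive_continuous[OF v, of k] by (rule continuous_on_eq) (simp add: U)
  have Umc: "continuous_on {c..d} (Um m)" for m
    unfolding Um_def[abs_def] by (rule primitive_continuous[OF vm])
  have "(\<integral>\<^sup>+ x. ennreal \<bar>us m x - u x\<bar> * indicator {c..d} x \<partial>lebesgue) = ennreal (integral {c..d} (\<lambda>x. \<bar>Um m x - U x\<bar>))" for m
  proof -
    have "AE x in lebesgue. x \<notin> N \<union> Nm m"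
      using negligible_Un[OF N(1) Nm[of m]] by (simp only: negligible_iff_null_sets AE_not_in)
    then have "(\<integral>\<^sup>+ x. ennreal \<bar>us m x - u x\<bar> * indicator {c..d} x \<partial>lebesgue) = (\<integral>\<^sup>+ x. ennreal \<bar>Um m x - U x\<bar> * indicator {c..d} x \<partial>lebesgue)"
    proof (intro nn_integral_cong_AE, eventually_elim)
      case (elim x)
      then show ?case using N(2)[of x] km[of x m] by (cases "x \<in> {c..d}") (auto simp: Um_def)
    qed
    also have "\<dots> = ennreal (integral {c..d} (\<lambda>x. \<bar>Um m x - U x\<bar>))"
      unfolding nn_integral_completion
      by (intro nn_integral_has_integral_lebesgue' integrable_integral integrable_continuous_real continuous_intros Umc Uc) auto
    finally show ?thesis .
  qed
  moreover have "(\<lambda>m. \<integral>\<^sup>+ x. ennreal \<bar>us m x - u x\<bar> * indicator {c..d} x \<partial>lebesgue) \<longlonglongrightarrow> 0"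
    using lim sub by (simp add: L1_loc_conv_def)
  ultimately have lim': "(\<lambda>m. integral {c..d} (\<lambda>x. \<bar>Um m x - U x\<bar>)) \<longlonglongrightarrow> 0"
    by (subst ennreal_tendsto_0_iff[symmetric]) (auto intro!: integral_nonneg integrable_continuous_real continuous_intros Umc Uc)
  define b where "b x = (f x (U x) (p + h) - f x (U x) p) / h" for x
  define y where "y x = f x (U x) p + b x * (v x - p) - 2 * \<epsilon>" for x
  have fxc: "continuous_on {c..d} (\<lambda>x. f x (U x) \<xi>)" for \<xi>
    using sub by (intro continuous_on_compose2[OF fc, of _ "\<lambda>x. (x, U x, \<xi>)", simplified]) (auto intro!: continuous_intros Uc)
  have bc: "continuous_on {c..d} b"
    unfolding b_def[abs_def] using h by (intro continuous_intros fxc) auto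
  have "(\<lambda>x. (f x (U x) p - b x * p - 2 * \<epsilon>) + b x * v x) absolutely_integrable_on {c..d}"
    by (intro set_integral_add absolutely_integrable_continuous_real absolutely_integrable_cont_mult continuous_intros fxc bc v)
  then have ya: "y absolutely_integrable_on {c..d}"
    unfolding y_def[abs_def] by (simp add: algebra_simps)
  obtain \<rho> where \<rho>: "\<rho> > 0" "(\<Union>x\<in>K. ball x \<rho>) \<subseteq> V \<inter> {c<..<d}"
  proof (rule compact_subset_open_imp_ball_epsilon_subset[OF K(1), of "V \<inter> {c<..<d}"])
    show "open (V \<inter> {c<..<d})" using K(3) by (intro open_Int) auto
  qed (use K in auto)
  have near: "x \<in> V \<inter> {c<..<d}" if "infdist x K < \<rho>" for x
  proof -
    obtain a where "a \<in> K" "infdist x K = dist x a"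
      using infdist_attains_inf[OF compact_imp_closed[OF K(1)] False] by blast
    then have "x \<in> (\<Union>x\<in>K. ball x \<rho>)" using that by (auto simp: dist_commute)
    then show ?thesis using \<rho>(2) by blast
  qed
  \<comment> \<open>Lipschitz with constant \<open>real (Suc j) / \<rho>\<close>, equal to 1 on
    \<open>K\<close>, and already for \<open>j = 0\<close> zero outside the \<rho>-neighbourhood of
    \<open>K\<close>.\<close>
  define \<psi> where "\<psi> j x = max 0 (1 - real (Suc j) / \<rho> * infdist x K)" for j x
  have \<psi>b: "0 \<le> \<psi> j x" "\<psi> j x \<le> 1" for j x
    using \<rho> by (auto simp: \<psi>_def infdist_nonneg)
  have \<psi>out: "\<psi> j x = 0" if "x \<notin> V \<inter> {c<..<d}" for j x
  proof -
    have "\<rho> \<le> infdist x K" using near[of x] that not_le by blast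
    then have "1 * \<rho> \<le> real (Suc j) * infdist x K"
      using \<rho>(1) by (intro mult_mono) auto
    then show ?thesis using \<rho> by (simp add: \<psi>_def field_simps)
  qed
  have \<psi>lip: "\<bar>\<psi> j x - \<psi> j z\<bar> \<le> real (Suc j) / \<rho> * \<bar>x - z\<bar>" for j x z
  proof -
    let ?l = "real (Suc j) / \<rho>"
    have "\<bar>infdist x K - infdist z K\<bar> \<le> \<bar>x - z\<bar>"
      using infdist_triangle[of x K z] infdist_triangle[of z K x] by (auto simp: dist_real_def)
    then have "\<bar>?l * infdist x K - ?l * infdist z K\<bar> \<le> ?l * \<bar>x - z\<bar>"
      using \<rho> unfolding right_diff_distrib[symmetric] abs_mult by (intro mult_mono) auto
    then show ?thesis unfolding \<psi>_def by linarith
  qed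
  have low: "ennreal (integral {c..d} (\<lambda>x. \<psi> j x * y x)) \<le> ?L" for j
    unfolding y_def b_def
    by (rule lower_bound_with_cutoff[OF \<open>c < d\<close> sub nonneg fc conv H4 vm v _ U lim' Nm _ R h osc \<psi>b \<psi>lip])
      (use km \<psi>out in \<open>auto simp: Um_def\<close>)
  have "(\<lambda>j. integral {c..d} (\<lambda>x. \<psi> j x * y x)) \<longlonglongrightarrow> integral {c..d} (\<lambda>x. if x \<in> K then y x else 0)"
  proof (rule dominated_convergence(2))
    have \<psi>c: "continuous_on {c..d} (\<psi> j)" for j
      unfolding \<psi>_def[abs_def] by (intro continuous_intros)
    show "(\<lambda>x. \<psi> j x * y x) integrable_on {c..d}" for j
      using absolutely_integrable_cont_mult[OF \<psi>c ya] set_lebesgue_integral_eq_integral(1) by blast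
    show "(\<lambda>x. \<bar>y x\<bar>) integrable_on {c..d}" using ya by (simp add: absolutely_integrable_on_def)
    show "norm (\<psi> j x * y x) \<le> \<bar>y x\<bar>" for j x
      using \<psi>b[of j x] by (simp add: abs_mult mult_left_le_one_le)
    fix x
    show "(\<lambda>j. \<psi> j x * y x) \<longlonglongrightarrow> (if x \<in> K then y x else 0)"
    proof (cases "x \<in> K")
      case True
      then show ?thesis by (simp add: \<psi>_def)
    next
      case out: False
      have pos: "infdist x K > 0"
        using infdist_pos_not_in_closed[OF compact_imp_closed[OF K(1)] False out] .
      obtain J where J: "\<rho> / infdist x K < real J" using reals_Archimedean2 by blast
      have "\<psi> j x = 0" if "j \<ge> J" for j
      proof -
        have "\<rho> < real J * infdist x K" using J pos by (simp add: field_simps)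
        also have "\<dots> \<le> real (Suc j) * infdist x K" using that pos by (intro mult_right_mono) auto
        finally show ?thesis using \<rho> by (simp add: \<psi>_def field_simps)
      qed
      then have "\<forall>\<^sub>F j in sequentially. \<psi> j x * y x = 0"
        by (intro eventually_sequentiallyI[of J]) simp
      then show ?thesis using out by (simp add: tendsto_eventually)
    qed
  qed
  also have "integral {c..d} (\<lambda>x. if x \<in> K then y x else 0) = integral K y"
  proof -
    have "K \<inter> {c..d} = K" using K by auto
    then show ?thesis using integral_restrict_Int[of "{c..d}" K y] by simp
  qed
  finally have "(\<lambda>j. ennreal (integral {c..d} (\<lambda>x. \<psi> j x * y x))) \<longlonglongrightarrow> ennreal (integral K y)"
    by (rule tendsto_ennrealI)
  then have le: "ennreal (integral K y) \<le> ?L"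
    using low by (intro LIMSEQ_le_const2) auto
  have Kcd: "K \<subseteq> {c..d}" using K(2) by auto
  have yK: "y absolutely_integrable_on K"
    by (rule set_integrable_subset[OF ya]) (use borel_compact[OF K(1)] Kcd in auto)
  \<comment> \<open>Of the four \<epsilon>, two are subtracted in \<open>y\<close>, one compares
    \<open>f\<close> at \<open>v x\<close> with \<open>f\<close> at \<open>p\<close>, and one bounds
    \<open>b x * (v x - p)\<close>, a fraction of the increment of \<open>f\<close> over
    \<open>{p..p+h}\<close>.\<close>
  have ptw: "f x (u x) (v x) - 4 * \<epsilon> \<le> y x" if x: "x \<in> K" "x \<notin> N" for x
  proof -
    have xcd: "x \<in> {c..d}" using x Kcd by auto
    have Ux: "\<bar>U x\<bar> \<le> R + 1" using R(2)[OF xcd] by simp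
    have eq: "u x = U x" using N(2)[of x] xcd x by auto
    have \<epsilon>0: "0 \<le> \<epsilon>" using osc[OF xcd Ux, of p] h by simp
    have 1: "\<bar>f x (U x) (v x) - f x (U x) p\<bar> \<le> \<epsilon>" by (rule osc[OF xcd Ux vK[OF x(1)]])
    have "b x * (v x - p) = (f x (U x) (p + h) - f x (U x) p) * ((v x - p) / h)" by (simp add: b_def)
    then have "\<bar>b x * (v x - p)\<bar> = \<bar>f x (U x) (p + h) - f x (U x) p\<bar> * \<bar>(v x - p) / h\<bar>" by (simp only: abs_mult)
    also have "\<dots> \<le> \<epsilon> * 1"
      using osc[OF xcd Ux, of "p + h"] vK[OF x(1)] h \<epsilon>0 by (intro mult_mono) auto
    finally show ?thesis using 1 unfolding y_def eq by (simp add: abs_le_iff)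
  qed
  have ae: "AE x in lebesgue. x \<notin> N" using N(1) by (simp add: negligible_iff_null_sets AE_not_in)
  have "(\<integral>\<^sup>+x. ennreal (f x (u x) (v x) - 4 * \<epsilon>) * indicator K x \<partial>lebesgue) \<le> (\<integral>\<^sup>+x. ennreal (indicator K x * y x) \<partial>lebesgue)"
    using ae by (intro nn_integral_mono_AE) (auto elim!: eventually_mono simp: indicator_def ptw ennreal_leI)
  also have "\<dots> = ennreal (\<integral>x. indicator K x * y x \<partial>lebesgue)"
  proof (rule nn_integral_eq_integral)
    show "integrable lebesgue (\<lambda>x. indicator K x * y x)" using yK by (simp add: set_integrable_def)
    \<comment> \<open>The assumption \<open>fK\<close> makes the minorant nonnegative on
      \<open>K\<close>, so its signed integral is the nonnegative one.\<close>
    show "AE x in lebesgue. 0 \<le> indicator K x * y x"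
      using ae
    proof eventually_elim
      case (elim x)
      then show ?case using ptw[of x] fK[of x] by (cases "x \<in> K") auto
    qed
  qed
  also have "(\<integral>x. indicator K x * y x \<partial>lebesgue) = integral K y"
    using set_lebesgue_integral_eq_integral(2)[OF yK] by (simp add: set_lebesgue_integral_def)
  finally show ?thesis using le by simp
qed simp

section \<open>Localization\<close>

lemma ennreal_liminf_add_le:
  fixes a b :: "nat \<Rightarrow> ennreal"
  shows "liminf a + liminf b \<le> liminf (\<lambda>n. a n + b n)"
proof -
  have inc: "incseq (\<lambda>n. INF m\<in>{n..}. q m)" for q :: "nat \<Rightarrow> ennreal"
    by (intro incseq_SucI INF_superset_mono) auto
  have "liminf a + liminf b = (SUP n. (INF m\<in>{n..}. a m) + (INF m\<in>{n..}. b m))"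
    unfolding liminf_SUP_INF by (rule ennreal_SUP_add[symmetric, OF inc inc])
  also have "\<dots> \<le> liminf (\<lambda>n. a n + b n)"
    unfolding liminf_SUP_INF
    by (intro SUP_mono' INF_greatest add_mono INF_lower) auto
  finally show ?thesis .
qed

text \<open>A Lebesgue set is a countable union of closed sets up to a null set; intersecting the
  partial unions with growing balls makes them compact.\<close>

lemma inner_compact_approximation:
  fixes E :: "real set"
  assumes "E \<in> sets lebesgue"
  obtains K :: "nat \<Rightarrow> real set" where "\<And>n. compact (K n)" "\<And>n. K n \<subseteq> E" "incseq K" "E - (\<Union>n. K n) \<in> null_sets lebesgue"
proof -
  obtain C T where C: "fsigma C" and T: "T \<in> null_sets lebesgue" "C \<union> T = E" "disjnt C T"
    using lebesgue_set_almost_fsigma[OF assms] by blast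
  from C obtain F :: "nat \<Rightarrow> real set" where F: "\<And>n. closed (F n)" "C = (\<Union>n. F n)"
    by (auto elim!: fsigma.cases)
  define K where "K n = (\<Union>i\<le>n. F i) \<inter> cball 0 (real n)" for n
  have un: "(\<Union>n. K n) = C"
  proof
    show "C \<subseteq> (\<Union>n. K n)"
    proof
      fix x assume "x \<in> C"
      then obtain i where i: "x \<in> F i" using F by auto
      obtain j where j: "norm x \<le> real j" using real_arch_simple by blast
      have "x \<in> K (max i j)" using i j by (auto simp: K_def le_max_iff_disj intro!: bexI[of _ i])
      then show "x \<in> (\<Union>n. K n)" by blast
    qed
  qed (use F in \<open>auto simp: K_def\<close>)
  show ?thesis
  proof (rule that[of K])
    show "compact (K n)" for n
      unfolding K_def using F(1) by (intro closed_Int_compact closed_UN) auto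
    show "K n \<subseteq> E" for n using un T by blast
    show "incseq K" by (rule incseq_SucI) (force simp: K_def le_Suc_eq)
    have "E - (\<Union>n. K n) = T" using un T by (auto simp: disjnt_def)
    then show "E - (\<Union>n. K n) \<in> null_sets lebesgue" using T by simp
  qed
qed

text \<open>Disjoint compact sets have disjoint open neighbourhoods, so local bounds on finitely
  many of them add up without counting any mass of \<open>g m\<close> twice. This is why
  \<open>loc\<close> is demanded for every open \<open>V\<close> around \<open>K\<close>: the
  neighbourhoods must be free to shrink.\<close>

lemma nn_integral_le_liminf_localization:
  fixes G :: "real \<Rightarrow> ennreal" and g :: "nat \<Rightarrow> real \<Rightarrow> ennreal" and E :: "nat \<Rightarrow> real set"
  assumes G [measurable]: "G \<in> borel_measurable lebesgue" and g [measurable]: "\<And>m. g m \<in> borel_measurable lebesgue"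
    and E: "\<And>n. E n \<in> sets lebesgue" "disjoint_family E"
    and loc: "\<And>n K V. compact K \<Longrightarrow> K \<subseteq> E n \<Longrightarrow> open V \<Longrightarrow> K \<subseteq> V \<Longrightarrow>
      (\<integral>\<^sup>+x. G x * indicator K x \<partial>lebesgue) \<le> liminf (\<lambda>m. \<integral>\<^sup>+x. g m x * indicator V x \<partial>lebesgue)"
  shows "(\<integral>\<^sup>+x. G x * indicator (\<Union>n. E n) x \<partial>lebesgue) \<le> liminf (\<lambda>m. \<integral>\<^sup>+x. g m x \<partial>lebesgue)"
proof -
  have lebo: "V \<in> sets lebesgue" if "open V" for V :: "real set" using that by auto
  have lebc: "K \<in> sets lebesgue" if "compact K" for K :: "real set" using borel_compact[OF that] by auto
  \<comment> \<open>Keeping all neighbourhoods \<open>V\<close> inside the predicate lets the union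
    step pass to smaller ones.\<close>
  define P where "P K \<longleftrightarrow> (\<forall>V. open V \<longrightarrow> K \<subseteq> V \<longrightarrow>
    (\<integral>\<^sup>+x. G x * indicator K x \<partial>lebesgue) \<le> liminf (\<lambda>m. \<integral>\<^sup>+x. g m x * indicator V x \<partial>lebesgue))" for K
  have P_Un: "P (A \<union> B)" if AB: "compact A" "compact B" "A \<inter> B = {}" "P A" "P B" for A B
    unfolding P_def
  proof (intro allI impI)
    fix V :: "real set" assume V: "open V" "A \<union> B \<subseteq> V"
    obtain S T where ST: "open S" "open T" "A \<subseteq> S" "B \<subseteq> T" "S \<inter> T = {}"
      using separation_normal_compact[OF AB(1) compact_imp_closed[OF AB(2)] AB(3)] by metis
    have [measurable]: "S \<inter> V \<in> sets lebesgue" "T \<inter> V \<in> sets lebesgue" "A \<in> sets lebesgue" "B \<in> sets lebesgue"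
      using ST V AB lebc by (auto intro!: lebo)
    have "(\<integral>\<^sup>+x. G x * indicator (A \<union> B) x \<partial>lebesgue) = (\<integral>\<^sup>+x. G x * indicator A x + G x * indicator B x \<partial>lebesgue)"
      using AB(3) by (intro nn_integral_cong) (auto simp: indicator_def)
    also have "\<dots> = (\<integral>\<^sup>+x. G x * indicator A x \<partial>lebesgue) + (\<integral>\<^sup>+x. G x * indicator B x \<partial>lebesgue)"
      by (intro nn_integral_add) measurable
    also have "\<dots> \<le> liminf (\<lambda>m. \<integral>\<^sup>+x. g m x * indicator (S \<inter> V) x \<partial>lebesgue) + liminf (\<lambda>m. \<integral>\<^sup>+x. g m x * indicator (T \<inter> V) x \<partial>lebesgue)"
      using AB(4,5) ST V unfolding P_def by (intro add_mono) (auto simp: open_Int)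
    also have "\<dots> \<le> liminf (\<lambda>m. (\<integral>\<^sup>+x. g m x * indicator (S \<inter> V) x \<partial>lebesgue) + (\<integral>\<^sup>+x. g m x * indicator (T \<inter> V) x \<partial>lebesgue))"
      by (rule ennreal_liminf_add_le)
    also have "\<dots> \<le> liminf (\<lambda>m. \<integral>\<^sup>+x. g m x * indicator V x \<partial>lebesgue)"
    proof (intro Liminf_mono always_eventually allI)
      fix m
      have "(\<integral>\<^sup>+x. g m x * indicator (S \<inter> V) x \<partial>lebesgue) + (\<integral>\<^sup>+x. g m x * indicator (T \<inter> V) x \<partial>lebesgue)
          = (\<integral>\<^sup>+x. g m x * indicator (S \<inter> V) x + g m x * indicator (T \<inter> V) x \<partial>lebesgue)"
        by (intro nn_integral_add[symmetric]) measurable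
      also have "\<dots> \<le> (\<integral>\<^sup>+x. g m x * indicator V x \<partial>lebesgue)"
        using ST(5) by (intro nn_integral_mono) (auto simp: indicator_def)
      finally show "(\<integral>\<^sup>+x. g m x * indicator (S \<inter> V) x \<partial>lebesgue) + (\<integral>\<^sup>+x. g m x * indicator (T \<inter> V) x \<partial>lebesgue)
          \<le> (\<integral>\<^sup>+x. g m x * indicator V x \<partial>lebesgue)" .
    qed
    finally show "(\<integral>\<^sup>+x. G x * indicator (A \<union> B) x \<partial>lebesgue) \<le> liminf (\<lambda>m. \<integral>\<^sup>+x. g m x * indicator V x \<partial>lebesgue)" .
  qed
  have "\<exists>K. (\<forall>k. compact (K k) \<and> K k \<subseteq> E n) \<and> incseq K \<and> E n - (\<Union>k. K k) \<in> null_sets lebesgue" for n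
    using inner_compact_approximation[OF E(1)[of n]] by metis
  then obtain K where K: "\<And>n k. compact (K n k)" "\<And>n k. K n k \<subseteq> E n" "\<And>n. incseq (K n)"
    "\<And>n. E n - (\<Union>k. K n k) \<in> null_sets lebesgue"
    by metis
  \<comment> \<open>A diagonal choice: finitely many cells at each stage keep the set compact, while
    both the number of cells and the quality of approximation grow with \<open>k\<close>.\<close>
  define C where "C k = (\<Union>n<k. K n k)" for k
  have PK: "compact (\<Union>n<j. K n k) \<and> P (\<Union>n<j. K n k)" for j k
  proof (induction j)
    case 0
    then show ?case by (simp add: P_def)
  next
    case (Suc j)
    have disj: "(\<Union>n<j. K n k) \<inter> K j k = {}"
    proof -
      have "K n k \<inter> K j k = {}" if "n < j" for n
        using K(2)[of n k] K(2)[of j k] E(2) that unfolding disjoint_family_on_def by (metis UNIV_I disjoint_iff less_irrefl subset_iff)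
      then show ?thesis by blast
    qed
    have "P (K j k)" unfolding P_def using loc[OF K(1) K(2)] by blast
    then have "P ((\<Union>n<j. K n k) \<union> K j k)" using P_Un[OF _ K(1) disj] Suc by blast
    moreover have "(\<Union>n<Suc j. K n k) = (\<Union>n<j. K n k) \<union> K j k" by (auto simp: lessThan_Suc)
    ultimately show ?case using Suc K(1) by (simp add: compact_Un)
  qed
  have Cle: "(\<integral>\<^sup>+x. G x * indicator (C k) x \<partial>lebesgue) \<le> liminf (\<lambda>m. \<integral>\<^sup>+x. g m x \<partial>lebesgue)" for k
    using PK[of k k, THEN conjunct2, unfolded P_def, rule_format, of UNIV] by (simp add: C_def)
  have Cinc: "incseq C"
  proof (rule incseq_SucI)
    fix k
    have "K n k \<subseteq> K n (Suc k)" for n using K(3)[of n] by (simp add: incseq_SucD)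
    then show "C k \<subseteq> C (Suc k)" unfolding C_def by (intro UN_mono) auto
  qed
  have [measurable]: "C k \<in> sets lebesgue" for k using PK[of k k] lebc by (simp add: C_def)
  have CU: "(\<Union>k. C k) = (\<Union>n. \<Union>k. K n k)"
  proof
    show "(\<Union>n. \<Union>k. K n k) \<subseteq> (\<Union>k. C k)"
    proof clarify
      fix x n k assume "x \<in> K n k"
      \<comment> \<open>The index must be at least \<open>k\<close> to contain the point and exceed
        \<open>n\<close> for the n-th cell to take part in the union.\<close>
      then have "x \<in> K n (max k (Suc n))" using K(3)[of n] by (meson incseq_def max.cobounded1 subsetD)
      then have "x \<in> C (max k (Suc n))" unfolding C_def by (intro UN_I[of n]) auto
      then show "x \<in> (\<Union>k. C k)" by blast
    qed
  qed (auto simp: C_def)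
  have null: "(\<Union>n. E n - (\<Union>k. K n k)) \<in> null_sets lebesgue" by (intro null_sets_UN K(4))
  have "(\<integral>\<^sup>+x. G x * indicator (\<Union>n. E n) x \<partial>lebesgue) = (\<integral>\<^sup>+x. (SUP k. G x * indicator (C k) x) \<partial>lebesgue)"
  proof (rule nn_integral_cong_AE)
    from AE_not_in[OF null] show "AE x in lebesgue. G x * indicator (\<Union>n. E n) x = (SUP k. G x * indicator (C k) x)"
    proof eventually_elim
      case (elim x)
      show ?case
      proof (cases "x \<in> (\<Union>n. E n)")
        case True
        then obtain n where "x \<in> E n" by auto
        with elim have "x \<in> (\<Union>k. K n k)" by auto
        then have "x \<in> (\<Union>k. C k)" unfolding CU by auto
        then obtain j where "x \<in> C j" by auto
        then have "G x \<le> (SUP k. G x * indicator (C k) x)"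
          by (intro SUP_upper2[of j]) auto
        moreover have "(SUP k. G x * indicator (C k) x) \<le> G x"
          by (intro SUP_least) (auto simp: indicator_def)
        ultimately show ?thesis using True by (simp add: antisym)
      next
        case False
        then have "x \<notin> C k" for k using K(2) by (auto simp: C_def)
        then show ?thesis using False by simp
      qed
    qed
  qed
  also have "\<dots> = (SUP k. \<integral>\<^sup>+x. G x * indicator (C k) x \<partial>lebesgue)"
  proof (rule nn_integral_monotone_convergence_SUP)
    show "incseq (\<lambda>k x. G x * indicator (C k) x)"
      using Cinc by (auto simp: incseq_def le_fun_def indicator_def subset_iff)
  qed measurable
  also have "\<dots> \<le> liminf (\<lambda>m. \<integral>\<^sup>+x. g m x \<partial>lebesgue)" by (intro SUP_least Cle)
  finally show ?thesis .
qed

section \<open>Lower semicontinuity\<close>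

lemma L1_loc_measurable:
  assumes "open \<Omega>" and u: "L1_loc \<Omega> u"
  shows "(\<lambda>x. if x \<in> \<Omega> then u x else 0) \<in> borel_measurable lebesgue"
proof -
  have "\<exists>C :: nat \<Rightarrow> real set. (\<forall>n. compact (C n) \<and> C n \<subseteq> \<Omega>) \<and> (\<forall>K. compact K \<and> K \<subseteq> \<Omega> \<longrightarrow> (\<exists>N. \<forall>n\<ge>N. K \<subseteq> C n))"
  proof (rule open_Union_compact_subsets[OF assms(1)])
    fix C :: "nat \<Rightarrow> real set"
    assume "\<And>n. compact (C n)" "\<And>n. C n \<subseteq> \<Omega>" "\<And>K. \<lbrakk>compact K; K \<subseteq> \<Omega>\<rbrakk> \<Longrightarrow> \<exists>N. \<forall>n\<ge>N. K \<subseteq> C n"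
    then show ?thesis by (intro exI[of _ C]) blast
  qed
  then obtain C :: "nat \<Rightarrow> real set" where C: "\<forall>n. compact (C n) \<and> C n \<subseteq> \<Omega>"
    and C': "\<forall>K. compact K \<and> K \<subseteq> \<Omega> \<longrightarrow> (\<exists>N. \<forall>n\<ge>N. K \<subseteq> C n)"
    by (elim exE conjE)
  show ?thesis
  proof (rule borel_measurable_LIMSEQ_real)
    show "(\<lambda>x. indicator (C n) x * u x) \<in> borel_measurable lebesgue" for n
      using u C by (auto simp: L1_loc_def set_integrable_def intro!: borel_measurable_integrable)
    show "(\<lambda>n. indicator (C n) x * u x) \<longlonglongrightarrow> (if x \<in> \<Omega> then u x else 0)" for x
    proof (cases "x \<in> \<Omega>")
      case True
      then obtain N where "\<And>n. n \<ge> N \<Longrightarrow> x \<in> C n" using C'[rule_format, of "{x}"] by auto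
      then have "\<forall>\<^sub>F n in sequentially. indicator (C n) x * u x = u x"
        by (intro eventually_sequentiallyI[of N]) simp
      then show ?thesis using True by (simp add: tendsto_eventually)
    next
      case False
      then have "x \<notin> C n" for n using C by blast
      then show ?thesis using False by simp
    qed
  qed
qed

lemma integrand_measurable:
  fixes f :: "real \<Rightarrow> real \<Rightarrow> real \<Rightarrow> real"
  assumes "open \<Omega>" and fc: "continuous_on (\<Omega> \<times> UNIV \<times> UNIV) (\<lambda>(x, s, \<xi>). f x s \<xi>)"
    and "L1_loc \<Omega> u" "L1_loc \<Omega> v"
  shows "(\<lambda>x. if x \<in> \<Omega> then f x (u x) (v x) else 0) \<in> borel_measurable lebesgue"
proof -
  let ?e = "\<lambda>w x. if x \<in> \<Omega> then w x else 0 :: real"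
  let ?D = "\<Omega> \<times> (UNIV :: (real \<times> real) set)"
  have D: "?D \<in> sets borel" using \<open>open \<Omega>\<close> by (intro borel_open open_Times) auto
  have F: "(\<lambda>z. indicator ?D z *\<^sub>R (\<lambda>(x, s, \<xi>). f x s \<xi>) z) \<in> borel_measurable borel"
    by (rule borel_measurable_continuous_on_indicator[OF D]) (use fc in simp)
  have "(\<lambda>x. (x, ?e u x, ?e v x)) \<in> borel_measurable lebesgue"
    by (intro borel_measurable_Pair L1_loc_measurable assms measurable_completion) simp
  from measurable_compose[OF this F]
  have "(\<lambda>x. indicator ?D (x, ?e u x, ?e v x) *\<^sub>R f x (?e u x) (?e v x)) \<in> borel_measurable lebesgue"
    by simp
  also have "(\<lambda>x. indicator ?D (x, ?e u x, ?e v x) *\<^sub>R f x (?e u x) (?e v x)) = (\<lambda>x. if x \<in> \<Omega> then f x (u x) (v x) else 0)"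
    by (auto simp: indicator_def)
  finally show ?thesis .
qed

text \<open>The extra unit in the range of \<open>s\<close> leaves room for the cutoff in the value variable.\<close>

definition cell :: "(real \<Rightarrow> real \<Rightarrow> real \<Rightarrow> real) \<Rightarrow> real set \<Rightarrow> (real \<Rightarrow> real) \<Rightarrow> (real \<Rightarrow> real) \<Rightarrow> real
    \<Rightarrow> real \<Rightarrow> real \<Rightarrow> real \<Rightarrow> real \<Rightarrow> bool" where
  "cell f \<Omega> u v \<epsilon> c d p h \<longleftrightarrow> c < d \<and> {c..d} \<subseteq> \<Omega> \<and> h > 0 \<and>
    (\<exists>U k N R. (\<forall>x\<in>{c..d}. U x = k + integral {c..x} v) \<and> negligible N \<and> (\<forall>x\<in>{c..d} - N. u x = U x) \<and>
      R \<ge> 0 \<and> (\<forall>x\<in>{c..d}. \<bar>U x\<bar> \<le> R) \<and>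
      (\<forall>x\<in>{c..d}. \<forall>s. \<bar>s\<bar> \<le> R + 1 \<longrightarrow> (\<forall>\<eta>\<in>{p..p+h}. \<bar>f x s \<eta> - f x s p\<bar> \<le> \<epsilon>)))"

text \<open>Rational parameters leave only countably many cells. The choices depend on each other in
  one direction: the interval determines the representative and its bound \<open>R\<close>, these
  determine the compact set for uniform continuity, which gives \<open>h\<close>, and
  \<open>p\<close> comes last.\<close>

lemma rational_cell_exists:
  fixes f :: "real \<Rightarrow> real \<Rightarrow> real \<Rightarrow> real" and \<xi> :: real
  assumes "open \<Omega>" and fc: "continuous_on (\<Omega> \<times> UNIV \<times> UNIV) (\<lambda>(x, s, \<xi>). f x s \<xi>)"
    and W: "W11_loc \<Omega> u v" and x: "x \<in> \<Omega>" and "\<epsilon> > 0"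
  obtains c d p h :: rat where "cell f \<Omega> u v \<epsilon> (of_rat c) (of_rat d) (of_rat p) (of_rat h)"
    "x \<in> {of_rat c<..<of_rat d}" "\<xi> \<in> {of_rat p..of_rat p + of_rat h}"
proof -
  obtain e where e: "e > 0" "ball x e \<subseteq> \<Omega>" using \<open>open \<Omega>\<close> x open_contains_ball by blast
  obtain c :: rat where c: "x - e < of_rat c" "of_rat c < x"
    using of_rat_dense[of "x - e" x] e by auto
  obtain d :: rat where d: "x < of_rat d" "of_rat d < x + e"
    using of_rat_dense[of x "x + e"] e by auto
  let ?c = "of_rat c :: real" and ?d = "of_rat d :: real"
  have cd: "?c < ?d" using c d by linarith
  have sub: "{?c..?d} \<subseteq> \<Omega>"
  proof -
    have "{?c..?d} \<subseteq> ball x e" using c d by (auto simp: dist_real_def)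
    then show ?thesis using e(2) by blast
  qed
  have v: "v absolutely_integrable_on {?c..?d}" using W sub by (auto simp: W11_loc_def L1_loc_def)
  obtain k N where N: "negligible N" "\<And>y. y \<in> {?c..?d} - N \<Longrightarrow> u y = k + integral {?c..y} v"
    using W11_loc_representative[OF W sub cd] by blast
  define U where "U y = k + integral {?c..y} v" for y
  have Uc: "continuous_on {?c..?d} U"
    unfolding U_def[abs_def] by (rule primitive_continuous[OF v])
  obtain R where R: "R \<ge> 0" "\<And>y. y \<in> {?c..?d} \<Longrightarrow> \<bar>U y\<bar> \<le> R"
    using continuous_on_Icc_bounded[OF Uc] by blast
  \<comment> \<open>The unit margin around \<xi> is fixed before \<open>p\<close> and
    \<open>h\<close> are known; \<open>h < 1\<close> and \<open>\<xi> - h < p < \<xi>\<close> later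
    keep \<open>{p..p+h}\<close> inside it.\<close>
  let ?K = "{?c..?d} \<times> {-(R+1)..R+1} \<times> {\<xi>-1..\<xi>+1}"
  have "uniformly_continuous_on ?K (\<lambda>(x, s, \<xi>). f x s \<xi>)"
    using sub by (intro compact_uniformly_continuous compact_Times compact_Icc continuous_on_subset[OF fc]) auto
  then obtain \<rho> where \<rho>: "\<rho> > 0" "\<And>z z'. z \<in> ?K \<Longrightarrow> z' \<in> ?K \<Longrightarrow> dist z' z < \<rho> \<Longrightarrow>
      dist ((\<lambda>(x, s, \<xi>). f x s \<xi>) z') ((\<lambda>(x, s, \<xi>). f x s \<xi>) z) < \<epsilon>"
    using \<open>\<epsilon> > 0\<close> unfolding uniformly_continuous_on_def by meson
  obtain h :: rat where h: "0 < (of_rat h :: real)" "of_rat h < min \<rho> 1"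
    using of_rat_dense[of 0 "min \<rho> 1"] \<rho> by auto
  obtain p :: rat where p: "\<xi> - of_rat h < of_rat p" "of_rat p < \<xi>"
    using of_rat_dense[of "\<xi> - of_rat h" \<xi>] h by auto
  have osc: "\<bar>f y s \<eta> - f y s (of_rat p)\<bar> \<le> \<epsilon>"
    if "y \<in> {?c..?d}" "\<bar>s\<bar> \<le> R + 1" "\<eta> \<in> {of_rat p..of_rat p + of_rat h}" for y s \<eta>
  proof -
    have "dist (y, s, \<eta>) (y, s, of_rat p) < \<rho>"
      using that(3) h by (auto simp: dist_Pair_Pair dist_real_def)
    moreover have "\<xi> - 1 \<le> of_rat p" "of_rat p + of_rat h \<le> \<xi> + 1" "(of_rat p :: real) \<le> of_rat p + of_rat h"
      using p h by linarith+
    then have "(y, s, \<eta>) \<in> ?K" "(y, s, of_rat p) \<in> ?K"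
      using that by auto
    ultimately show ?thesis using \<rho>(2)[of "(y, s, of_rat p)" "(y, s, \<eta>)"] by (simp add: dist_real_def)
  qed
  have "cell f \<Omega> u v \<epsilon> ?c ?d (of_rat p) (of_rat h)"
    unfolding cell_def
    using cd sub h(1) N R osc
    by (intro conjI exI[of _ U] exI[of _ k] exI[of _ N] exI[of _ R]) (auto simp: U_def)
  then show ?thesis using that c d p h by auto
qed

text \<open>Points with \<open>f < 4 * \<epsilon>\<close> contribute nothing, since
  \<open>ennreal\<close> sends negative numbers to 0. Hence only the part of \<open>\<Omega>\<close>
  where \<open>f \<ge> 4 * \<epsilon>\<close> must be covered by cells, and there the lower bound on
  a cell is available.\<close>

lemma truncated_lower_semicontinuity:
  fixes f :: "real \<Rightarrow> real \<Rightarrow> real \<Rightarrow> real"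
  assumes "open \<Omega>" and nonneg: "\<And>x s \<xi>. x \<in> \<Omega> \<Longrightarrow> f x s \<xi> \<ge> 0"
    and fc: "continuous_on (\<Omega> \<times> UNIV \<times> UNIV) (\<lambda>(x, s, \<xi>). f x s \<xi>)"
    and conv: "\<And>x s. x \<in> \<Omega> \<Longrightarrow> convex_on UNIV (f x s)" and H4: "H4 f \<Omega>"
    and W: "\<And>m. W11_loc \<Omega> (us m) (vs m)" and Wu: "W11_loc \<Omega> u v"
    and lim: "L1_loc_conv \<Omega> us u" and \<epsilon>: "\<epsilon> > 0"
  shows "(\<integral>\<^sup>+x. ennreal (f x (u x) (v x) - 4 * \<epsilon>) * indicator \<Omega> x \<partial>lebesgue)
    \<le> liminf (\<lambda>m. F_functional f \<Omega> (us m) (vs m))"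
proof -
  define g where "g x = (if x \<in> \<Omega> then f x (u x) (v x) else 0)" for x
  define G where "G x = ennreal (g x - 4 * \<epsilon>)" for x
  define gm where "gm m x = ennreal (f x (us m x) (vs m x)) * indicator \<Omega> x" for m x
  \<comment> \<open>Only the extension by zero is measurable on the whole line; it agrees with
    \<open>v\<close> on every cell.\<close>
  define w where "w x = (if x \<in> \<Omega> then v x else 0)" for x
  have Lu: "L1_loc \<Omega> u" "L1_loc \<Omega> v" using Wu by (auto simp: W11_loc_def)
  have [measurable]: "g \<in> borel_measurable lebesgue"
    unfolding g_def[abs_def] using \<open>open \<Omega>\<close> fc Lu by (rule integrand_measurable)
  have [measurable]: "w \<in> borel_measurable lebesgue"
    unfolding w_def[abs_def] using \<open>open \<Omega>\<close> Lu(2) by (rule L1_loc_measurable)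
  have Gm: "G \<in> borel_measurable lebesgue" unfolding G_def[abs_def] by measurable
  have gmm: "gm m \<in> borel_measurable lebesgue" for m
  proof -
    have "L1_loc \<Omega> (us m)" "L1_loc \<Omega> (vs m)" using W[of m] by (auto simp: W11_loc_def)
    then have "(\<lambda>x. if x \<in> \<Omega> then f x (us m x) (vs m x) else 0) \<in> borel_measurable lebesgue"
      by (intro integrand_measurable \<open>open \<Omega>\<close> fc)
    then have "(\<lambda>x. ennreal (if x \<in> \<Omega> then f x (us m x) (vs m x) else 0)) \<in> borel_measurable lebesgue"
      by measurable
    also have "(\<lambda>x. ennreal (if x \<in> \<Omega> then f x (us m x) (vs m x) else 0)) = gm m"
      by (auto simp: gm_def)
    finally show ?thesis .
  qed
  define q where "q n = (from_nat n :: rat \<times> rat \<times> rat \<times> rat)" for n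
  \<comment> \<open>Quadruples that do not describe a cell get the empty set, so a point of
    \<open>E n\<close> certifies the cell conditions. The sets overlap and are made disjoint before
    gluing; compact subsets of the disjoint pieces still lie in \<open>E n\<close>.\<close>
  define E where "E n = (case q n of (c, d, p, h) \<Rightarrow>
    if cell f \<Omega> u v \<epsilon> (of_rat c) (of_rat d) (of_rat p) (of_rat h)
    then {x \<in> {of_rat c<..<of_rat d}. w x \<in> {of_rat p..of_rat p + of_rat h} \<and> g x \<ge> 4 * \<epsilon>} else {})" for n
  have Es: "E n \<in> sets lebesgue" for n
  proof -
    have [measurable]: "(\<lambda>x::real. x) \<in> borel_measurable lebesgue" by (rule measurable_completion) simp
    have "{x \<in> {a<..<b}. w x \<in> {a'..b'} \<and> g x \<ge> 4 * \<epsilon>} \<in> sets lebesgue" for a b a' b'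
    proof -
      have "{x \<in> space lebesgue. a < x \<and> x < b \<and> a' \<le> w x \<and> w x \<le> b' \<and> g x \<ge> 4 * \<epsilon>} \<in> sets lebesgue"
        by measurable
      then show ?thesis by (simp add: conj_assoc)
    qed
    then show ?thesis by (auto simp: E_def split: prod.split)
  qed
  have "(\<integral>\<^sup>+x. G x * indicator (\<Union>n. disjointed E n) x \<partial>lebesgue) \<le> liminf (\<lambda>m. \<integral>\<^sup>+x. gm m x \<partial>lebesgue)"
  proof (rule nn_integral_le_liminf_localization[OF Gm gmm])
    show "disjointed E n \<in> sets lebesgue" for n
      unfolding disjointed_def using Es by auto
    show "disjoint_family (disjointed E)" by (rule disjoint_family_disjointed)
    fix n and K V :: "real set"
    assume K: "compact K" "K \<subseteq> disjointed E n" and V: "open V" "K \<subseteq> V"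
    show "(\<integral>\<^sup>+x. G x * indicator K x \<partial>lebesgue) \<le> liminf (\<lambda>m. \<integral>\<^sup>+x. gm m x * indicator V x \<partial>lebesgue)"
    proof (cases "K = {}")
      case False
      have KE: "K \<subseteq> E n" using K(2) disjointed_subset[of E n] by blast
      obtain c d p h where qn: "q n = (c, d, p, h)" by (cases "q n")
      let ?c = "of_rat c :: real" and ?d = "of_rat d :: real" and ?p = "of_rat p :: real" and ?h = "of_rat h :: real"
      have cell: "cell f \<Omega> u v \<epsilon> ?c ?d ?p ?h" using KE False by (auto simp: E_def qn split: if_splits)
      then have Kin: "x \<in> {?c<..<?d} \<and> w x \<in> {?p..?p + ?h} \<and> g x \<ge> 4 * \<epsilon>" if "x \<in> K" for x
        using KE that by (auto simp: E_def qn)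
      from cell obtain U k N R where cd: "?c < ?d" and sub: "{?c..?d} \<subseteq> \<Omega>" and h: "?h > 0"
        and U: "\<And>x. x \<in> {?c..?d} \<Longrightarrow> U x = k + integral {?c..x} v"
        and N: "negligible N" "\<And>x. x \<in> {?c..?d} - N \<Longrightarrow> u x = U x"
        and R: "R \<ge> 0" "\<And>x. x \<in> {?c..?d} \<Longrightarrow> \<bar>U x\<bar> \<le> R"
        and osc: "\<And>x s \<eta>. x \<in> {?c..?d} \<Longrightarrow> \<bar>s\<bar> \<le> R + 1 \<Longrightarrow> \<eta> \<in> {?p..?p + ?h} \<Longrightarrow> \<bar>f x s \<eta> - f x s ?p\<bar> \<le> \<epsilon>"
        unfolding cell_def by blast
      have K\<Omega>: "x \<in> \<Omega>" if "x \<in> K" for x using Kin[OF that] sub by auto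
      have v: "v absolutely_integrable_on {?c..?d}" using Lu(2) sub by (auto simp: L1_loc_def)
      have "(\<integral>\<^sup>+x. ennreal (f x (u x) (v x) - 4 * \<epsilon>) * indicator K x \<partial>lebesgue)
        \<le> liminf (\<lambda>m. \<integral>\<^sup>+x. ennreal (f x (us m x) (vs m x)) * indicator (V \<inter> \<Omega>) x \<partial>lebesgue)"
      proof (rule lower_bound_on_cell[OF cd sub nonneg fc conv H4 W v lim U N R h osc K(1)])
        show "K \<subseteq> {?c<..<?d}" using Kin by blast
        show "open (V \<inter> \<Omega>)" using V \<open>open \<Omega>\<close> by (rule_tac open_Int)
        show "K \<subseteq> V \<inter> \<Omega>" using V K\<Omega> by blast
        show "v x \<in> {?p..?p + ?h}" if "x \<in> K" for x using Kin[OF that] K\<Omega>[OF that] by (simp add: w_def)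
        show "4 * \<epsilon> \<le> f x (u x) (v x)" if "x \<in> K" for x using Kin[OF that] K\<Omega>[OF that] by (simp add: g_def)
      qed
      moreover have "(\<integral>\<^sup>+x. ennreal (f x (u x) (v x) - 4 * \<epsilon>) * indicator K x \<partial>lebesgue) = (\<integral>\<^sup>+x. G x * indicator K x \<partial>lebesgue)"
        by (intro nn_integral_cong) (use K\<Omega> in \<open>auto simp: G_def g_def indicator_def\<close>)
      moreover have "(\<integral>\<^sup>+x. ennreal (f x (us m x) (vs m x)) * indicator (V \<inter> \<Omega>) x \<partial>lebesgue) = (\<integral>\<^sup>+x. gm m x * indicator V x \<partial>lebesgue)" for m
        by (intro nn_integral_cong) (auto simp: gm_def indicator_def)
      ultimately show ?thesis by simp
    qed simp
  qed
  also have "(\<integral>\<^sup>+x. G x * indicator (\<Union>n. disjointed E n) x \<partial>lebesgue)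
      = (\<integral>\<^sup>+x. ennreal (f x (u x) (v x) - 4 * \<epsilon>) * indicator \<Omega> x \<partial>lebesgue)"
  proof (rule nn_integral_cong)
    fix x
    show "G x * indicator (\<Union>n. disjointed E n) x = ennreal (f x (u x) (v x) - 4 * \<epsilon>) * indicator \<Omega> x"
    proof (cases "x \<in> \<Omega> \<and> g x \<ge> 4 * \<epsilon>")
      case True
      then obtain c d p h :: rat where cell: "cell f \<Omega> u v \<epsilon> (of_rat c) (of_rat d) (of_rat p) (of_rat h)"
        "x \<in> {of_rat c<..<of_rat d}" "v x \<in> {of_rat p..of_rat p + of_rat h}"
        using rational_cell_exists[OF \<open>open \<Omega>\<close> fc Wu _ \<epsilon>] by blast
      define n where "n = to_nat (c, d, p, h)"
      have "q n = (c, d, p, h)" by (simp add: q_def n_def)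
      then have "x \<in> E n" using cell True by (simp add: E_def w_def)
      then have "x \<in> (\<Union>n. disjointed E n)" unfolding UN_disjointed_eq by blast
      then show ?thesis using True by (simp add: G_def g_def)
    next
      case False
      then have "G x = 0" using \<epsilon> by (auto simp: G_def g_def ennreal_neg split: if_splits)
      moreover have "ennreal (f x (u x) (v x) - 4 * \<epsilon>) * indicator \<Omega> x = 0"
        using False by (auto simp: g_def ennreal_neg indicator_def)
      ultimately show ?thesis by simp
    qed
  qed
  finally show ?thesis by (simp add: F_functional_def gm_def)
qed

theorem theorem1p5:
  fixes f :: "real \<Rightarrow> real \<Rightarrow> real \<Rightarrow> real" and \<Omega> :: "real set"
    and us vs :: "nat \<Rightarrow> real \<Rightarrow> real" and u v :: "real \<Rightarrow> real"
  assumes "open \<Omega>"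
    and "\<forall>x\<in>\<Omega>. \<forall>s \<xi>. f x s \<xi> \<ge> 0"
    and "continuous_on (\<Omega> \<times> UNIV \<times> UNIV) (\<lambda>(x, s, \<xi>). f x s \<xi>)"
    and "\<forall>x\<in>\<Omega>. \<forall>s. convex_on UNIV (f x s)"
    and "H4 f \<Omega>"
    and "\<forall>m. W11_loc \<Omega> (us m) (vs m)"
    and "W11_loc \<Omega> u v"
    and "L1_loc_conv \<Omega> us u"
  shows "F_functional f \<Omega> u v \<le> liminf (\<lambda>m. F_functional f \<Omega> (us m) (vs m))"
proof -
  let ?L = "liminf (\<lambda>m. F_functional f \<Omega> (us m) (vs m))"
  define g where "g x = (if x \<in> \<Omega> then f x (u x) (v x) else 0)" for x
  \<comment> \<open>The previous bound is used with \<epsilon> a quarter of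
    \<open>inverse (real (Suc n))\<close>. The truncations increase to \<open>g\<close>, so monotone
    convergence removes the loss even when the integral is infinite; outside \<open>\<Omega>\<close>
    the negative argument becomes 0.\<close>
  define G where "G n x = ennreal (g x - inverse (real (Suc n)))" for n x
  have [measurable]: "g \<in> borel_measurable lebesgue"
    unfolding g_def[abs_def] using assms by (intro integrand_measurable) (auto simp: W11_loc_def)
  have le: "(\<integral>\<^sup>+x. G n x \<partial>lebesgue) \<le> ?L" for n
  proof -
    have "(\<integral>\<^sup>+x. G n x \<partial>lebesgue) = (\<integral>\<^sup>+x. ennreal (f x (u x) (v x) - 4 * (inverse (real (Suc n)) / 4)) * indicator \<Omega> x \<partial>lebesgue)"
      by (intro nn_integral_cong) (auto simp: G_def g_def indicator_def ennreal_neg)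
    also have "\<dots> \<le> ?L"
      by (rule truncated_lower_semicontinuity) (use assms in auto)
    finally show ?thesis .
  qed
  have inc: "incseq G"
    unfolding incseq_def le_fun_def G_def
    by (intro allI impI ennreal_leI diff_left_mono le_imp_inverse_le) auto
  have sup: "(SUP n. G n x) = ennreal (g x)" for x
  proof (rule LIMSEQ_unique[OF LIMSEQ_SUP])
    show "incseq (\<lambda>n. G n x)" using inc by (auto simp: incseq_def le_fun_def)
    have "(\<lambda>n. g x - inverse (real (Suc n))) \<longlonglongrightarrow> g x - 0"
      by (intro tendsto_intros LIMSEQ_inverse_real_of_nat)
    then show "(\<lambda>n. G n x) \<longlonglongrightarrow> ennreal (g x)"
      unfolding G_def by (intro tendsto_ennrealI) simp
  qed
  have "F_functional f \<Omega> u v = (\<integral>\<^sup>+x. (SUP n. G n x) \<partial>lebesgue)"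
    unfolding F_functional_def sup by (intro nn_integral_cong) (auto simp: g_def)
  also have "\<dots> = (SUP n. \<integral>\<^sup>+x. G n x \<partial>lebesgue)"
  proof (rule nn_integral_monotone_convergence_SUP[OF inc])
    show "G n \<in> borel_measurable lebesgue" for n unfolding G_def[abs_def] by measurable
  qed
  also have "\<dots> \<le> ?L" by (intro SUP_least le)
  finally show ?thesis .
qed

end
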